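(* Let $A$ be a $C^*$-algebra. Then $A$ is amenable if and only if for every essential Banach $A$-bimodule $X$ and every bounded hyperlocal operator $D\colon A\to X^*$, there are $x^*,y^*\in X^*$ such that $D(a)=ax^*-y^*a$ for all $a\in A$.
   Context: Operators are linear. For a Banach $A$-bimodule $X$, the dual $X^*$ is a Banach $A$-bimodule via $\langle ax^*,x\rangle=\langle x^*,xa\rangle$ and $\langle x^*a,x\rangle=\langle x^*,ax\rangle$. $X$ is essential if it is essential as a left and as a right $A$-module, i.e. the closed linear spans of $\{ax: a\in A, x\in X\}$ and of $\{xa: a\in A, x\in X\}$ both equal $X$. For a Banach $A$-bimodule $Y$, an operator $D\colon A\to Y$ is hyperlocal if, for $a,b,c\in A$, $ac=cb=0$ implies $aD(c)b=0$. A derivation $D\colon A\to Y$ is a linear map with $D(ab)=aD(b)+D(a)b$; it is inner if there is $y\in Y$ with $D(a)=ay-ya$ for all $a\in A$. $A$ is amenable if for every Banach $A$-bimodule $X$, every bounded derivation $D\colon A\to X^*$ is inner. *)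

theory Defs
  imports "HOL-Analysis.Analysis"
begin

(* Complex Banach algebras and C*-algebras, not assumed unital. The classes real_normed_algebra and
   banach supply the real normed algebra and its completeness; scaleC extends the real scaling. *)

class complex_banach_algebra = real_normed_algebra + banach +
  fixes scaleC :: "complex \<Rightarrow> 'a \<Rightarrow> 'a"  (infixr "*\<^sub>C" 75)
  assumes scaleC_of_real: "of_real r *\<^sub>C a = r *\<^sub>R a"
    and scaleC_scaleC: "z *\<^sub>C w *\<^sub>C a = (z * w) *\<^sub>C a"
    and scaleC_add_left: "(z + w) *\<^sub>C a = z *\<^sub>C a + w *\<^sub>C a"
    and scaleC_add_right: "z *\<^sub>C (a + b) = z *\<^sub>C a + z *\<^sub>C b"
    and mult_scaleC_left: "(z *\<^sub>C a) * b = z *\<^sub>C (a * b)"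
    and mult_scaleC_right: "a * (z *\<^sub>C b) = z *\<^sub>C (a * b)"
    and norm_scaleC: "norm (z *\<^sub>C a) = cmod z * norm a"

class cstar_algebra = complex_banach_algebra +
  fixes star :: "'a \<Rightarrow> 'a"
  assumes star_star: "star (star a) = a"
    and star_add: "star (a + b) = star a + star b"
    and star_scaleC: "star (z *\<^sub>C a) = cnj z *\<^sub>C star a"
    and star_mult: "star (a * b) = star b * star a"
    and cstar_identity: "norm (star a * a) = (norm a)\<^sup>2"

(* Bimodules are carrier-based structures, because definitions and theorems below quantify over all
   Banach bimodules and form duals, neither of which can be done with one type per module. *)

record 'x normed_space =
  carrier :: "'x set"
  zero :: 'x  ("\<zero>\<index>")
  add :: "'x \<Rightarrow> 'x \<Rightarrow> 'x"  (infixl "\<oplus>\<index>" 65)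
  smult :: "complex \<Rightarrow> 'x \<Rightarrow> 'x"  (infixr "\<odot>\<index>" 75)
  nrm :: "'x \<Rightarrow> real"

record ('a, 'x) bimodule = "'x normed_space" +
  lact :: "'a \<Rightarrow> 'x \<Rightarrow> 'x"  (infixr "\<rhd>\<index>" 70)
  ract :: "'x \<Rightarrow> 'a \<Rightarrow> 'x"  (infixl "\<lhd>\<index>" 70)

definition vdiff :: "('x, 'm) normed_space_scheme \<Rightarrow> 'x \<Rightarrow> 'x \<Rightarrow> 'x"  (infixl "\<ominus>\<index>" 65)
  where "x \<ominus>\<^bsub>X\<^esub> y = x \<oplus>\<^bsub>X\<^esub> (- 1) \<odot>\<^bsub>X\<^esub> y"

(* The value outside the carrier is fixed because the locale Metric_space demands symmetry and
   nonnegativity of the distance on the whole type. *)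

definition vdist :: "('x, 'm) normed_space_scheme \<Rightarrow> 'x \<Rightarrow> 'x \<Rightarrow> real"
  where "vdist X x y =
    (if x \<in> carrier X \<and> y \<in> carrier X then nrm X (x \<ominus>\<^bsub>X\<^esub> y) else 0)"

locale complex_banach_space =
  fixes X :: "('x, 'm) normed_space_scheme" (structure)
  assumes zero_closed: "\<zero> \<in> carrier X"
    and add_closed: "\<lbrakk>x \<in> carrier X; y \<in> carrier X\<rbrakk> \<Longrightarrow> x \<oplus> y \<in> carrier X"
    and smult_closed: "x \<in> carrier X \<Longrightarrow> z \<odot> x \<in> carrier X"
    and add_assoc: "\<lbrakk>x \<in> carrier X; y \<in> carrier X; w \<in> carrier X\<rbrakk> \<Longrightarrow> (x \<oplus> y) \<oplus> w = x \<oplus> (y \<oplus> w)"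
    and add_commute: "\<lbrakk>x \<in> carrier X; y \<in> carrier X\<rbrakk> \<Longrightarrow> x \<oplus> y = y \<oplus> x"
    and add_zero: "x \<in> carrier X \<Longrightarrow> x \<oplus> \<zero> = x"
    and minus_self: "x \<in> carrier X \<Longrightarrow> x \<ominus> x = \<zero>"
    and smult_one: "x \<in> carrier X \<Longrightarrow> 1 \<odot> x = x"
    and smult_smult: "x \<in> carrier X \<Longrightarrow> z \<odot> (v \<odot> x) = (z * v) \<odot> x"
    and smult_add_left: "x \<in> carrier X \<Longrightarrow> (z + v) \<odot> x = z \<odot> x \<oplus> v \<odot> x"
    and smult_add_right: "\<lbrakk>x \<in> carrier X; y \<in> carrier X\<rbrakk> \<Longrightarrow> z \<odot> (x \<oplus> y) = z \<odot> x \<oplus> z \<odot> y"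
    and nrm_eq_zero: "x \<in> carrier X \<Longrightarrow> nrm X x = 0 \<longleftrightarrow> x = \<zero>"
    and nrm_triangle: "\<lbrakk>x \<in> carrier X; y \<in> carrier X\<rbrakk> \<Longrightarrow> nrm X (x \<oplus> y) \<le> nrm X x + nrm X y"
    and nrm_smult: "x \<in> carrier X \<Longrightarrow> nrm X (z \<odot> x) = cmod z * nrm X x"
    and complete: "Metric_space.mcomplete (carrier X) (vdist X)"

(* The module actions are bounded, not necessarily contractive. *)

locale banach_bimodule = complex_banach_space X
  for X :: "('a::complex_banach_algebra, 'x) bimodule" (structure) +
  assumes lact_closed: "x \<in> carrier X \<Longrightarrow> a \<rhd> x \<in> carrier X"
    and lact_add_left: "x \<in> carrier X \<Longrightarrow> (a + b) \<rhd> x = (a \<rhd> x) \<oplus> (b \<rhd> x)"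
    and lact_add_right:
      "\<lbrakk>x \<in> carrier X; y \<in> carrier X\<rbrakk> \<Longrightarrow> a \<rhd> (x \<oplus> y) = (a \<rhd> x) \<oplus> (a \<rhd> y)"
    and lact_scaleC: "x \<in> carrier X \<Longrightarrow> (z *\<^sub>C a) \<rhd> x = z \<odot> (a \<rhd> x)"
    and lact_smult: "x \<in> carrier X \<Longrightarrow> a \<rhd> (z \<odot> x) = z \<odot> (a \<rhd> x)"
    and lact_mult: "x \<in> carrier X \<Longrightarrow> (a * b) \<rhd> x = a \<rhd> (b \<rhd> x)"
    and lact_bounded: "\<exists>K. \<forall>a. \<forall>x\<in>carrier X. nrm X (a \<rhd> x) \<le> K * norm a * nrm X x"
    and ract_closed: "x \<in> carrier X \<Longrightarrow> x \<lhd> a \<in> carrier X"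
    and ract_add_right: "x \<in> carrier X \<Longrightarrow> x \<lhd> (a + b) = (x \<lhd> a) \<oplus> (x \<lhd> b)"
    and ract_add_left:
      "\<lbrakk>x \<in> carrier X; y \<in> carrier X\<rbrakk> \<Longrightarrow> (x \<oplus> y) \<lhd> a = (x \<lhd> a) \<oplus> (y \<lhd> a)"
    and ract_scaleC: "x \<in> carrier X \<Longrightarrow> x \<lhd> (z *\<^sub>C a) = z \<odot> (x \<lhd> a)"
    and ract_smult: "x \<in> carrier X \<Longrightarrow> (z \<odot> x) \<lhd> a = z \<odot> (x \<lhd> a)"
    and ract_mult: "x \<in> carrier X \<Longrightarrow> x \<lhd> (a * b) = (x \<lhd> a) \<lhd> b"
    and ract_bounded: "\<exists>K. \<forall>a. \<forall>x\<in>carrier X. nrm X (x \<lhd> a) \<le> K * norm a * nrm X x"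
    and lact_ract: "x \<in> carrier X \<Longrightarrow> (a \<rhd> x) \<lhd> b = a \<rhd> (x \<lhd> b)"

definition linear_subspace :: "('x, 'm) normed_space_scheme \<Rightarrow> 'x set \<Rightarrow> bool"
  where "linear_subspace X V \<longleftrightarrow> V \<subseteq> carrier X \<and> \<zero>\<^bsub>X\<^esub> \<in> V
    \<and> (\<forall>x\<in>V. \<forall>y\<in>V. x \<oplus>\<^bsub>X\<^esub> y \<in> V) \<and> (\<forall>z. \<forall>x\<in>V. z \<odot>\<^bsub>X\<^esub> x \<in> V)"

definition linear_span :: "('x, 'm) normed_space_scheme \<Rightarrow> 'x set \<Rightarrow> 'x set"
  where "linear_span X S = \<Inter>{V. linear_subspace X V \<and> S \<subseteq> V}"

definition closed_linear_span :: "('x, 'm) normed_space_scheme \<Rightarrow> 'x set \<Rightarrow> 'x set"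
  where "closed_linear_span X S =
    Metric_space.mtopology (carrier X) (vdist X) closure_of linear_span X S"

definition essential :: "('a, 'x) bimodule \<Rightarrow> bool"
  where "essential X \<longleftrightarrow>
    closed_linear_span X {a \<rhd>\<^bsub>X\<^esub> x | a x. x \<in> carrier X} = carrier X \<and>
    closed_linear_span X {x \<lhd>\<^bsub>X\<^esub> a | a x. x \<in> carrier X} = carrier X"

(* Functionals on X are functions on the whole type 'x; they are normalised by being undefined
   outside the carrier, so that equality in the dual is equality on the carrier. *)

definition dual_carrier :: "('x, 'm) normed_space_scheme \<Rightarrow> ('x \<Rightarrow> complex) set"
  where "dual_carrier X = {f \<in> extensional (carrier X).
    (\<forall>x\<in>carrier X. \<forall>y\<in>carrier X. f (x \<oplus>\<^bsub>X\<^esub> y) = f x + f y) \<and>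
    (\<forall>z. \<forall>x\<in>carrier X. f (z \<odot>\<^bsub>X\<^esub> x) = z * f x) \<and>
    (\<exists>K. \<forall>x\<in>carrier X. cmod (f x) \<le> K * nrm X x)}"

definition dual :: "('a, 'x) bimodule \<Rightarrow> ('a, 'x \<Rightarrow> complex) bimodule"
  where "dual X = \<lparr>
    carrier = dual_carrier X,
    zero = (\<lambda>x\<in>carrier X. 0),
    add = (\<lambda>f g. \<lambda>x\<in>carrier X. f x + g x),
    smult = (\<lambda>z f. \<lambda>x\<in>carrier X. z * f x),
    nrm = (\<lambda>f. SUP x\<in>{x \<in> carrier X. nrm X x \<le> 1}. cmod (f x)),
    lact = (\<lambda>a f. \<lambda>x\<in>carrier X. f (x \<lhd>\<^bsub>X\<^esub> a)),
    ract = (\<lambda>f a. \<lambda>x\<in>carrier X. f (a \<rhd>\<^bsub>X\<^esub> x))\<rparr>"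

definition bounded_operator ::
  "('a::complex_banach_algebra, 'y) bimodule \<Rightarrow> ('a \<Rightarrow> 'y) \<Rightarrow> bool"
  where "bounded_operator Y D \<longleftrightarrow>
    (\<forall>a. D a \<in> carrier Y) \<and>
    (\<forall>a b. D (a + b) = D a \<oplus>\<^bsub>Y\<^esub> D b) \<and>
    (\<forall>z a. D (z *\<^sub>C a) = z \<odot>\<^bsub>Y\<^esub> D a) \<and>
    (\<exists>K. \<forall>a. nrm Y (D a) \<le> K * norm a)"

definition bounded_derivation ::
  "('a::complex_banach_algebra, 'y) bimodule \<Rightarrow> ('a \<Rightarrow> 'y) \<Rightarrow> bool"
  where "bounded_derivation Y D \<longleftrightarrow>
    bounded_operator Y D \<and> (\<forall>a b. D (a * b) = (a \<rhd>\<^bsub>Y\<^esub> D b) \<oplus>\<^bsub>Y\<^esub> (D a \<lhd>\<^bsub>Y\<^esub> b))"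

definition inner_derivation :: "('a, 'y) bimodule \<Rightarrow> ('a \<Rightarrow> 'y) \<Rightarrow> bool"
  where "inner_derivation Y D \<longleftrightarrow>
    (\<exists>y\<in>carrier Y. \<forall>a. D a = (a \<rhd>\<^bsub>Y\<^esub> y) \<ominus>\<^bsub>Y\<^esub> (y \<lhd>\<^bsub>Y\<^esub> a))"

definition hyperlocal :: "('a::complex_banach_algebra, 'y) bimodule \<Rightarrow> ('a \<Rightarrow> 'y) \<Rightarrow> bool"
  where "hyperlocal Y D \<longleftrightarrow>
    (\<forall>a b c. a * c = 0 \<and> c * b = 0 \<longrightarrow> (a \<rhd>\<^bsub>Y\<^esub> D c) \<lhd>\<^bsub>Y\<^esub> b = \<zero>\<^bsub>Y\<^esub>)"

(* A formula of HOL cannot range over all types, so the type 'x acts as a universe: the bimodules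
   considered are all those whose underlying set is a subset of 'x. Amenability in the usual sense
   is amenability for every type 'x. *)

definition amenable :: "'a::complex_banach_algebra itself \<Rightarrow> 'x itself \<Rightarrow> bool"
  where "amenable A U \<longleftrightarrow>
    (\<forall>(X :: ('a, 'x) bimodule) D.
      banach_bimodule X \<longrightarrow> bounded_derivation (dual X) D \<longrightarrow> inner_derivation (dual X) D)"

end

theory Submission
  imports Defs
begin

text \<open>
  Let \<open>D\<close> be hyperlocal on an essential bimodule. For a self-adjoint \<open>h\<close> in the unitization with small
  norm, the Cayley transform is unitary, and this yields a continuous functional calculus on \<open>[0, 1]\<close> for
  the inverse of \<open>1 + h\<^sup>2\<close>. Evaluating a zero-product-preserving bilinear map \<open>\<phi>\<close> on tent functions with
  disjoint supports gives \<open>\<phi>(x m, y) = \<phi>(x, m y)\<close>; applied twice to \<open>a D(c) b\<close> this becomes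
  \<open>D(m c n) = m D(c n) + D(m c) n - m D(c) n\<close>. If \<open>c\<close> runs through a bounded approximate identity and
  \<open>\<xi>\<close> is a weak-star limit of \<open>D(c)\<close>, then \<open>a \<mapsto> D(a) - a \<xi>\<close> is a derivation, hence inner.

  Conversely, a derivation is hyperlocal, so it has the form \<open>a x' - y' a\<close> on the essential part of the
  bimodule, where the Leibniz rule forces \<open>x' = y'\<close>. The functional extends to the whole bimodule as an
  iterated limit of \<open>y'(e x e')\<close>, and the remaining derivation, which vanishes on the essential part, is
  inner by an explicit limit formula.
\<close>

subsection \<open>Unitization\<close>

text \<open>The calculus rests on norm estimates drawn from the C*-identity of the algebra itself.
  The unitization carries a sum norm, which is not a C*-norm, so estimates run through the operator
  norm of left multiplication on the algebra; the scalar part is tracked separately, and this is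
  where the factor 3 of the calculus comes from. The Cayley transform enters because the powers of a
  unitary have operator norm at most 1 and their real parts multiply like cos (n t), so that a
  polynomial on [0, 1] becomes a cosine polynomial. The tents form a partition of unity with mesh 1
  / n. Then n times the defect of balancedness is a sum over neighbouring tents only, and it is
  bounded independently of n, so the defect is 0. Weak-star limits are taken along an ultrafilter on
  the algebra along which e a and a e tend to a. The converse stays inside the given bimodule: its
  essential part is a subset of the carrier, hence belongs to the same universe \<open>'x\<close>,
  and what lies beyond it is reached by iterated limits along the same ultrafilter.\<close>

lemma scaleC_zero_right [simp]: "z *\<^sub>C (0::'a::complex_banach_algebra) = 0"
  by (metis add_cancel_right_left scaleC_add_right add.right_neutral)

lemma scaleC_zero_left [simp]: "0 *\<^sub>C (a::'a::complex_banach_algebra) = 0"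
  by (metis of_real_0 scaleC_of_real scaleR_zero_left)

lemma scaleC_one [simp]: "1 *\<^sub>C (a::'a::complex_banach_algebra) = a"
  by (metis of_real_1 scaleC_of_real scaleR_one)

lemma scaleC_minus_right: "z *\<^sub>C (- a) = - (z *\<^sub>C (a::'a::complex_banach_algebra))"
  by (metis add.right_inverse add_eq_0_iff scaleC_add_right scaleC_zero_right)

lemma scaleC_minus_left: "(- z) *\<^sub>C a = - (z *\<^sub>C (a::'a::complex_banach_algebra))"
  by (metis add.right_inverse add_eq_0_iff scaleC_add_left scaleC_zero_left)

lemma scaleC_diff_right: "z *\<^sub>C (a - b) = z *\<^sub>C a - z *\<^sub>C (b::'a::complex_banach_algebra)"
  using scaleC_add_right[of z a "- b"] by (simp add: scaleC_minus_right)

lemma scaleR_scaleC: "r *\<^sub>R a = of_real r *\<^sub>C (a::'a::complex_banach_algebra)"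
  by (simp add: scaleC_of_real)

datatype 'a unitization = Unitize (scal: complex) (elem: 'a)

lemma unitization_eq_iff: "b = c \<longleftrightarrow> scal b = scal c \<and> elem b = elem c"
  by (cases b; cases c) auto

instantiation unitization :: (complex_banach_algebra) real_normed_algebra_1
begin

definition "0 = Unitize 0 0"
definition "1 = Unitize 1 0"
definition "b + c = Unitize (scal b + scal c) (elem b + elem c)"
definition "- b = Unitize (- scal b) (- elem b)"
definition "b - c = Unitize (scal b - scal c) (elem b - elem c)"
definition "b * c = Unitize (scal b * scal c)
  (scal b *\<^sub>C elem c + scal c *\<^sub>C elem b + elem b * elem c)"
definition "r *\<^sub>R b = Unitize (r *\<^sub>R scal b) (r *\<^sub>R elem b)"
text \<open>The sum norm makes submultiplicativity and completeness elementary. It is not a C*-norm;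
  C*-estimates use \<open>opnorm\<close>, and \<open>norm_le_opnorm\<close> leads back.\<close>

definition "norm b = cmod (scal b) + norm (elem b)"
definition "sgn (b :: 'a unitization) = inverse (norm b) *\<^sub>R b"
definition "dist (b :: 'a unitization) c = norm (b - c)"
definition "(uniformity :: ('a unitization \<times> 'a unitization) filter) =
  (INF e\<in>{0<..}. principal {(x, y). dist x y < e})"
definition "open (S :: 'a unitization set) \<longleftrightarrow>
  (\<forall>x\<in>S. \<forall>\<^sub>F (x', y) in uniformity. x' = x \<longrightarrow> y \<in> S)"

lemmas unitization_ops = zero_unitization_def one_unitization_def plus_unitization_def
  uminus_unitization_def minus_unitization_def times_unitization_def scaleR_unitization_def

instance
proof
  fix a b c :: "'a unitization" and r s :: real
  show "a * b * c = a * (b * c)"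
    by (simp add: unitization_ops scaleC_add_right scaleC_scaleC mult_scaleC_left mult_scaleC_right
        algebra_simps)
  show "norm (a + b) \<le> norm a + norm b"
    using norm_triangle_ineq[of "scal a" "scal b"] norm_triangle_ineq[of "elem a" "elem b"]
    by (simp add: unitization_ops norm_unitization_def)
  show "norm (a * b) \<le> norm a * norm b"
  proof -
    have "norm (scal a *\<^sub>C elem b + scal b *\<^sub>C elem a + elem a * elem b)
        \<le> cmod (scal a) * norm (elem b) + cmod (scal b) * norm (elem a) + norm (elem a) * norm (elem b)"
      by (intro order.trans[OF norm_triangle_ineq] add_mono norm_mult_ineq) (simp_all add: norm_scaleC)
    then show ?thesis
      by (simp add: unitization_ops norm_unitization_def norm_mult algebra_simps)
  qed
  show "(norm a = 0) = (a = 0)"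
    by (auto simp: unitization_ops norm_unitization_def unitization_eq_iff add_nonneg_eq_0_iff)
  show "norm (r *\<^sub>R a) = \<bar>r\<bar> * norm a"
    by (simp add: unitization_ops norm_unitization_def algebra_simps)
qed (auto simp: unitization_ops unitization_eq_iff algebra_simps scaleC_add_right scaleC_add_left
    norm_unitization_def sgn_unitization_def dist_unitization_def uniformity_unitization_def
    open_unitization_def scaleR_scaleC scaleC_scaleC mult_scaleC_left mult_scaleC_right
    scaleR_conv_of_real)

end

lemma scal_simps [simp]:
  "scal (0::'a::complex_banach_algebra unitization) = 0"
  "scal (1::'a unitization) = 1"
  "scal (b + c) = scal b + scal (c::'a unitization)"
  "scal (- b) = - scal (b::'a unitization)"
  "scal (b - c) = scal b - scal (c::'a unitization)"
  "scal (b * c) = scal b * scal (c::'a unitization)"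
  "scal (r *\<^sub>R b) = of_real r * scal (b::'a unitization)"
  by (simp_all add: unitization_ops scaleR_conv_of_real)

lemma elem_simps [simp]:
  "elem (0::'a::complex_banach_algebra unitization) = 0"
  "elem (1::'a unitization) = 0"
  "elem (b + c) = elem b + elem (c::'a unitization)"
  "elem (- b) = - elem (b::'a unitization)"
  "elem (b - c) = elem b - elem (c::'a unitization)"
  "elem (b * c) = scal b *\<^sub>C elem c + scal c *\<^sub>C elem b + elem b * elem (c::'a unitization)"
  "elem (r *\<^sub>R b) = r *\<^sub>R elem (b::'a unitization)"
  by (simp_all add: unitization_ops)

lemma scal_power [simp]: "scal (b ^ n) = scal (b::'a::complex_banach_algebra unitization) ^ n"
  by (induction n) auto

lemma bounded_linear_scal: "bounded_linear (scal :: 'a::complex_banach_algebra unitization \<Rightarrow> complex)"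
  by (rule bounded_linear_intro[where K = 1]) (auto simp: scaleR_conv_of_real[where 'a = complex] norm_unitization_def)

lemma bounded_linear_elem: "bounded_linear (elem :: 'a::complex_banach_algebra unitization \<Rightarrow> 'a)"
  by (rule bounded_linear_intro[where K = 1]) (auto simp: norm_unitization_def)

instance unitization :: (complex_banach_algebra) banach
proof
  fix X :: "nat \<Rightarrow> 'a unitization"
  assume "Cauchy X"
  then have "Cauchy (\<lambda>n. scal (X n))" "Cauchy (\<lambda>n. elem (X n))"
    by (simp_all add: bounded_linear.Cauchy bounded_linear_scal bounded_linear_elem)
  then obtain z a where z: "(\<lambda>n. scal (X n)) \<longlonglongrightarrow> z" and a: "(\<lambda>n. elem (X n)) \<longlonglongrightarrow> a"
    by (auto simp: Cauchy_convergent_iff convergent_def)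
  have "(\<lambda>n. cmod (scal (X n) - z) + norm (elem (X n) - a)) \<longlonglongrightarrow> 0"
    using tendsto_add[OF tendsto_norm[OF Lim_null[THEN iffD1, OF z]] tendsto_norm[OF Lim_null[THEN iffD1, OF a]]]
    by simp
  then have "(\<lambda>n. norm (X n - Unitize z a)) \<longlonglongrightarrow> 0"
    by (simp add: norm_unitization_def)
  then have "X \<longlonglongrightarrow> Unitize z a"
    by (simp add: Lim_null[of X] tendsto_norm_zero_iff)
  then show "convergent X"
    by (auto simp: convergent_def)
qed

text \<open>The algebra is an ideal of its unitization, and these are the two actions on it. Through
  them elements of the calculus, which have a scalar part, can be moved between the arguments of a
  bilinear map defined on the algebra alone.\<close>

definition lmul :: "'a::complex_banach_algebra unitization \<Rightarrow> 'a \<Rightarrow> 'a"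
  where "lmul b x = scal b *\<^sub>C x + elem b * x"

definition rmul :: "'a::complex_banach_algebra \<Rightarrow> 'a unitization \<Rightarrow> 'a"
  where "rmul x b = scal b *\<^sub>C x + x * elem b"

lemma lmul_mult: "lmul (b * c) x = lmul b (lmul c x)"
  by (simp add: lmul_def scaleC_add_right scaleC_scaleC mult_scaleC_left mult_scaleC_right algebra_simps)

lemma rmul_mult: "rmul x (b * c) = rmul (rmul x b) c"
  by (simp add: rmul_def scaleC_add_right scaleC_scaleC mult_scaleC_left mult_scaleC_right algebra_simps)

lemma rmul_times_lmul: "rmul x b * y = x * lmul b y"
  by (simp add: rmul_def lmul_def mult_scaleC_left mult_scaleC_right algebra_simps)

lemma lmul_one [simp]: "lmul 1 x = x" and rmul_one [simp]: "rmul x 1 = x"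
  by (simp_all add: lmul_def rmul_def)

lemma lmul_Unitize0 [simp]: "lmul (Unitize 0 a) x = a * x"
  and rmul_Unitize0 [simp]: "rmul x (Unitize 0 a) = x * a"
  by (simp_all add: lmul_def rmul_def)

lemma bounded_bilinear_lmul: "bounded_bilinear (lmul :: 'a::complex_banach_algebra unitization \<Rightarrow> _)"
proof (rule bounded_bilinear.intro, goal_cases)
  case 5
  have "norm (lmul b x) \<le> norm b * norm x * 1" for b and x :: 'a
    unfolding lmul_def norm_unitization_def mult_1_right distrib_right
    by (intro order.trans[OF norm_triangle_ineq] add_mono norm_mult_ineq) (simp add: norm_scaleC)
  then show ?case by blast
qed (auto simp: lmul_def scaleC_add_right scaleC_add_left scaleR_scaleC scaleC_scaleC mult_scaleC_left
    mult_scaleC_right algebra_simps)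

lemma bounded_bilinear_rmul: "bounded_bilinear (rmul :: 'a::complex_banach_algebra \<Rightarrow> _)"
proof (rule bounded_bilinear.intro, goal_cases)
  case 5
  have "norm (rmul x b) \<le> norm x * norm b * 1" for b and x :: 'a
    unfolding rmul_def norm_unitization_def mult_1_right distrib_left
    by (intro order.trans[OF norm_triangle_ineq] add_mono norm_mult_ineq) (simp add: norm_scaleC mult.commute)
  then show ?case by blast
qed (auto simp: rmul_def scaleC_add_right scaleC_add_left scaleR_scaleC scaleC_scaleC mult_scaleC_left
    mult_scaleC_right algebra_simps)

interpretation lmul: bounded_bilinear "lmul :: 'a::complex_banach_algebra unitization \<Rightarrow> _"
  by (rule bounded_bilinear_lmul)

interpretation rmul: bounded_bilinear "rmul :: 'a::complex_banach_algebra \<Rightarrow> _"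
  by (rule bounded_bilinear_rmul)

section \<open>The involution and the C*-identity for left multiplication\<close>

lemma star_zero [simp]: "star (0::'a::cstar_algebra) = 0"
  by (metis add_cancel_right_left star_add add.right_neutral)

lemma star_minus: "star (- a) = - star (a::'a::cstar_algebra)"
  by (metis add.right_inverse add_eq_0_iff star_add star_zero)

lemma star_diff: "star (a - b) = star a - star (b::'a::cstar_algebra)"
  using star_add[of a "- b"] by (simp add: star_minus)

lemma star_scaleR: "star (r *\<^sub>R a) = r *\<^sub>R star (a::'a::cstar_algebra)"
  by (simp add: scaleR_scaleC star_scaleC)

lemma norm_star [simp]: "norm (star a) = norm (a::'a::cstar_algebra)"
proof -
  have "norm b \<le> norm (star b)" for b :: 'a
  proof (cases "b = 0")
    case False
    have "norm b * norm b \<le> norm (star b) * norm b"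
      using cstar_identity[of b] norm_mult_ineq[of "star b" b] by (simp add: power2_eq_square)
    then show ?thesis using False by simp
  qed simp
  from this[of a] this[of "star a"] show ?thesis by (simp add: star_star)
qed

definition ustar :: "'a::cstar_algebra unitization \<Rightarrow> 'a unitization"
  where "ustar b = Unitize (cnj (scal b)) (star (elem b))"

lemma ustar_simps:
  "ustar 0 = 0" "ustar 1 = 1" "ustar (b + c) = ustar b + ustar c" "ustar (- b) = - ustar b"
  "ustar (b * c) = ustar c * ustar b" "ustar (r *\<^sub>R b) = r *\<^sub>R ustar b" "ustar (ustar b) = b"
  by (auto simp: ustar_def unitization_eq_iff star_add star_minus star_mult star_scaleC star_scaleR
      star_star add_ac)

lemma ustar_power: "ustar (b ^ n) = ustar b ^ n"
  by (induction n) (simp_all add: ustar_simps power_commutes)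

lemma star_lmul: "star (lmul b x) = rmul (star x) (ustar b)"
  by (simp add: lmul_def rmul_def ustar_def star_add star_scaleC star_mult)

text \<open>The C*-identity is given for the algebra, not for its unitization. It is applied to the
  element \<open>lmul b x\<close> of the algebra, after which \<open>b\<close> is moved across the
  product.\<close>

lemma lmul_cstar_bound: "(norm (lmul b x))\<^sup>2 \<le> norm x * norm (lmul (ustar b * b) x)"
proof -
  have "star (lmul b x) * lmul b x = star x * lmul (ustar b * b) x"
    by (simp add: star_lmul rmul_times_lmul lmul_mult)
  then show ?thesis
    using cstar_identity[of "lmul b x"] norm_mult_ineq[of "star x" "lmul (ustar b * b) x"] by simp
qed

lemma norm_lmul_unitary:
  assumes "ustar u * u = 1"
  shows "norm (lmul u x) \<le> norm x"
proof -
  have "(norm (lmul u x))\<^sup>2 \<le> (norm x)\<^sup>2"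
    using lmul_cstar_bound[of u x] assms by (simp add: power2_eq_square)
  then show ?thesis by (rule power2_le_imp_le) simp
qed

text \<open>The norm of \<open>elem b\<close> is read off from the test vector
  \<open>star (elem b)\<close>, for which the C*-identity gives the full square of the norm; the
  scalar part of \<open>b\<close> is then subtracted.\<close>

lemma norm_elem_le:
  fixes b :: "'a::cstar_algebra unitization"
  assumes "\<And>x. norm (lmul b x) \<le> c * norm x" "0 \<le> c"
  shows "norm (elem b) \<le> c + cmod (scal b)"
proof (cases "elem b = 0")
  case False
  let ?a = "elem b"
  have "norm (?a * star ?a) = (norm ?a)\<^sup>2"
    using cstar_identity[of "star ?a"] by (simp add: star_star)
  moreover have "?a * star ?a = lmul b (star ?a) - scal b *\<^sub>C star ?a"
    by (simp add: lmul_def)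
  ultimately have "(norm ?a)\<^sup>2 \<le> norm (lmul b (star ?a)) + cmod (scal b) * norm ?a"
    by (metis norm_triangle_ineq4 norm_scaleC norm_star)
  also have "\<dots> \<le> (c + cmod (scal b)) * norm ?a"
    using assms(1)[of "star ?a"] by (simp add: distrib_right)
  finally show ?thesis
    using False by (simp add: power2_eq_square)
qed (use assms(2) in simp)

lemma ex_inverse_one_minus:
  fixes x :: "'b::{real_normed_algebra_1, banach}"
  assumes "norm x < 1"
  shows "\<exists>y. (1 - x) * y = 1 \<and> y * (1 - x) = 1"
proof -
  have s: "summable (\<lambda>n. x ^ n)"
    by (rule summable_comparison_test[OF _ summable_geometric[of "norm x"]])
       (use assms in \<open>auto simp: norm_power_ineq\<close>)
  define y where "y = (\<Sum>n. x ^ n)"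
  have "y = 1 + (\<Sum>n. x ^ Suc n)"
    unfolding y_def using suminf_split_head[OF s] by simp
  moreover have "(\<Sum>n. x ^ Suc n) = x * y"
    unfolding y_def using suminf_mult[OF s, of x] by simp
  moreover have "(\<Sum>n. x ^ Suc n) = y * x"
    unfolding y_def using suminf_mult2[OF s, of x] by (simp add: power_commutes)
  ultimately have "y = 1 + x * y" "y = 1 + y * x" by auto
  then show ?thesis
    by (intro exI[of _ y]) (simp add: algebra_simps)
qed

subsection \<open>Polynomial calculus of a self-adjoint element\<close>

text \<open>Only a seminorm: if the algebra has a unit e, then 1 - e acts as zero. Hence the scalar
  part in \<open>norm_le_opnorm\<close>.\<close>

definition opnorm :: "'a::cstar_algebra unitization \<Rightarrow> real"
  where "opnorm b = onorm (lmul b)"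

lemma lmul_le_opnorm: "norm (lmul b x) \<le> opnorm b * norm x"
  unfolding opnorm_def by (rule onorm) (rule lmul.bounded_linear_right)

lemma opnorm_le: "0 \<le> c \<Longrightarrow> (\<And>x. norm (lmul b x) \<le> c * norm x) \<Longrightarrow> opnorm b \<le> c"
  unfolding opnorm_def by (rule onorm_bound)

lemma opnorm_nonneg: "0 \<le> opnorm b"
  unfolding opnorm_def by (rule onorm_pos_le) (rule lmul.bounded_linear_right)

lemma opnorm_cstar: "(opnorm b)\<^sup>2 \<le> opnorm (ustar b * b)"
proof -
  have "norm (lmul b x) \<le> sqrt (opnorm (ustar b * b)) * norm x" for x
  proof -
    have "(norm (lmul b x))\<^sup>2 \<le> norm x * (opnorm (ustar b * b) * norm x)"
      by (intro order.trans[OF lmul_cstar_bound] mult_left_mono lmul_le_opnorm) simp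
    then have "(norm (lmul b x))\<^sup>2 \<le> (sqrt (opnorm (ustar b * b)) * norm x)\<^sup>2"
      by (simp add: power_mult_distrib opnorm_nonneg power2_eq_square algebra_simps)
    then show ?thesis
      by (rule power2_le_imp_le) (simp add: opnorm_nonneg)
  qed
  then have "opnorm b \<le> sqrt (opnorm (ustar b * b))"
    by (intro opnorm_le) (auto simp: opnorm_nonneg)
  then have "(opnorm b)\<^sup>2 \<le> (sqrt (opnorm (ustar b * b)))\<^sup>2"
    by (intro power_mono opnorm_nonneg)
  then show ?thesis
    by (simp add: opnorm_nonneg)
qed

text \<open>Powers of a self-adjoint element are self-adjoint, so each doubling of the exponent is
  one more use of \<open>opnorm_cstar\<close>.\<close>

lemma opnorm_power_two_power:
  assumes "ustar b = b"
  shows "opnorm b ^ 2 ^ m \<le> opnorm (b ^ 2 ^ m)"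
proof (induction m)
  case (Suc m)
  have "opnorm b ^ 2 ^ Suc m = (opnorm b ^ 2 ^ m)\<^sup>2"
    by (simp add: power_mult mult.commute flip: power_mult)
  also have "\<dots> \<le> (opnorm (b ^ 2 ^ m))\<^sup>2"
    by (intro power_mono Suc.IH) (simp add: opnorm_nonneg)
  also have "\<dots> \<le> opnorm (b ^ 2 ^ m * b ^ 2 ^ m)"
    using opnorm_cstar[of "b ^ 2 ^ m"] by (simp add: ustar_power assms)
  also have "b ^ 2 ^ m * b ^ 2 ^ m = b ^ 2 ^ Suc m"
    by (simp add: mult_2 flip: power_add)
  finally show ?case .
qed simp

text \<open>One \<open>cmod (scal b)\<close> belongs to the sum norm, the other comes from
  \<open>norm_elem_le\<close>.\<close>

lemma norm_le_opnorm: "norm b \<le> opnorm b + 2 * cmod (scal b)"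
  using norm_elem_le[OF lmul_le_opnorm opnorm_nonneg, of b] by (simp add: norm_unitization_def)

section \<open>Cosine polynomials and their coefficients\<close>

lemma integral_cos_nat:
  "((\<lambda>t. cos (real n * t)) has_integral (if n = 0 then 2 * pi else 0)) {0..2 * pi}"
proof (cases "n = 0")
  case True
  then show ?thesis using has_integral_const_real[of "1::real" 0 "2 * pi"] by simp
next
  case False
  have "((\<lambda>t. cos (real n * t)) has_integral
      (sin (real n * (2 * pi)) / real n - sin (real n * 0) / real n)) {0..2 * pi}"
    by (rule fundamental_theorem_of_calculus)
       (use False in \<open>auto intro!: derivative_eq_intros simp flip: has_real_derivative_iff_has_vector_derivative\<close>)
  moreover have "sin (real n * (2 * pi)) = 0"
    by (metis mult.assoc mult.commute sin_npi2 mult_2 of_nat_mult of_nat_numeral sin_npi)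
  ultimately show ?thesis using False by simp
qed

text \<open>The conditional is |j - k| without truncated subtraction on \<open>nat\<close>; the
  relation \<open>C_mult\<close> of \<open>chebyshev\<close> copies this shape.\<close>

lemma cos_mult_cos_nat:
  "cos (real j * t) * cos (real k * t)
    = (cos (real (j + k) * t) + cos (real (if j \<le> k then k - j else j - k) * t)) / 2"
proof -
  have "cos (real j * t - real k * t) = cos (real (if j \<le> k then k - j else j - k) * t)"
    by (auto simp: of_nat_diff left_diff_distrib cos_diff)
  then show ?thesis
    by (simp add: cos_times_cos distrib_right)
qed

text \<open>Integrating against cos (k t) over a period isolates the coefficient with weight pi for
  k > 0 and 2 pi for k = 0. The integral is at most 2 pi s, and dividing by at least pi gives the
  factor 2.\<close>

lemma cosine_coefficient_bound:
  fixes a :: "nat \<Rightarrow> real"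
  assumes bound: "\<And>t. \<bar>\<Sum>j\<le>d. a j * cos (real j * t)\<bar> \<le> s" and k: "k \<le> d"
  shows "\<bar>a k\<bar> \<le> 2 * s"
proof -
  define c where "c = (if k = 0 then 2 * pi else pi)"
  have I: "((\<lambda>t. cos (real j * t) * cos (real k * t)) has_integral (if j = k then c else 0)) {0..2 * pi}" for j
  proof -
    have "((\<lambda>t. (cos (real (j + k) * t) + cos (real (if j \<le> k then k - j else j - k) * t)) / 2) has_integral
       ((if j + k = 0 then 2 * pi else 0) + (if (if j \<le> k then k - j else j - k) = 0 then 2 * pi else 0)) / 2) {0..2 * pi}"
      by (intro has_integral_divide has_integral_add integral_cos_nat)
    also have "((if j + k = 0 then 2 * pi else 0) + (if (if j \<le> k then k - j else j - k) = 0 then 2 * pi else 0)) / 2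
      = (if j = k then c else 0)"
      by (auto simp: c_def)
    finally show ?thesis by (simp only: cos_mult_cos_nat)
  qed
  have "((\<lambda>t. \<Sum>j\<le>d. a j * (cos (real j * t) * cos (real k * t))) has_integral
      (\<Sum>j\<le>d. a j * (if j = k then c else 0))) {0..2 * pi}"
    by (intro has_integral_sum has_integral_mult_right I) auto
  also have "(\<Sum>j\<le>d. a j * (if j = k then c else 0)) = (\<Sum>j\<le>d. if j = k then a j * c else 0)"
    by (intro sum.cong) auto
  also have "\<dots> = a k * c"
    using k by simp
  also have "(\<lambda>t. \<Sum>j\<le>d. a j * (cos (real j * t) * cos (real k * t)))
    = (\<lambda>t. (\<Sum>j\<le>d. a j * cos (real j * t)) * cos (real k * t))"
    by (simp add: sum_distrib_right mult.assoc)
  finally have I': "((\<lambda>t. (\<Sum>j\<le>d. a j * cos (real j * t)) * cos (real k * t)) has_integral a k * c)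
      (cbox 0 (2 * pi))" by simp
  have "norm (a k * c) \<le> s * measure lborel (cbox 0 (2 * pi))"
  proof (rule has_integral_bound[OF _ I'])
    show "0 \<le> s" using bound[of 0] by linarith
    fix t
    have "\<bar>\<Sum>j\<le>d. a j * cos (real j * t)\<bar> * \<bar>cos (real k * t)\<bar> \<le> s * 1"
      by (intro mult_mono bound) (use bound[of 0] in auto)
    then show "norm ((\<Sum>j\<le>d. a j * cos (real j * t)) * cos (real k * t)) \<le> s"
      by (simp add: abs_mult)
  qed
  then have "\<bar>a k\<bar> * c \<le> 2 * s * pi"
    by (simp add: abs_mult c_def split: if_splits)
  moreover have "\<bar>a k\<bar> * pi \<le> \<bar>a k\<bar> * c"
    by (intro mult_left_mono) (auto simp: c_def)
  ultimately have "\<bar>a k\<bar> * pi \<le> (2 * s) * pi" by linarith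
  then show ?thesis by simp
qed

text \<open>Evaluation of real polynomials at \<open>r\<close>, recorded as a graph: pairing the
  polynomial function with its value makes the properties of the calculus rule inductions.\<close>

inductive polycalc :: "'b::real_algebra_1 \<Rightarrow> (real \<Rightarrow> real) \<Rightarrow> 'b \<Rightarrow> bool" for r where
  const: "polycalc r (\<lambda>_. c) (c *\<^sub>R 1)"
| var: "polycalc r (\<lambda>t. t) r"
| add: "polycalc r f b \<Longrightarrow> polycalc r g b' \<Longrightarrow> polycalc r (\<lambda>t. f t + g t) (b + b')"
| mult: "polycalc r f b \<Longrightarrow> polycalc r g b' \<Longrightarrow> polycalc r (\<lambda>t. f t * g t) (b * b')"

lemma polycalc_scaleR: "polycalc r f b \<Longrightarrow> polycalc r (\<lambda>t. c * f t) (c *\<^sub>R b)"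
  using polycalc.mult[OF polycalc.const[of r c]] by fastforce

lemma polycalc_one: "polycalc r (\<lambda>t. 1) 1"
  using polycalc.const[of r 1] by simp

lemma polycalc_diff: "polycalc r f b \<Longrightarrow> polycalc r g b' \<Longrightarrow> polycalc r (\<lambda>t. f t - g t) (b - b')"
  using polycalc.add[of r f b "\<lambda>t. -1 * g t" "- 1 *\<^sub>R b'"] polycalc_scaleR[of r g b' "- 1"] by simp

lemma polycalc_power: "polycalc r f b \<Longrightarrow> polycalc r (\<lambda>t. f t ^ n) (b ^ n)"
  by (induction n) (auto intro: polycalc.mult polycalc_one)

lemma polycalc_sum:
  "(\<And>i. i \<in> I \<Longrightarrow> polycalc r (f i) (b i)) \<Longrightarrow> polycalc r (\<lambda>t. \<Sum>i\<in>I. f i t) (\<Sum>i\<in>I. b i)"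
proof (induction I rule: infinite_finite_induct)
  case (insert i I)
  then show ?case using polycalc.add[of r "f i" "b i"] by simp
qed (use polycalc.const[of r 0] in auto)

lemma continuous_on_polycalc: "polycalc r f b \<Longrightarrow> continuous_on S f"
  by (induction rule: polycalc.induct) (auto intro!: continuous_intros)

lemma polycalc_commute_var: "polycalc r f b \<Longrightarrow> b * r = r * b"
proof (induction rule: polycalc.induct)
  case (mult f b g b')
  then show ?case by (metis mult.assoc)
qed (auto simp: algebra_simps)

lemma polycalc_commute: "polycalc r f b \<Longrightarrow> polycalc r g b' \<Longrightarrow> b * b' = b' * b"
proof (induction rule: polycalc.induct)
  case var
  then show ?case using polycalc_commute_var by metis
next
  case (mult f b g b'')
  then show ?case by (metis mult.assoc)
qed (auto simp: algebra_simps)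

text \<open>Function and element share their coefficients. Unlike in \<open>polycalc\<close> the
  degree is visible, because the first norm bound is linear in it; \<open>d\<close> is only an upper
  bound for the degree.\<close>

inductive cosine_poly :: "(nat \<Rightarrow> 'b::real_algebra_1) \<Rightarrow> nat \<Rightarrow> (real \<Rightarrow> real) \<Rightarrow> 'b \<Rightarrow> bool" for C where
  "cosine_poly C d (\<lambda>t. \<Sum>j\<le>d. a j * cos (real j * t)) (\<Sum>j\<le>d. a j *\<^sub>R C j)"

lemma cosine_poly_basis: "j \<le> d \<Longrightarrow> cosine_poly C d (\<lambda>t. c * cos (real j * t)) (c *\<^sub>R C j)"
  using cosine_poly.intros[of C d "\<lambda>i. if i = j then c else 0"]
  by (simp add: if_distrib[of "\<lambda>x. x * _"] if_distrib[of "\<lambda>x. x *\<^sub>R _"] cong: if_cong)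

lemma cosine_poly_add:
  assumes "cosine_poly C d f b" "cosine_poly C d g c"
  shows "cosine_poly C d (\<lambda>t. f t + g t) (b + c)"
proof -
  from assms(1) obtain a1 where "f = (\<lambda>t. \<Sum>j\<le>d. a1 j * cos (real j * t))" "b = (\<Sum>j\<le>d. a1 j *\<^sub>R C j)"
    by cases
  moreover from assms(2) obtain a2 where "g = (\<lambda>t. \<Sum>j\<le>d. a2 j * cos (real j * t))" "c = (\<Sum>j\<le>d. a2 j *\<^sub>R C j)"
    by cases
  ultimately show ?thesis
    using cosine_poly.intros[of C d "\<lambda>j. a1 j + a2 j"] by (simp add: distrib_right scaleR_add_left sum.distrib)
qed

lemma cosine_poly_sum:
  "finite I \<Longrightarrow> (\<And>i. i \<in> I \<Longrightarrow> cosine_poly C d (f i) (b i)) \<Longrightarrow>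
    cosine_poly C d (\<lambda>t. \<Sum>i\<in>I. f i t) (\<Sum>i\<in>I. b i)"
proof (induction I rule: finite_induct)
  case empty
  then show ?case using cosine_poly.intros[of C d "\<lambda>_. 0"] by simp
next
  case (insert i I)
  then show ?case using cosine_poly_add[of C d "f i" "b i"] by simp
qed

lemma cosine_poly_mono:
  assumes "cosine_poly C d f b" "d \<le> e"
  shows "cosine_poly C e f b"
  using assms(1)
proof cases
  case (1 a)
  show ?thesis
    unfolding 1 by (intro cosine_poly_sum cosine_poly_basis) (use assms(2) in auto)
qed

text \<open>\<open>C n\<close> plays the role of cos (n t), and these are the product relations of
  the Chebyshev polynomials. The intended instance is the real part of the n-th power of a
  unitary.\<close>

locale chebyshev =
  fixes C :: "nat \<Rightarrow> 'b::real_algebra_1"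
  assumes C_0: "C 0 = 1"
    and C_mult: "C j * C k = (1 / 2) *\<^sub>R (C (j + k) + C (if j \<le> k then k - j else j - k))"
begin

lemma cosine_poly_mult:
  assumes "cosine_poly C d f b" "cosine_poly C e g c"
  shows "cosine_poly C (d + e) (\<lambda>t. f t * g t) (b * c)"
proof -
  from assms(1) obtain a1 where 1: "f = (\<lambda>t. \<Sum>j\<le>d. a1 j * cos (real j * t))" "b = (\<Sum>j\<le>d. a1 j *\<^sub>R C j)"
    by cases
  from assms(2) obtain a2 where 2: "g = (\<lambda>t. \<Sum>j\<le>e. a2 j * cos (real j * t))" "c = (\<Sum>j\<le>e. a2 j *\<^sub>R C j)"
    by cases
  have basis: "cosine_poly C (d + e) (\<lambda>t. a1 j * cos (real j * t) * (a2 k * cos (real k * t)))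
      (a1 j *\<^sub>R C j * a2 k *\<^sub>R C k)" if "j \<le> d" "k \<le> e" for j k
  proof -
    let ?m = "if j \<le> k then k - j else j - k"
    have "cosine_poly C (d + e) (\<lambda>t. (a1 j * a2 k / 2) * cos (real (j + k) * t) + (a1 j * a2 k / 2) * cos (real ?m * t))
      ((a1 j * a2 k / 2) *\<^sub>R C (j + k) + (a1 j * a2 k / 2) *\<^sub>R C ?m)"
      by (intro cosine_poly_add cosine_poly_basis) (use that in auto)
    also have "(\<lambda>t. (a1 j * a2 k / 2) * cos (real (j + k) * t) + (a1 j * a2 k / 2) * cos (real ?m * t))
      = (\<lambda>t. (a1 j * a2 k) * (cos (real j * t) * cos (real k * t)))"
      unfolding cos_mult_cos_nat by (simp add: field_simps)
    also have "\<dots> = (\<lambda>t. a1 j * cos (real j * t) * (a2 k * cos (real k * t)))"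
      by (simp add: mult_ac)
    also have "(a1 j * a2 k / 2) *\<^sub>R C (j + k) + (a1 j * a2 k / 2) *\<^sub>R C ?m = a1 j *\<^sub>R C j * a2 k *\<^sub>R C k"
      by (simp add: C_mult scaleR_add_right mult.commute)
    finally show ?thesis .
  qed
  show ?thesis
    unfolding 1 2 sum_product by (intro cosine_poly_sum basis) auto
qed

lemma cosine_poly_power:
  assumes "cosine_poly C d f b"
  shows "cosine_poly C (n * d) (\<lambda>t. f t ^ n) (b ^ n)"
proof (induction n)
  case 0
  show ?case using cosine_poly_basis[of 0 0 C 1] by (simp add: C_0)
next
  case (Suc n)
  show ?case using cosine_poly_mult[OF assms Suc.IH] by simp
qed

text \<open>The substitution s = (1 + cos t) / 2 maps the line onto [0, 1] and corresponds to r = (1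
  + C 1) / 2, so bounds on [0, 1] become bounds for a cosine polynomial on the whole line.\<close>

lemma polycalc_imp_cosine_poly:
  assumes "polycalc ((1 / 2) *\<^sub>R (1 + C 1)) f b"
  shows "\<exists>d. cosine_poly C d (\<lambda>t. f ((1 + cos t) / 2)) b"
  using assms
proof (induction rule: polycalc.induct)
  case (const c)
  show ?case using cosine_poly_basis[of 0 0 C c] by (auto simp: C_0)
next
  case var
  have "cosine_poly C 1 (\<lambda>t. 1 / 2 * cos (real 0 * t) + 1 / 2 * cos (real 1 * t)) ((1 / 2) *\<^sub>R C 0 + (1 / 2) *\<^sub>R C 1)"
    by (intro cosine_poly_add cosine_poly_basis) auto
  then show ?case by (auto simp: C_0 scaleR_add_right add_divide_distrib)
next
  case (add f b g b')
  then obtain d e where "cosine_poly C d (\<lambda>t. f ((1 + cos t) / 2)) b" "cosine_poly C e (\<lambda>t. g ((1 + cos t) / 2)) b'"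
    by blast
  then have "cosine_poly C (max d e) (\<lambda>t. f ((1 + cos t) / 2) + g ((1 + cos t) / 2)) (b + b')"
    by (intro cosine_poly_add) (auto intro: cosine_poly_mono)
  then show ?case by blast
next
  case (mult f b g b')
  then show ?case using cosine_poly_mult by blast
qed

end

section \<open>The power trick and the continuous functional calculus on [0, 1]\<close>

lemma exponential_beats_linear:
  fixes x :: real
  assumes "1 < x" and "\<And>m. x ^ 2 ^ m \<le> K * 2 ^ m"
  shows False
proof -
  have 1: "(\<lambda>n. real n / x ^ n) \<longlonglongrightarrow> 0"
    using lim_n_over_pown[of x] assms(1) by simp
  have 2: "filterlim (\<lambda>m::nat. 2 ^ m :: nat) at_top at_top"
    by (rule filterlim_subseq) (simp add: strict_mono_def)
  have "(\<lambda>m. K * (real (2 ^ m) / x ^ 2 ^ m)) \<longlonglongrightarrow> K * 0"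
    by (intro tendsto_mult tendsto_const filterlim_compose[OF 1 2])
  moreover have "1 \<le> K * (real (2 ^ m) / x ^ 2 ^ m)" for m
    using assms(2)[of m] assms(1) by (simp add: field_simps)
  ultimately have "1 \<le> K * 0"
    by (intro LIMSEQ_le_const) auto
  then show False by simp
qed

text \<open>\<open>\<rho>\<close> is the value of the character \<open>scal\<close> at
  \<open>r\<close>. It has to lie in [0, 1] so that scalar parts obey the same sup bounds as
  operator norms.\<close>

locale selfadjoint_calculus = chebyshev C for C :: "nat \<Rightarrow> 'a::cstar_algebra unitization" +
  fixes r :: "'a unitization" and \<rho> :: real
  assumes opnorm_C: "opnorm (C n) \<le> 1"
    and r_eq: "r = (1 / 2) *\<^sub>R (1 + C 1)"
    and ustar_r: "ustar r = r"
    and scal_r: "scal r = of_real \<rho>"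
    and \<rho>: "\<rho> \<in> {0..1}"
begin

lemma polycalc_selfadjoint: "polycalc r f b \<Longrightarrow> ustar b = b"
  by (induction rule: polycalc.induct) (auto simp: ustar_simps ustar_r polycalc_commute)

lemma polycalc_scal: "polycalc r f b \<Longrightarrow> scal b = of_real (f \<rho>)"
  by (induction rule: polycalc.induct) (auto simp: scal_r)

lemma opnorm_cosine_poly:
  assumes "cosine_poly C d F b" and bound: "\<And>t. \<bar>F t\<bar> \<le> s"
  shows "opnorm b \<le> 2 * (real d + 1) * s"
  using assms(1)
proof cases
  case (1 a)
  have s: "0 \<le> s" using bound[of 0] by linarith
  have a: "\<bar>a j\<bar> \<le> 2 * s" if "j \<le> d" for j
    by (rule cosine_coefficient_bound[OF _ that]) (use bound 1 in simp)
  have C: "norm (lmul (C j) x) \<le> norm x" for j x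
    using lmul_le_opnorm[of "C j" x] opnorm_C[of j] mult_right_mono[of "opnorm (C j)" 1 "norm x"] by simp
  show ?thesis
  proof (rule opnorm_le)
    fix x
    have "norm (lmul b x) \<le> (\<Sum>j\<le>d. norm (a j *\<^sub>R lmul (C j) x))"
      unfolding 1 by (simp only: lmul.sum_left lmul.scaleR_left norm_sum)
    also have "\<dots> \<le> (\<Sum>j\<le>d. 2 * s * norm x)"
      by (intro sum_mono) (auto intro!: mult_mono a C simp: s)
    finally show "norm (lmul b x) \<le> 2 * (real d + 1) * s * norm x"
      by (simp add: algebra_simps)
  qed (use s in simp)
qed

(* The crude bound loses a factor linear in the degree; taking powers, which the C*-identity allows,
   removes it. *)
lemma opnorm_polycalc:
  assumes b: "polycalc r f b" and bound: "\<And>t. t \<in> {0..1} \<Longrightarrow> \<bar>f t\<bar> \<le> s"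
  shows "opnorm b \<le> s"
proof -
  have s: "0 \<le> s" using bound[of 0] by simp
  define F where "F t = f ((1 + cos t) / 2)" for t :: real
  have F: "\<bar>F t\<bar> \<le> s" for t
  proof -
    have "(1 + cos t) / 2 \<in> {0..1}"
      using cos_ge_minus_one[of t] cos_le_one[of t] unfolding atLeastAtMost_iff by (auto simp del: cos_ge_minus_one)
    then show ?thesis unfolding F_def by (rule bound)
  qed
  from b obtain d where d: "cosine_poly C d F b"
    using polycalc_imp_cosine_poly[of f b] unfolding r_eq F_def by blast
  have crude: "opnorm b ^ 2 ^ m \<le> 2 * (real d + 1) * 2 ^ m * s ^ 2 ^ m" for m
  proof -
    have "opnorm b ^ 2 ^ m \<le> opnorm (b ^ 2 ^ m)"
      by (intro opnorm_power_two_power polycalc_selfadjoint[OF b])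
    also have "\<dots> \<le> 2 * (real (2 ^ m * d) + 1) * s ^ 2 ^ m"
      by (rule opnorm_cosine_poly[OF cosine_poly_power[OF d]])
         (use F in \<open>auto simp: power_abs intro: power_mono\<close>)
    also have "2 * (real (2 ^ m * d) + 1) \<le> 2 * (real d + 1) * 2 ^ m"
      by (simp add: algebra_simps)
    finally show ?thesis using s by (simp add: mult_right_mono)
  qed
  show ?thesis
  proof (rule ccontr)
    assume less: "\<not> opnorm b \<le> s"
    have "s \<noteq> 0" using crude[of 0] less by auto
    with s have s: "0 < s" by simp
    show False
    proof (rule exponential_beats_linear)
      show "1 < opnorm b / s" using less s by simp
      show "(opnorm b / s) ^ 2 ^ m \<le> 2 * (real d + 1) * 2 ^ m" for m
        using crude[of m] s by (simp add: power_divide divide_le_eq)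
    qed
  qed
qed

text \<open>The factor 3 is one for the operator norm plus two for the scalar part, which is a value
  of \<open>f\<close> on [0, 1].\<close>

lemma norm_polycalc:
  assumes b: "polycalc r f b" and bound: "\<And>t. t \<in> {0..1} \<Longrightarrow> \<bar>f t\<bar> \<le> s"
  shows "norm b \<le> 3 * s"
  using norm_le_opnorm[of b] opnorm_polycalc[OF assms] bound[OF \<rho>] polycalc_scal[OF b] by simp

text \<open>Bernstein polynomials are linear in \<open>f\<close> and preserve sup bounds, so
  linearity and the norm bound of the calculus hold already before the limit.\<close>

definition bernstein_approx :: "nat \<Rightarrow> (real \<Rightarrow> real) \<Rightarrow> real \<Rightarrow> real"
  where "bernstein_approx n f t = (\<Sum>k\<le>n. f (k / n) * Bernstein n k t)"

definition bernstein_elem :: "nat \<Rightarrow> (real \<Rightarrow> real) \<Rightarrow> 'a unitization"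
  where "bernstein_elem n f = (\<Sum>k\<le>n. f (k / n) *\<^sub>R (real (n choose k) *\<^sub>R (r ^ k * (1 - r) ^ (n - k))))"

definition fcalc :: "(real \<Rightarrow> real) \<Rightarrow> 'a unitization"
  where "fcalc f = lim (\<lambda>n. bernstein_elem n f)"

lemma polycalc_bernstein: "polycalc r (bernstein_approx n f) (bernstein_elem n f)"
proof -
  have "polycalc r (\<lambda>t. real (n choose k) * (t ^ k * (1 - t) ^ (n - k)))
      (real (n choose k) *\<^sub>R (r ^ k * (1 - r) ^ (n - k)))" for k
    by (intro polycalc_scaleR polycalc.mult polycalc_power polycalc_diff polycalc.var polycalc_one)
  then have "polycalc r (\<lambda>t. \<Sum>k\<le>n. f (k / n) * (real (n choose k) * (t ^ k * (1 - t) ^ (n - k)))) (bernstein_elem n f)"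
    unfolding bernstein_elem_def by (intro polycalc_sum, rule polycalc_scaleR)
  then show ?thesis
    by (simp add: bernstein_approx_def[abs_def] Bernstein_def mult.assoc)
qed

lemma bernstein_approx_converges:
  assumes "continuous_on {0..1} f" "0 < e"
  obtains N where "\<And>n t. N \<le> n \<Longrightarrow> t \<in> {0..1} \<Longrightarrow> \<bar>f t - bernstein_approx n f t\<bar> < e"
  using Bernstein_Weierstrass[OF assms] unfolding bernstein_approx_def by blast

lemma convergent_bernstein_elem:
  assumes f: "continuous_on {0..1} f"
  shows "convergent (\<lambda>n. bernstein_elem n f)"
proof -
  have "Cauchy (\<lambda>n. bernstein_elem n f)"
  proof (rule CauchyI)
    fix e :: real assume e: "0 < e"
    \<comment> \<open>Two errors of e / 12 add up to e / 6, and the factor 3 of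
      \<open>norm_polycalc\<close> leaves e / 2.\<close>
    obtain N where N: "\<And>n t. N \<le> n \<Longrightarrow> t \<in> {0..1} \<Longrightarrow> \<bar>f t - bernstein_approx n f t\<bar> < e / 12"
      using bernstein_approx_converges[OF f, of "e / 12"] e by auto
    have "norm (bernstein_elem m f - bernstein_elem n f) < e" if "N \<le> m" "N \<le> n" for m n
    proof -
      have "norm (bernstein_elem m f - bernstein_elem n f) \<le> 3 * (e / 6)"
      proof (rule norm_polycalc[OF polycalc_diff[OF polycalc_bernstein polycalc_bernstein]])
        fix t :: real assume "t \<in> {0..1}"
        then show "\<bar>bernstein_approx m f t - bernstein_approx n f t\<bar> \<le> e / 6"
          using N[OF that(1), of t] N[OF that(2), of t] by linarith
      qed
      then show ?thesis using e by simp
    qed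
    then show "\<exists>N. \<forall>m\<ge>N. \<forall>n\<ge>N. norm (bernstein_elem m f - bernstein_elem n f) < e" by blast
  qed
  then show ?thesis by (simp add: Cauchy_convergent_iff)
qed

lemma tendsto_fcalc:
  "continuous_on {0..1} f \<Longrightarrow> (\<lambda>n. bernstein_elem n f) \<longlonglongrightarrow> fcalc f"
  unfolding fcalc_def by (simp add: convergent_bernstein_elem convergent_LIMSEQ_iff[symmetric])

text \<open>Frees the calculus from its Bernstein approximants. This is what products require, since
  a product of Bernstein polynomials is not the Bernstein polynomial of the product; it also
  identifies the value at a function that agrees with a polynomial on [0, 1].\<close>

lemma fcalc_unique:
  assumes f: "continuous_on {0..1} f" and b: "\<And>n. polycalc r (p n) (b n)" and lim: "b \<longlonglongrightarrow> l"
    and p: "\<And>e. 0 < e \<Longrightarrow> \<exists>N. \<forall>n\<ge>N. \<forall>t\<in>{0..1}. \<bar>f t - p n t\<bar> < e"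
  shows "fcalc f = l"
proof -
  have "(\<lambda>n. bernstein_elem n f - b n) \<longlonglongrightarrow> 0"
  proof (rule LIMSEQ_I)
    fix e :: real assume e: "0 < e"
    obtain N where N: "\<And>n t. N \<le> n \<Longrightarrow> t \<in> {0..1} \<Longrightarrow> \<bar>f t - bernstein_approx n f t\<bar> < e / 12"
      using bernstein_approx_converges[OF f, of "e / 12"] e by auto
    obtain M where M: "\<And>n t. M \<le> n \<Longrightarrow> t \<in> {0..1} \<Longrightarrow> \<bar>f t - p n t\<bar> < e / 12"
      using p[of "e / 12"] e by (metis zero_less_divide_iff zero_less_numeral)
    have "norm (bernstein_elem n f - b n) < e" if "max M N \<le> n" for n
    proof -
      have "norm (bernstein_elem n f - b n) \<le> 3 * (e / 6)"
      proof (rule norm_polycalc[OF polycalc_diff[OF polycalc_bernstein b]])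
        fix t :: real assume t: "t \<in> {0..1}"
        show "\<bar>bernstein_approx n f t - p n t\<bar> \<le> e / 6"
          using N[OF _ t, of n] M[OF _ t, of n] that by (simp only: max.bounded_iff) argo
      qed
      then show ?thesis using e by simp
    qed
    then show "\<exists>N. \<forall>n\<ge>N. norm (bernstein_elem n f - b n - 0) < e"
      by (intro exI[of _ "max M N"]) simp
  qed
  moreover have "(\<lambda>n. bernstein_elem n f - b n) \<longlonglongrightarrow> fcalc f - l"
    by (intro tendsto_diff tendsto_fcalc f lim)
  ultimately show ?thesis using LIMSEQ_unique by fastforce
qed

lemma fcalc_polycalc: "polycalc r f b \<Longrightarrow> fcalc f = b"
  by (rule fcalc_unique[where p = "\<lambda>_. f" and b = "\<lambda>_. b"]) (auto intro: continuous_on_polycalc)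

lemma fcalc_add:
  assumes "continuous_on {0..1} f" "continuous_on {0..1} g"
  shows "fcalc (\<lambda>t. f t + g t) = fcalc f + fcalc g"
proof -
  have "(\<lambda>n. bernstein_elem n (\<lambda>t. f t + g t)) = (\<lambda>n. bernstein_elem n f + bernstein_elem n g)"
    by (simp add: bernstein_elem_def distrib_right scaleR_add_left sum.distrib)
  then have "(\<lambda>n. bernstein_elem n (\<lambda>t. f t + g t)) \<longlonglongrightarrow> fcalc f + fcalc g"
    using tendsto_add[OF tendsto_fcalc tendsto_fcalc] assms by simp
  then show ?thesis
    unfolding fcalc_def by (rule limI)
qed

lemma fcalc_scaleR:
  assumes "continuous_on {0..1} f"
  shows "fcalc (\<lambda>t. c * f t) = c *\<^sub>R fcalc f"
proof -
  have "(\<lambda>n. bernstein_elem n (\<lambda>t. c * f t)) = (\<lambda>n. c *\<^sub>R bernstein_elem n f)"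
    by (simp add: bernstein_elem_def scaleR_sum_right mult.assoc)
  then have "(\<lambda>n. bernstein_elem n (\<lambda>t. c * f t)) \<longlonglongrightarrow> c *\<^sub>R fcalc f"
    using tendsto_scaleR[OF tendsto_const tendsto_fcalc] assms by simp
  then show ?thesis
    unfolding fcalc_def by (rule limI)
qed

lemma fcalc_sum:
  "(\<And>i. i \<in> I \<Longrightarrow> continuous_on {0..1} (f i)) \<Longrightarrow> fcalc (\<lambda>t. \<Sum>i\<in>I. f i t) = (\<Sum>i\<in>I. fcalc (f i))"
proof (induction I rule: infinite_finite_induct)
  case (insert i I)
  then show ?case
    using fcalc_add[of "f i" "\<lambda>t. \<Sum>i\<in>I. f i t"] by (simp add: continuous_on_sum)
qed (use fcalc_polycalc[OF polycalc.const[of r 0]] in auto)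

text \<open>Bernstein weights are nonnegative with sum 1, so every approximant obeys the same sup
  bound and the limit loses nothing.\<close>

lemma norm_fcalc:
  assumes f: "continuous_on {0..1} f" and bound: "\<And>t. t \<in> {0..1} \<Longrightarrow> \<bar>f t\<bar> \<le> s"
  shows "norm (fcalc f) \<le> 3 * s"
proof (rule Lim_norm_ubound[OF _ tendsto_fcalc[OF f]])
  have Bern: "\<bar>bernstein_approx n f t\<bar> \<le> s" if t: "t \<in> {0..1}" for n t
  proof -
    have "\<bar>bernstein_approx n f t\<bar> \<le> (\<Sum>k\<le>n. \<bar>f (k / n)\<bar> * Bernstein n k t)"
      unfolding bernstein_approx_def
      by (rule order.trans[OF sum_abs]) (use t in \<open>auto simp: abs_mult Bernstein_nonneg\<close>)
    also have "\<dots> \<le> (\<Sum>k\<le>n. s * Bernstein n k t)"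
      using t by (intro sum_mono mult_right_mono bound Bernstein_nonneg) (auto simp: divide_le_eq)
    also have "\<dots> = s"
      by (simp flip: sum_distrib_left)
    finally show ?thesis .
  qed
  show "\<forall>\<^sub>F n in sequentially. norm (bernstein_elem n f) \<le> 3 * s"
    by (intro always_eventually allI norm_polycalc[OF polycalc_bernstein] Bern)
qed simp

text \<open>The product of the two approximants tends to 0 uniformly on [0, 1], so uniqueness
  identifies the limit of the corresponding elements with the value of the calculus at the zero
  function.\<close>

lemma fcalc_mult_eq_0:
  assumes f: "continuous_on {0..1} f" and g: "continuous_on {0..1} g"
    and zero: "\<And>t. t \<in> {0..1} \<Longrightarrow> f t * g t = 0"
  shows "fcalc f * fcalc g = 0"
proof -
  have "fcalc (\<lambda>_. 0) = fcalc f * fcalc g"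
  proof (rule fcalc_unique)
    show "polycalc r (\<lambda>t. bernstein_approx n f t * bernstein_approx n g t) (bernstein_elem n f * bernstein_elem n g)" for n
      by (intro polycalc.mult polycalc_bernstein)
    show "(\<lambda>n. bernstein_elem n f * bernstein_elem n g) \<longlonglongrightarrow> fcalc f * fcalc g"
      by (intro tendsto_mult tendsto_fcalc f g)
  next
    fix e :: real assume e: "0 < e"
    obtain K where K: "\<And>t. t \<in> {0..1} \<Longrightarrow> \<bar>f t\<bar> + \<bar>g t\<bar> \<le> K" "1 \<le> K"
    proof -
      have "compact ((\<lambda>t. \<bar>f t\<bar> + \<bar>g t\<bar>) ` {0..1})"
        by (intro compact_continuous_image continuous_intros f g) simp
      then obtain K where "\<And>t. t \<in> {0..1} \<Longrightarrow> norm (\<bar>f t\<bar> + \<bar>g t\<bar>) \<le> K"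
        by (meson bounded_iff compact_imp_bounded imageI)
      then show thesis by (intro that[of "max K 1"]) force+
    qed
    \<comment> \<open>There are three error terms of size at most K d, the quadratic one because d
      \<le> 1 \<le> K; and 3 K d < 4 K d \<le> e.\<close>
    define d where "d = min 1 (e / (4 * K))"
    have d: "0 < d" "d \<le> 1" "d * (4 * K) \<le> e" using e K by (auto simp: d_def min_def field_simps)
    obtain N where N: "\<And>n t. N \<le> n \<Longrightarrow> t \<in> {0..1} \<Longrightarrow> \<bar>f t - bernstein_approx n f t\<bar> < d"
      using bernstein_approx_converges[OF f d(1)] by auto
    obtain M where M: "\<And>n t. M \<le> n \<Longrightarrow> t \<in> {0..1} \<Longrightarrow> \<bar>g t - bernstein_approx n g t\<bar> < d"
      using bernstein_approx_converges[OF g d(1)] by auto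
    have "\<bar>0 - bernstein_approx n f t * bernstein_approx n g t\<bar> < e" if n: "max M N \<le> n" and t: "t \<in> {0..1}" for n t
    proof -
      define x y where "x = bernstein_approx n f t - f t" and "y = bernstein_approx n g t - g t"
      have xy: "\<bar>x\<bar> < d" "\<bar>y\<bar> < d" using N[of n t] M[of n t] n t by (auto simp: x_def y_def)
      have "bernstein_approx n f t * bernstein_approx n g t = f t * y + x * g t + x * y"
        using zero[OF t] by (simp add: x_def y_def algebra_simps)
      then have "\<bar>bernstein_approx n f t * bernstein_approx n g t\<bar> \<le> \<bar>f t\<bar> * \<bar>y\<bar> + \<bar>x\<bar> * \<bar>g t\<bar> + \<bar>x\<bar> * \<bar>y\<bar>"
        by (simp flip: abs_mult)
      also have "\<dots> \<le> K * d + d * K + d * K"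
        using K(1)[OF t] K(2) xy d by (intro add_mono mult_mono) auto
      also have "\<dots> < d * (4 * K)"
        using d(1) K(2) by simp
      finally show ?thesis using d(3) by simp
    qed
    then show "\<exists>N. \<forall>n\<ge>N. \<forall>t\<in>{0..1}. \<bar>0 - bernstein_approx n f t * bernstein_approx n g t\<bar> < e" by blast
  qed simp
  then show ?thesis
    using fcalc_polycalc[OF polycalc.const[of r 0]] by simp
qed

end

section \<open>The Cayley transform\<close>

definition imag_unit :: "'a::complex_banach_algebra unitization"
  where "imag_unit = Unitize \<i> 0"

text \<open>As a type class instance the unitization is a real algebra, so scaling by i is expressed
  as multiplication by a central element of square -1.\<close>

lemma imag_unit_commute: "imag_unit * b = b * imag_unit"
  and imag_unit_square: "imag_unit * (imag_unit * b) = - b"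
  and norm_imag_unit: "norm (imag_unit :: 'a unitization) = 1"
  and ustar_imag_unit: "ustar imag_unit = - imag_unit"
  for b :: "'a::cstar_algebra unitization"
  by (auto simp: imag_unit_def unitization_eq_iff norm_unitization_def ustar_def scaleC_scaleC
      scaleC_minus_left)

(* The Cayley transform u of h is unitary, and (1 + h^2)^-1 = (1 + Re u) / 2. *)
lemma cayley_calculus:
  fixes h :: "'a::cstar_algebra unitization"
  assumes h: "ustar h = h" "norm h < 1"
  obtains C r \<rho> where "selfadjoint_calculus C r \<rho>" "r * (1 + h * h) = 1" "(1 + h * h) * r = 1"
proof -
  define x where "x = imag_unit * h"
  have xs: "ustar x = - x"
    by (simp add: x_def ustar_simps h ustar_imag_unit imag_unit_commute)
  have xx: "x * x = - (h * h)"
    unfolding x_def by (metis imag_unit_commute imag_unit_square mult.assoc mult_minus_left)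
  \<comment> \<open>The bound on \<open>h\<close> serves to invert 1 - i h by a Neumann series. With
    p = 1 - i h, q = 1 + i h and their inverses y and y', the transform is u = q y.\<close>
  have "norm x < 1"
    using norm_mult_ineq[of imag_unit h] h(2) by (simp add: x_def norm_imag_unit)
  then obtain y where y: "(1 - x) * y = 1" "y * (1 - x) = 1"
    using ex_inverse_one_minus by blast
  define y' p q where "y' = ustar y" and "p = 1 - x" and "q = 1 + x"
  have p: "p * y = 1" "y * p = 1"
    using y by (simp_all add: p_def)
  have ustar_pq: "ustar p = q" "ustar q = p"
    by (simp_all add: p_def q_def ustar_simps xs diff_conv_add_uminus del: add_uminus_conv_diff)
  have q: "y' * q = 1" "q * y' = 1"
    using arg_cong[OF p(1), of ustar] arg_cong[OF p(2), of ustar]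
    unfolding ustar_simps ustar_pq y'_def by auto
  have pq: "p * q = q * p" "p + q = 2" by (simp_all add: p_def q_def algebra_simps)
  have cancel: "p * (y * z) = z" "y * (p * z) = z" "q * (y' * z) = z" "y' * (q * z) = z" for z
    by (simp_all add: p q flip: mult.assoc)
  have yy': "y * y' = y' * y"
  proof -
    have "y * y' = (y * y') * ((p * q) * (y' * y))"
      by (simp add: mult.assoc cancel p q)
    also have "\<dots> = y' * y"
      unfolding pq by (simp add: mult.assoc cancel p q)
    finally show ?thesis .
  qed
  define u v where "u = q * y" and "v = y' * p"
  have v: "v = ustar u"
    by (simp add: u_def v_def ustar_simps ustar_pq y'_def)
  have vu: "v * u = 1"
  proof -
    have "v * u = y' * ((p * q) * y)" by (simp add: u_def v_def mult.assoc)
    also have "\<dots> = 1" unfolding pq by (simp add: mult.assoc cancel p q)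
    finally show ?thesis .
  qed
  have uv: "u * v = 1"
  proof -
    have "u * v = q * ((y * y') * p)" by (simp add: u_def v_def mult.assoc)
    also have "\<dots> = 1" unfolding yy' by (simp add: mult.assoc cancel p q)
    finally show ?thesis .
  qed
  define r where "r = y * y'"
  have hh: "1 + h * h = p * q"
    by (simp add: p_def q_def algebra_simps xx)
  have r1: "r * (1 + h * h) = 1"
    unfolding r_def hh pq by (simp add: mult.assoc cancel p q)
  have r2: "(1 + h * h) * r = 1"
    unfolding r_def hh yy' by (simp add: mult.assoc cancel p q)
  \<comment> \<open>Since p + q = 2, u + 1 = 2 y and v + 1 = 2 y', while y + y' = y (p + q) y' = 2
    r.\<close>
  have r4: "4 *\<^sub>R r = 2 + u + v"
  proof -
    have "u + 1 = (q + p) * y" "v + 1 = y' * (p + q)"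
      by (simp_all add: u_def v_def distrib_left distrib_right p q)
    moreover have "q + p = 2" "p + q = 2" using pq(2) by (simp_all add: add.commute)
    ultimately have "u + 1 = 2 * y" "v + 1 = y' * 2" by simp_all
    then have "(u + 1) + (v + 1) = 2 *\<^sub>R (y + y')"
      by (simp add: mult_2 mult_2_right scaleR_2)
    moreover have "(u + 1) + (v + 1) = 2 + u + v"
      by simp
    moreover have "y + y' = y * ((p + q) * y')"
      by (simp add: distrib_left distrib_right mult.assoc cancel q)
    moreover have "\<dots> = 2 *\<^sub>R r"
      unfolding pq by (simp add: r_def mult_2 mult_2_right scaleR_2 distrib_left)
    ultimately show ?thesis by simp
  qed
  define C where "C n = (1 / 2) *\<^sub>R (u ^ n + v ^ n)" for n
  have uv_pow: "u ^ n * v ^ n = 1" "v ^ n * u ^ n = 1" for n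
  proof -
    have cancel_uv: "u * (v * z) = z" "v * (u * z) = z" for z
      by (simp_all add: uv vu flip: mult.assoc)
    show "u ^ n * v ^ n = 1"
      by (induction n) (simp_all only: power_0 mult_1_left power_Suc2[of u] power_Suc[of v] mult.assoc cancel_uv)
    show "v ^ n * u ^ n = 1"
      by (induction n) (simp_all only: power_0 mult_1_left power_Suc2[of v] power_Suc[of u] mult.assoc cancel_uv)
  qed
  have uv_le: "u ^ j * v ^ (j + k) = v ^ k" "v ^ j * u ^ (j + k) = u ^ k"
    and uv_ge: "u ^ (j + k) * v ^ k = u ^ j" "v ^ (j + k) * u ^ k = v ^ j" for j k
  proof -
    show "u ^ j * v ^ (j + k) = v ^ k" "v ^ j * u ^ (j + k) = u ^ k"
      by (simp_all add: power_add uv_pow flip: mult.assoc)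
    show "u ^ (j + k) * v ^ k = u ^ j" "v ^ (j + k) * u ^ k = v ^ j"
      by (simp_all add: power_add uv_pow mult.assoc)
  qed
  have pn: "ustar (u ^ n) * u ^ n = 1" "ustar (v ^ n) * v ^ n = 1" for n
    using uv_pow v by (simp_all add: ustar_power ustar_simps)
  \<comment> \<open>Applying the character \<open>scal\<close> to r (1 + h h) = 1 determines
    \<open>\<rho>\<close>; \<open>scal h\<close> is real because \<open>h\<close> is
    self-adjoint.\<close>
  have "selfadjoint_calculus C r (1 / (1 + (Re (scal h))\<^sup>2))"
  proof (unfold_locales, goal_cases)
    case 1
    then show ?case by (simp add: C_def scaleR_2[symmetric])
  next
    case (2 j k)
    show ?case
    proof (cases "j \<le> k")
      case True
      then obtain m where k: "k = j + m" by (auto simp: le_iff_add)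
      show ?thesis
        unfolding k C_def distrib_left distrib_right mult_scaleR_left mult_scaleR_right uv_le
        by (simp add: scaleR_add_right add_ac flip: power_add)
    next
      case False
      then obtain m where j: "j = m + k" "m \<noteq> 0" by (metis add.commute le_iff_add nle_le add_0)
      show ?thesis
        unfolding j(1) C_def distrib_left distrib_right mult_scaleR_left mult_scaleR_right uv_ge
        using j(2) by (simp add: scaleR_add_right add_ac flip: power_add)
    qed
  next
    case (3 n)
    show ?case
    proof (rule opnorm_le)
      fix x :: 'a
      have "norm (lmul (C n) x) \<le> (norm (lmul (u ^ n) x) + norm (lmul (v ^ n) x)) / 2"
        using norm_triangle_ineq[of "lmul (u ^ n) x" "lmul (v ^ n) x"]
        by (simp add: C_def lmul.scaleR_left lmul.add_left)
      also have "\<dots> \<le> norm x"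
        using add_mono[OF norm_lmul_unitary[OF pn(1)] norm_lmul_unitary[OF pn(2)], of n x n x] by simp
      finally show "norm (lmul (C n) x) \<le> 1 * norm x" by simp
    qed simp
  next
    case 4
    have "4 *\<^sub>R r = 4 *\<^sub>R ((1 / 2) *\<^sub>R (1 + C 1))"
      unfolding r4 by (simp add: C_def scaleR_add_right scaleR_2)
    then show ?case by (simp only: scaleR_cancel_left) simp
  next
    case 5
    show ?case by (simp add: r_def y'_def ustar_simps)
  next
    case 6
    have "cnj (scal h) = scal h" using arg_cong[OF h(1), of scal] by (simp add: ustar_def)
    then obtain s where s: "scal h = complex_of_real s"
      by (auto simp: complex_eq_iff intro: that[of "Re (scal h)"])
    have "scal r * (1 + scal h * scal h) = 1" using arg_cong[OF r1, of scal] by simp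
    then have "scal r * complex_of_real (1 + s\<^sup>2) = 1" by (simp add: s power2_eq_square)
    moreover have "1 + s\<^sup>2 \<noteq> 0"
      using zero_le_power2[of s] by linarith
    then have "complex_of_real (1 + s\<^sup>2) \<noteq> 0"
      by (simp only: of_real_eq_0_iff not_False_eq_True)
    ultimately have "scal r = 1 / complex_of_real (1 + s\<^sup>2)"
      by (metis nonzero_eq_divide_eq)
    then show ?case by (simp add: s)
  next
    case 7
    show ?case by (simp add: add_pos_nonneg)
  qed
  then show thesis using r1 r2 by (rule that)
qed

subsection \<open>Bilinear maps preserving zero products\<close>

definition tent :: "real \<Rightarrow> real"
  where "tent s = max 0 (1 - \<bar>s\<bar>)"

lemma tent_nonneg: "0 \<le> tent s"
  by (simp add: tent_def)

text \<open>A partition of unity up to s = m; the falling flank beyond m is what the induction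
  carries.\<close>

lemma sum_tent:
  assumes "0 \<le> s"
  shows "(\<Sum>j\<le>m. tent (s - real j)) = max 0 (min 1 (real m + 1 - s))"
  by (induction m) (use assms in \<open>auto simp: tent_def max_def min_def abs_if\<close>)

text \<open>Piecewise linear interpolation at the integers reproduces the identity; again the branch
  beyond m is there for the induction.\<close>

lemma sum_index_tent:
  assumes "0 \<le> s"
  shows "(\<Sum>j\<le>m. real j * tent (s - real j)) = (if s \<le> real m then s else real m * max 0 (real m + 1 - s))"
proof (induction m)
  case (Suc m)
  consider "s \<le> real m" | "real m < s" "s \<le> real m + 1" | "real m + 1 < s" by linarith
  then show ?case
  proof cases
    case 1
    then have "tent (s - real (Suc m)) = 0" by (simp add: tent_def)
    then show ?thesis using Suc 1 by simp
  next
    case 2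
    then have tent: "tent (s - real (Suc m)) = s - real m" by (simp add: tent_def)
    have IH: "(\<Sum>j\<le>m. real j * tent (s - real j)) = real m * (real m + 1 - s)"
      using Suc 2 by simp
    have "(\<Sum>j\<le>Suc m. real j * tent (s - real j)) = real m * (real m + 1 - s) + (real m + 1) * (s - real m)"
      unfolding sum.atMost_Suc IH tent by simp
    also have "\<dots> = s" by (simp add: algebra_simps)
    finally show ?thesis using 2 by simp
  next
    case 3
    then have "tent (s - real (Suc m)) = max 0 (real (Suc m) + 1 - s)" by (simp add: tent_def)
    then show ?thesis using Suc 3 by simp
  qed
qed (use assms in simp)

text \<open>For residues i and k this is i - k modulo 3, represented in {-1, 0, 1}; 3 is the least
  modulus that separates these values.\<close>

definition mod3_sign :: "nat \<Rightarrow> nat \<Rightarrow> real"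
  where "mod3_sign i k = (if k = (i + 1) mod 3 then -1 else if i = (k + 1) mod 3 then 1 else 0)"

(* For neighbouring indices the difference j - k only depends on the residues of j and k mod 3. *)
lemma tridiagonal_bound:
  fixes \<Psi> :: "'b::real_normed_vector \<Rightarrow> 'b \<Rightarrow> 'c::real_normed_vector"
  assumes "bounded_bilinear \<Psi>"
    and zero: "\<And>j k. j + 1 < k \<or> k + 1 < j \<Longrightarrow> \<Psi> (e j) (e k) = 0"
    and M: "\<And>i. norm (\<Sum>j\<le>n. of_bool (j mod 3 = i) *\<^sub>R e j) \<le> M"
    and K: "\<And>b c. norm (\<Psi> b c) \<le> norm b * norm c * K" "0 \<le> K"
  shows "norm (\<Psi> (\<Sum>j\<le>n. real j *\<^sub>R e j) (\<Sum>k\<le>n. e k) - \<Psi> (\<Sum>j\<le>n. e j) (\<Sum>k\<le>n. real k *\<^sub>R e k))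
    \<le> 9 * (M * M * K)"
proof -
  interpret bounded_bilinear \<Psi> by fact
  define G where "G i = (\<Sum>j\<le>n. of_bool (j mod 3 = i) *\<^sub>R e j)" for i
  have sign: "(real j - real k) *\<^sub>R \<Psi> (e j) (e k) = mod3_sign (j mod 3) (k mod 3) *\<^sub>R \<Psi> (e j) (e k)" for j k
  proof -
    consider "j = k" | "k = j + 1" | "j = k + 1" | "j + 1 < k \<or> k + 1 < j" by linarith
    then show ?thesis
    proof cases
      case 1
      have "j mod 3 \<noteq> (j mod 3 + 1) mod 3" by presburger
      then show ?thesis by (simp add: 1 mod3_sign_def)
    next
      case 2
      have "k mod 3 = (j mod 3 + 1) mod 3" unfolding 2 by presburger
      then show ?thesis by (simp add: 2 mod3_sign_def)
    next
      case 3
      have "j mod 3 = (k mod 3 + 1) mod 3" "k mod 3 \<noteq> (j mod 3 + 1) mod 3" unfolding 3 by presburger+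
      then have "mod3_sign (j mod 3) (k mod 3) = 1" by (simp add: mod3_sign_def)
      then show ?thesis by (simp add: 3)
    next
      case 4
      then show ?thesis by (simp add: zero)
    qed
  qed
  \<comment> \<open>For given j and k exactly one pair of residues contributes. Inserted into the
    double sum, this lets the coefficient leave the sums over j and k, so that nine terms formed
    from the class sums \<open>G\<close> remain.\<close>
  have pick: "(\<Sum>i<3. \<Sum>l<3. (mod3_sign i l * (of_bool (j mod 3 = i) * of_bool (k mod 3 = l))) *\<^sub>R v)
      = mod3_sign (j mod 3) (k mod 3) *\<^sub>R v" for j k :: nat and v :: 'c
  proof -
    have "(\<Sum>i<3. \<Sum>l<3. (mod3_sign i l * (of_bool (j mod 3 = i) * of_bool (k mod 3 = l))) *\<^sub>R v)
      = (\<Sum>i<3. \<Sum>l<3. if l = k mod 3 then if i = j mod 3 then mod3_sign i l *\<^sub>R v else 0 else 0)"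
      by (intro sum.cong) (auto simp: of_bool_def)
    then show ?thesis by simp
  qed
  have "\<Psi> (\<Sum>j\<le>n. real j *\<^sub>R e j) (\<Sum>k\<le>n. e k) - \<Psi> (\<Sum>j\<le>n. e j) (\<Sum>k\<le>n. real k *\<^sub>R e k)
      = (\<Sum>j\<le>n. \<Sum>k\<le>n. (real j - real k) *\<^sub>R \<Psi> (e j) (e k))"
    unfolding sum_left
    by (simp add: sum_right scaleR_left scaleR_right scaleR_sum_right sum_subtractf scaleR_diff_left)
  also have "\<dots> = (\<Sum>j\<le>n. \<Sum>k\<le>n. \<Sum>i<3. \<Sum>l<3.
      (mod3_sign i l * (of_bool (j mod 3 = i) * of_bool (k mod 3 = l))) *\<^sub>R \<Psi> (e j) (e k))"
    unfolding pick sign ..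
  also have "\<dots> = (\<Sum>j\<le>n. \<Sum>i<3. \<Sum>k\<le>n. \<Sum>l<3.
      (mod3_sign i l * (of_bool (j mod 3 = i) * of_bool (k mod 3 = l))) *\<^sub>R \<Psi> (e j) (e k))"
    by (intro sum.cong refl sum.swap)
  also have "\<dots> = (\<Sum>i<3. \<Sum>j\<le>n. \<Sum>l<3. \<Sum>k\<le>n.
      (mod3_sign i l * (of_bool (j mod 3 = i) * of_bool (k mod 3 = l))) *\<^sub>R \<Psi> (e j) (e k))"
    by (subst sum.swap) (intro sum.cong refl sum.swap)
  also have "\<dots> = (\<Sum>i<3. \<Sum>l<3. \<Sum>j\<le>n. \<Sum>k\<le>n.
      (mod3_sign i l * (of_bool (j mod 3 = i) * of_bool (k mod 3 = l))) *\<^sub>R \<Psi> (e j) (e k))"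
    by (intro sum.cong refl sum.swap)
  also have "\<dots> = (\<Sum>i<3. \<Sum>l<3. mod3_sign i l *\<^sub>R \<Psi> (G i) (G l))"
    unfolding G_def sum_left by (simp add: sum_right scaleR_left scaleR_right scaleR_sum_right mult_ac)
  also have "norm \<dots> \<le> (\<Sum>i<(3::nat). \<Sum>l<(3::nat). M * M * K)"
  proof (intro order.trans[OF norm_sum] sum_mono)
    fix i l :: nat
    have "norm (mod3_sign i l *\<^sub>R \<Psi> (G i) (G l)) \<le> 1 * norm (\<Psi> (G i) (G l))"
      unfolding norm_scaleR by (intro mult_right_mono) (auto simp: mod3_sign_def)
    also have "\<dots> \<le> norm (G i) * norm (G l) * K" using K(1) by simp
    also have "\<dots> \<le> M * M * K"
      using M[of i] M[of l] K(2) order.trans[OF norm_ge_zero M[of i]]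
      by (intro mult_right_mono mult_mono) (auto simp: G_def)
    finally show "norm (mod3_sign i l *\<^sub>R \<Psi> (G i) (G l)) \<le> M * M * K" .
  qed
  also have "\<dots> = 9 * (M * M * K)" by simp
  finally show ?thesis .
qed

context selfadjoint_calculus
begin

text \<open>The tents with mesh 1 / n give elements \<open>e j\<close> whose sum is 1 and whose sum
  weighted by j is n r. So n times the difference of the two sides is the sum of (j - k)
  \<open>\<Psi> (e j) (e k)\<close>, where the terms with |j - k| > 1 vanish, and its norm is at
  most 81 K for every n. Here 81 = 9 * 3 * 3: nine pairs of residues mod 3, and the constant of
  \<open>norm_fcalc\<close> twice.\<close>

lemma fcalc_zero_product_imp_balanced:
  assumes "bounded_bilinear \<Psi>"
    and zero: "\<And>f g. continuous_on {0..1} f \<Longrightarrow> continuous_on {0..1} g \<Longrightarrow>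
      (\<And>t. t \<in> {0..1} \<Longrightarrow> f t * g t = 0) \<Longrightarrow> \<Psi> (fcalc f) (fcalc g) = 0"
  shows "\<Psi> r 1 = \<Psi> 1 r"
proof -
  interpret \<Psi>: bounded_bilinear \<Psi> by fact
  obtain K where K: "0 \<le> K" "\<And>b c. norm (\<Psi> b c) \<le> norm b * norm c * K"
    using \<Psi>.nonneg_bounded by blast
  have bound: "norm (\<Psi> r 1 - \<Psi> 1 r) * real n \<le> 81 * K" if n: "0 < n" for n :: nat
  proof -
    define hat where "hat j t = tent (real n * t - real j)" for j :: nat and t :: real
    define e where "e j = fcalc (hat j)" for j
    have cont: "continuous_on {0..1} (hat j)" for j
      unfolding hat_def tent_def by (intro continuous_intros)
    have range: "0 \<le> real n * t" "real n * t \<le> real n" if "t \<in> {0..1}" for t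
      using that mult_left_mono[of t 1 "real n"] by auto
    have hats: "(\<Sum>j\<le>n. hat j t) = 1" "(\<Sum>j\<le>n. real j * hat j t) = real n * t" if "t \<in> {0..1}" for t
      using range[OF that] by (simp_all add: hat_def sum_tent sum_index_tent)
    have comb: "(\<Sum>j\<le>n. c j *\<^sub>R e j) = fcalc (\<lambda>t. \<Sum>j\<le>n. c j * hat j t)" for c
      unfolding e_def by (simp add: fcalc_scaleR cont fcalc_sum continuous_on_mult_left)
    have eq: "fcalc f = b" if "polycalc r g b" "continuous_on {0..1} f" "\<And>t. t \<in> {0..1} \<Longrightarrow> f t = g t" for f g b
      by (rule fcalc_unique[where p = "\<lambda>_. g" and b = "\<lambda>_. b"]) (use that in auto)
    have one: "(\<Sum>j\<le>n. e j) = 1"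
    proof -
      have "fcalc (\<lambda>t. \<Sum>j\<le>n. 1 * hat j t) = 1"
        by (rule eq[OF polycalc_one])
           (auto intro!: continuous_intros cont simp: hats)
      then show ?thesis using comb[of "\<lambda>_. 1"] by simp
    qed
    have var: "(\<Sum>j\<le>n. real j *\<^sub>R e j) = real n *\<^sub>R r"
      unfolding comb
      by (rule eq[OF polycalc_scaleR[OF polycalc.var]])
         (auto intro!: continuous_intros cont simp: hats)
    have "norm (\<Psi> (\<Sum>j\<le>n. real j *\<^sub>R e j) (\<Sum>k\<le>n. e k) - \<Psi> (\<Sum>j\<le>n. e j) (\<Sum>k\<le>n. real k *\<^sub>R e k))
        \<le> 9 * (3 * 3 * K)"
    proof (rule tridiagonal_bound[OF assms(1)])
      show "\<Psi> (e j) (e k) = 0" if "j + 1 < k \<or> k + 1 < j" for j k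
        unfolding e_def
      proof (rule zero[OF cont cont])
        fix t :: real
        have "real j + 2 \<le> real k \<or> real k + 2 \<le> real j" using that by linarith
        then have "1 \<le> \<bar>real n * t - real j\<bar> \<or> 1 \<le> \<bar>real n * t - real k\<bar>" by linarith
        then have "tent (real n * t - real j) = 0 \<or> tent (real n * t - real k) = 0"
          by (auto simp: tent_def)
        then show "hat j t * hat k t = 0" by (auto simp: hat_def)
      qed
      show "norm (\<Sum>j\<le>n. of_bool (j mod 3 = i) *\<^sub>R e j) \<le> 3" for i
      proof -
        have "norm (fcalc (\<lambda>t. \<Sum>j\<le>n. of_bool (j mod 3 = i) * hat j t)) \<le> 3 * 1"
        proof (rule norm_fcalc)
          fix t :: real assume t: "t \<in> {0..1}"
          have "(\<Sum>j\<le>n. of_bool (j mod 3 = i) * hat j t) \<le> (\<Sum>j\<le>n. hat j t)"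
            by (intro sum_mono) (simp add: hat_def tent_nonneg)
          also have "\<dots> = 1" using hats(1)[OF t] .
          finally show "\<bar>\<Sum>j\<le>n. of_bool (j mod 3 = i) * hat j t\<bar> \<le> 1"
            by (simp add: sum_nonneg hat_def tent_nonneg)
        qed (intro continuous_intros cont)
        then show ?thesis by (simp add: comb)
      qed
    qed (use K in auto)
    then have "norm (real n *\<^sub>R (\<Psi> r 1 - \<Psi> 1 r)) \<le> 81 * K"
      by (simp add: one var \<Psi>.scaleR_left \<Psi>.scaleR_right scaleR_diff_right)
    then show ?thesis by (simp add: mult.commute)
  qed
  have "norm (\<Psi> r 1 - \<Psi> 1 r) \<le> 0"
  proof (rule ccontr)
    assume "\<not> ?thesis"
    then have "0 < norm (\<Psi> r 1 - \<Psi> 1 r)" by simp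
    then obtain n where "81 * K < real n * norm (\<Psi> r 1 - \<Psi> 1 r)"
      using reals_Archimedean3 by blast
    moreover have "0 < n"
      using calculation K(1) by (cases n) auto
    ultimately show False using bound[of n] by (simp add: mult.commute)
  qed
  then show ?thesis by simp
qed

end

section \<open>Balanced multipliers\<close>

lemma bounded_bilinear_compose_mult:
  assumes "bounded_bilinear \<phi>"
  shows "bounded_bilinear (\<lambda>b c. \<phi> (rmul x b) (lmul c y))"
  using bounded_bilinear.comp[OF assms rmul.bounded_linear_right lmul.bounded_linear_left] .

definition balanced :: "('a::complex_banach_algebra \<Rightarrow> 'a \<Rightarrow> 'b) \<Rightarrow> 'a unitization \<Rightarrow> bool"
  where "balanced \<phi> b \<longleftrightarrow> (\<forall>x y. \<phi> (rmul x b) y = \<phi> x (lmul b y))"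

text \<open>Inserts b c = 1 and moves b across. It leads from (1 + h h)^-1 to 1 + h h.\<close>

lemma balanced_inverse:
  assumes "balanced \<phi> b" "b * c = 1" "c * b = 1"
  shows "balanced \<phi> c"
  unfolding balanced_def
proof (intro allI)
  fix x y
  have "\<phi> (rmul x c) y = \<phi> (rmul x c) (lmul b (lmul c y))"
    by (simp add: assms flip: lmul_mult)
  also have "\<dots> = \<phi> (rmul (rmul x c) b) (lmul c y)"
    using assms(1) by (simp add: balanced_def)
  also have "\<dots> = \<phi> x (lmul c y)"
    by (simp add: assms flip: rmul_mult)
  finally show "\<phi> (rmul x c) y = \<phi> x (lmul c y)" .
qed

text \<open>For fixed x and y the map sending b, c to \<open>\<phi> (rmul x b) (lmul c y)\<close>
  inherits the vanishing on zero products, as (x b) (c y) = x (b c) y. The calculus then balances (1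
  + h h)^-1; inversion and additivity give h h.\<close>

lemma balanced_square:
  fixes \<phi> :: "'a::cstar_algebra \<Rightarrow> 'a \<Rightarrow> 'b::real_normed_vector"
  assumes "bounded_bilinear \<phi>" and zero: "\<And>x y. x * y = 0 \<Longrightarrow> \<phi> x y = 0"
    and h: "ustar h = h" "norm h < 1"
  shows "balanced \<phi> (h * h)"
proof -
  interpret \<phi>: bounded_bilinear \<phi> by fact
  obtain C r \<rho> where calc: "selfadjoint_calculus C r \<rho>" and inv: "r * (1 + h * h) = 1" "(1 + h * h) * r = 1"
    using cayley_calculus[OF h] .
  interpret selfadjoint_calculus C r \<rho> by fact
  have "\<phi> (rmul x r) (lmul 1 y) = \<phi> (rmul x 1) (lmul r y)" for x y
  proof (rule fcalc_zero_product_imp_balanced[OF bounded_bilinear_compose_mult[OF assms(1)]])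
    fix f g :: "real \<Rightarrow> real"
    assume "continuous_on {0..1} f" "continuous_on {0..1} g" "\<And>t. t \<in> {0..1} \<Longrightarrow> f t * g t = 0"
    then have "fcalc f * fcalc g = 0" by (rule fcalc_mult_eq_0)
    then show "\<phi> (rmul x (fcalc f)) (lmul (fcalc g) y) = 0"
      by (intro zero) (simp add: rmul_times_lmul lmul.zero_left flip: lmul_mult)
  qed
  then have "balanced \<phi> r" by (simp add: balanced_def)
  then have "balanced \<phi> (1 + h * h)" using inv by (rule balanced_inverse)
  then show ?thesis
    by (simp add: balanced_def rmul.add_right lmul.add_left \<phi>.add_left \<phi>.add_right)
qed

text \<open>Squares suffice by polarization with the unit: (1/4 + h)^2 - h^2 = 1/16 + h / 2, and
  real scalars are balanced by bilinearity.\<close>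

lemma balanced_selfadjoint:
  fixes \<phi> :: "'a::cstar_algebra \<Rightarrow> 'a \<Rightarrow> 'b::real_normed_vector"
  assumes "bounded_bilinear \<phi>" and zero: "\<And>x y. x * y = 0 \<Longrightarrow> \<phi> x y = 0"
    and p: "star p = p"
  shows "\<phi> (x * p) y = \<phi> x (p * y)"
proof -
  interpret \<phi>: bounded_bilinear \<phi> by fact
  \<comment> \<open>Makes the norm of c p less than 3/4, so that both c p and 1/4 + c p satisfy the
    norm bound of \<open>balanced_square\<close>.\<close>
  define c where "c = 1 / (2 * (1 + norm p))"
  have c: "0 < c" "norm (c *\<^sub>R p) < 3 / 4"
    by (auto simp: c_def add_pos_nonneg field_simps)
  define h where "h s = Unitize (complex_of_real s) (c *\<^sub>R p)" for s
  have h: "ustar (h s) = h s" for s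
    by (simp add: h_def ustar_def star_scaleR p)
  have b0: "balanced \<phi> (h 0 * h 0)"
    by (rule balanced_square[OF assms(1) zero h]) (use c in \<open>auto simp: h_def norm_unitization_def\<close>)
  have b1: "balanced \<phi> (h (1 / 4) * h (1 / 4))"
    by (rule balanced_square[OF assms(1) zero h]) (use c in \<open>auto simp: h_def norm_unitization_def norm_divide\<close>)
  have "h (1 / 4) = (1 / 4) *\<^sub>R 1 + h 0"
    by (simp add: h_def unitization_eq_iff)
  then have "h (1 / 4) * h (1 / 4) = (1 / 16) *\<^sub>R 1 + (1 / 2) *\<^sub>R h 0 + h 0 * h 0"
    by (simp add: algebra_simps flip: scaleR_add_left)
  then have "\<phi> (rmul x (h 0)) y = \<phi> x (lmul (h 0) y)"
    using b0 b1 by (simp add: balanced_def rmul.add_right lmul.add_left \<phi>.add_left \<phi>.add_right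
        rmul.scaleR_right lmul.scaleR_left \<phi>.scaleR_left \<phi>.scaleR_right)
  then show ?thesis
    using c(1) by (simp add: h_def \<phi>.scaleR_left \<phi>.scaleR_right)
qed

text \<open>\<open>bounded_bilinear\<close> is real bilinearity, so the decomposition a = p + i q
  into self-adjoint parts calls for balancedness of the scalar i as a separate hypothesis.\<close>

lemma zero_product_preserving_imp_balanced:
  fixes \<phi> :: "'a::cstar_algebra \<Rightarrow> 'a \<Rightarrow> 'b::real_normed_vector"
  assumes "bounded_bilinear \<phi>" and zero: "\<And>x y. x * y = 0 \<Longrightarrow> \<phi> x y = 0"
    and imag: "\<And>x y. \<phi> (\<i> *\<^sub>C x) y = \<phi> x (\<i> *\<^sub>C y)"
  shows "\<phi> (x * a) y = \<phi> x (a * y)"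
proof -
  interpret \<phi>: bounded_bilinear \<phi> by fact
  define p q where "p = (1 / 2) *\<^sub>R (a + star a)" and "q = (1 / 2) *\<^sub>R (- \<i> *\<^sub>C (a - star a))"
  have p: "star p = p" by (simp add: p_def star_scaleR star_add star_star add.commute)
  have q: "star q = q"
    by (simp add: q_def star_scaleR star_scaleC star_minus star_diff star_star scaleC_minus_left
        scaleC_diff_right scaleR_diff_right)
  have a: "a = p + \<i> *\<^sub>C q"
  proof -
    have "\<i> *\<^sub>C q = (1 / 2) *\<^sub>R (a - star a)"
      by (simp add: q_def scaleR_scaleC scaleC_scaleC del: scaleC_of_real)
    then show ?thesis
      by (simp add: p_def flip: scaleR_add_right)
  qed
  have "\<phi> (x * \<i> *\<^sub>C q) y = \<phi> (\<i> *\<^sub>C (x * q)) y" by (simp add: mult_scaleC_right)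
  also have "\<dots> = \<phi> x (q * \<i> *\<^sub>C y)"
    using imag balanced_selfadjoint[OF assms(1) zero q] by simp
  also have "\<dots> = \<phi> x ((\<i> *\<^sub>C q) * y)" by (simp add: mult_scaleC_left mult_scaleC_right)
  finally show ?thesis
    using balanced_selfadjoint[OF assms(1) zero p]
    by (simp add: a distrib_left distrib_right \<phi>.add_left \<phi>.add_right)
qed

subsection \<open>Bounded approximate identities\<close>

text \<open>t^n is the smallest of the n + 1 terms of the geometric sum ending in t^n, and (1 - t)
  times that sum is at most 1.\<close>

lemma power_times_one_minus_le:
  fixes t :: real
  assumes t: "t \<in> {0..1}"
  shows "t ^ n * (1 - t) \<le> 1 / (real n + 1)"
proof -
  have "(real n + 1) * t ^ n = (\<Sum>i\<le>n. t ^ n)" by simp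
  also have "\<dots> \<le> (\<Sum>i\<le>n. t ^ i)"
    using t by (intro sum_mono power_decreasing) auto
  finally have "(1 - t) * ((real n + 1) * t ^ n) \<le> (1 - t) * (\<Sum>i\<le>n. t ^ i)"
    using t by (intro mult_left_mono) auto
  also have "\<dots> = 1 - t ^ Suc n"
    by (simp only: sum_gp_basic)
  also have "\<dots> \<le> 1" using t by simp
  finally show ?thesis by (simp add: field_simps)
qed

lemma Unitize0_mult [simp]: "Unitize 0 a * Unitize 0 b = Unitize 0 (a * b)"
  by (simp add: unitization_eq_iff)

lemma norm_minus_mult_le:
  fixes x f :: "'a::real_normed_algebra"
  shows "norm (x - f * x) \<le> norm x + norm f * norm x"
    and "norm (x - x * f) \<le> norm x + norm x * norm f"
  using norm_triangle_ineq4[of x "f * x"] norm_mult_ineq[of f x]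
    norm_triangle_ineq4[of x "x * f"] norm_mult_ineq[of x f] by linarith+

text \<open>For h = c a (star a) and r = (1 + h h)^-1 the unit is e = 1 - r^n, with error r^n a. By
  the C*-identity the fourth power of the norm of this error, times c^2, is the norm of k k for k =
  r^n h r^n; and k k = h h r^(4n) = (1 - r) r^(4n-1) is small by the calculus.\<close>

lemma ex_left_unit:
  fixes a :: "'a::cstar_algebra"
  assumes \<epsilon>: "0 < \<epsilon>"
  shows "\<exists>e. norm e \<le> 2 \<and> norm (a - e * a) < \<epsilon>"
proof -
  define c where "c = 1 / (2 * (1 + (norm a)\<^sup>2))"
  have norm_aa: "norm (a * star a) = (norm a)\<^sup>2"
    using cstar_identity[of "star a"] by (simp add: star_star)
  have c: "0 < c" "c * norm (a * star a) < 1"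
    by (auto simp: c_def norm_aa add_pos_nonneg field_simps intro: add_pos_nonneg add_nonneg_pos)
  define h where "h = Unitize 0 (c *\<^sub>R (a * star a))"
  have h: "ustar h = h" "norm h < 1"
    using c by (simp_all add: h_def ustar_def star_scaleR star_mult star_star norm_unitization_def)
  obtain C r \<rho> where "selfadjoint_calculus C r \<rho>" and inv: "r * (1 + h * h) = 1" "(1 + h * h) * r = 1"
    using cayley_calculus[OF h] .
  then interpret selfadjoint_calculus C r \<rho> by blast
  have scal_r1: "scal r = 1"
    using arg_cong[OF inv(1), of scal] by (simp add: h_def)
  have rh: "r * h = h * r"
  proof -
    have "r * h = r * h * ((1 + h * h) * r)" by (simp add: inv)
    also have "\<dots> = (r * (1 + h * h)) * h * r" by (simp add: algebra_simps)
    finally show ?thesis by (simp add: inv)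
  qed
  have comm: "r ^ n * h = h * r ^ n" for n
    by (rule power_commuting_commutes) (rule rh)
  have hhr: "h * h * r = 1 - r"
    using inv(2) by (simp add: algebra_simps)
  have small: "c\<^sup>2 * norm (lmul (r ^ n) a) ^ 4 \<le> 3 / (4 * real n)" if n: "0 < n" for n
  proof -
    define g where "g = r ^ n"
    define k where "k = c *\<^sub>R (lmul g a * star (lmul g a))"
    have g: "ustar g = g" by (simp add: g_def ustar_power ustar_r)
    have gh: "g * h = h * g" by (simp add: g_def comm)
    have "Unitize 0 k = g * h * g"
      by (simp add: unitization_eq_iff k_def h_def star_lmul g)
         (simp add: lmul_def rmul_def scaleC_add_right scaleC_scaleC mult_scaleC_left
           mult_scaleC_right scaleR_scaleC algebra_simps)
    then have "Unitize 0 (k * k) = (g * h * g) * (g * h * g)"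
      by (simp flip: Unitize0_mult)
    also have "\<dots> = h * h * (g * g * (g * g))"
    proof -
      have "g * (h * z) = h * (g * z)" for z by (simp add: gh flip: mult.assoc)
      then show ?thesis by (simp add: mult.assoc gh)
    qed
    \<comment> \<open>One factor r is split off to turn h h r into 1 - r; the remaining exponent 4 n
      - 1 yields the bound 1 / (4 n).\<close>
    also have "\<dots> = h * h * r * r ^ (4 * n - 1)"
    proof -
      have "n + n + (n + n) = Suc (4 * n - 1)" using n by simp
      then have "g * g * (g * g) = r * r ^ (4 * n - 1)"
        unfolding g_def power_add[symmetric] by (simp only: power_Suc)
      then show ?thesis by (simp add: mult.assoc)
    qed
    finally have kk: "Unitize 0 (k * k) = (1 - r) * r ^ (4 * n - 1)" by (simp add: hhr)
    have "star k = k" by (simp add: k_def star_scaleR star_mult star_star)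
    then have "(norm k)\<^sup>2 = norm (k * k)" using cstar_identity[of k] by simp
    also have "\<dots> = norm (Unitize 0 (k * k))" by (simp add: norm_unitization_def)
    also have "\<dots> \<le> 3 * (1 / (real (4 * n - 1) + 1))"
      unfolding kk
    proof (rule norm_polycalc[OF polycalc.mult[OF polycalc_diff[OF polycalc_one polycalc.var] polycalc_power[OF polycalc.var]]])
      fix t :: real assume "t \<in> {0..1}"
      then show "\<bar>(1 - t) * t ^ (4 * n - 1)\<bar> \<le> 1 / (real (4 * n - 1) + 1)"
        using power_times_one_minus_le[of t "4 * n - 1"] by (simp add: abs_mult mult.commute)
    qed
    also have "\<dots> = 3 / (4 * real n)" using n by (simp add: of_nat_diff)
    finally have "(norm k)\<^sup>2 \<le> 3 / (4 * real n)" .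
    moreover have "norm k = c * (norm (lmul g a))\<^sup>2"
      using c(1) cstar_identity[of "star (lmul g a)"] by (simp add: k_def star_star)
    ultimately show ?thesis
      by (simp add: power_mult_distrib g_def flip: power_mult)
  qed
  obtain n where n: "0 < n" "3 / (4 * real n) < c\<^sup>2 * \<epsilon> ^ 4"
  proof -
    have pos: "0 < c\<^sup>2 * \<epsilon> ^ 4" using c(1) \<epsilon> by simp
    then obtain n where "3 / 4 < real n * (c\<^sup>2 * \<epsilon> ^ 4)"
      using reals_Archimedean3 by blast
    moreover have "0 < n" using calculation by (cases n) auto
    ultimately show thesis by (intro that[of n]) (simp_all add: field_simps)
  qed
  \<comment> \<open>Since \<open>scal r\<close> is 1, r^n equals 1 - e in the unitization. Of its
    norm, at most 3, the scalar part takes 1, which leaves 2 for e.\<close>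
  define e where "e = - elem (r ^ n)"
  have "c\<^sup>2 * norm (lmul (r ^ n) a) ^ 4 < c\<^sup>2 * \<epsilon> ^ 4"
    using small[OF n(1)] n(2) by linarith
  then have "norm (lmul (r ^ n) a) ^ 4 < \<epsilon> ^ 4" using c(1) by simp
  then have "norm (lmul (r ^ n) a) < \<epsilon>"
    by (rule power_less_imp_less_base) (use \<epsilon> in simp)
  moreover have "lmul (r ^ n) a = a - e * a"
    by (simp add: lmul_def e_def scal_r1)
  moreover have "norm (r ^ n) \<le> 3 * 1"
    by (rule norm_polycalc[OF polycalc_power[OF polycalc.var]])
       (auto simp: power_abs intro: power_le_one)
  then have "norm e \<le> 2" by (simp add: norm_unitization_def scal_r1 e_def)
  ultimately show ?thesis by auto
qed

(* The unit u = e + f - f e obtained for insert a S need not obey the bound 2, but a unit g for u does: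
   g b is close to g u b, hence to u b and to b. *)
lemma ex_left_unit_finite:
  fixes S :: "'a::cstar_algebra set"
  assumes "finite S" "0 < \<epsilon>"
  shows "\<exists>e. norm e \<le> 2 \<and> (\<forall>a\<in>S. norm (a - e * a) < \<epsilon>)"
  using assms
proof (induction S arbitrary: \<epsilon> rule: finite_induct)
  case empty
  then show ?case by (intro exI[of _ 0]) auto
next
  case (insert a S)
  \<comment> \<open>The final estimate is 6 \<delta> + 12 \<delta> + \<epsilon> / 4, which for this
    \<delta> is 26/32 of \<epsilon>.\<close>
  define \<delta> where "\<delta> = \<epsilon> / 32"
  have \<delta>: "0 < \<delta>" using insert.prems by (simp add: \<delta>_def)
  obtain e where e: "norm e \<le> 2" "\<And>b. b \<in> S \<Longrightarrow> norm (b - e * b) < \<delta>"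
    using insert.IH[OF \<delta>] by blast
  obtain f where f: "norm f \<le> 2" "norm ((a - e * a) - f * (a - e * a)) < \<delta>"
    using ex_left_unit[OF \<delta>] by blast
  define u where "u = e + f - f * e"
  have ub: "b - u * b = (b - e * b) - f * (b - e * b)" for b
    by (simp add: u_def algebra_simps)
  have u: "norm (b - u * b) < 6 * \<delta>" if "b \<in> insert a S" for b
  proof (cases "b = a")
    case True
    then show ?thesis using f(2) \<delta> by (simp add: ub)
  next
    case False
    then have b: "norm (b - e * b) < \<delta>" using that e(2) by simp
    have "norm (b - u * b) \<le> norm (b - e * b) + norm f * norm (b - e * b)"
      unfolding ub by (rule norm_minus_mult_le)
    also have "\<dots> \<le> \<delta> + 2 * \<delta>"
      using b f(1) \<delta> by (intro add_mono mult_mono) auto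
    finally show ?thesis using \<delta> by simp
  qed
  define R where "R = (\<Sum>b\<in>insert a S. norm b)"
  have R: "0 \<le> R" "\<And>b. b \<in> insert a S \<Longrightarrow> norm b \<le> R"
    unfolding R_def using insert.hyps(1) by (auto intro!: sum_nonneg member_le_sum simp del: sum.insert)
  obtain g where g: "norm g \<le> 2" "norm (u - g * u) < \<epsilon> / (4 * (R + 1))"
    using ex_left_unit[of "\<epsilon> / (4 * (R + 1))" u] insert.prems R(1) by auto
  have "norm (b - g * b) < \<epsilon>" if b: "b \<in> insert a S" for b
  proof -
    have "b - g * b = ((b - u * b) - g * (b - u * b)) + (u - g * u) * b"
      by (simp add: algebra_simps)
    then have "norm (b - g * b) \<le> norm ((b - u * b) - g * (b - u * b)) + norm ((u - g * u) * b)"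
      by (metis norm_triangle_ineq)
    also have "\<dots> \<le> norm (b - u * b) + norm g * norm (b - u * b) + norm (u - g * u) * norm b"
      by (intro add_mono norm_minus_mult_le norm_mult_ineq)
    also have "\<dots> \<le> 6 * \<delta> + 2 * (6 * \<delta>) + \<epsilon> / (4 * (R + 1)) * R"
      using u[OF b] g R b \<delta> insert.prems
      by (intro add_mono mult_mono) (auto intro: less_imp_le divide_nonneg_nonneg)
    also have "\<epsilon> / (4 * (R + 1)) * R \<le> \<epsilon> / 4"
    proof -
      have "\<epsilon> / (4 * (R + 1)) * R = \<epsilon> / 4 * (R / (R + 1))" by simp
      also have "\<dots> \<le> \<epsilon> / 4 * 1"
        using R(1) insert.prems by (intro mult_left_mono) (auto simp: divide_le_eq)
      finally show ?thesis by simp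
    qed
    finally show ?thesis using insert.prems by (simp add: \<delta>_def)
  qed
  then show ?case using g(1) by blast
qed

text \<open>With e a left and f a right unit, (1 - f) (1 - e) = 1 - w: acting on a from the left it
  starts with 1 - e, from the right with 1 - f, so both errors are small. The right unit is the
  adjoint of a left unit for the adjoints, and 8 = 2 + 2 + 2 * 2.\<close>

lemma ex_two_sided_unit_finite:
  fixes S :: "'a::cstar_algebra set"
  assumes S: "finite S" and \<epsilon>: "0 < \<epsilon>"
  shows "\<exists>e. norm e \<le> 8 \<and> (\<forall>a\<in>S. norm (a - e * a) < \<epsilon> \<and> norm (a - a * e) < \<epsilon>)"
proof -
  define \<delta> where "\<delta> = \<epsilon> / 4"
  have \<delta>: "0 < \<delta>" using \<epsilon> by (simp add: \<delta>_def)
  obtain e where e: "norm e \<le> 2" "\<And>a. a \<in> S \<Longrightarrow> norm (a - e * a) < \<delta>"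
    using ex_left_unit_finite[OF S \<delta>] by blast
  obtain f' where f': "norm f' \<le> 2" "\<And>a. a \<in> star ` S \<Longrightarrow> norm (a - f' * a) < \<delta>"
    using ex_left_unit_finite[OF finite_imageI[OF S] \<delta>] by blast
  define f where "f = star f'"
  have f: "norm f \<le> 2" "norm (a - a * f) < \<delta>" if "a \<in> S" for a
  proof -
    have "star (star a - f' * star a) = a - a * f"
      by (simp add: star_diff star_mult star_star f_def)
    then show "norm (a - a * f) < \<delta>"
      using f'(2)[of "star a"] that by (metis imageI norm_star)
  qed (use f' in \<open>simp add: f_def\<close>)
  have nf: "norm f \<le> 2" using f'(1) by (simp add: f_def)
  define w where "w = e + f - f * e"
  have "norm (f * e) \<le> 2 * 2"
    using e(1) nf by (intro order.trans[OF norm_mult_ineq] mult_mono) auto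
  then have "norm w \<le> 8"
    using norm_triangle_ineq4[of "e + f" "f * e"] norm_triangle_ineq[of e f] e(1) nf
    unfolding w_def by linarith
  moreover have "norm (a - w * a) < \<epsilon>" if a: "a \<in> S" for a
  proof -
    have eq: "a - w * a = (a - e * a) - f * (a - e * a)" by (simp add: w_def algebra_simps)
    have "norm (a - w * a) \<le> norm (a - e * a) + norm f * norm (a - e * a)"
      unfolding eq by (rule norm_minus_mult_le)
    also have "\<dots> \<le> \<delta> + 2 * \<delta>"
      using e(2)[OF a] nf \<delta> by (intro add_mono mult_mono) auto
    finally show ?thesis using \<epsilon> by (simp add: \<delta>_def)
  qed
  moreover have "norm (a - a * w) < \<epsilon>" if a: "a \<in> S" for a
  proof -
    have eq: "a - a * w = (a - a * f) - (a - a * f) * e" by (simp add: w_def algebra_simps)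
    have "norm (a - a * w) \<le> norm (a - a * f) + norm (a - a * f) * norm e"
      unfolding eq by (rule norm_minus_mult_le)
    also have "\<dots> \<le> \<delta> + \<delta> * 2"
      using f(2)[OF a] e(1) \<delta> by (intro add_mono mult_mono) auto
    finally show ?thesis using \<epsilon> by (simp add: \<delta>_def)
  qed
  ultimately show ?thesis by blast
qed

section \<open>Ultrafilters and limits along an approximate identity\<close>

definition ultrafilter :: "'a filter \<Rightarrow> bool"
  where "ultrafilter U \<longleftrightarrow> U \<noteq> bot \<and> (\<forall>G. G \<le> U \<longrightarrow> G \<noteq> bot \<longrightarrow> G = U)"

text \<open>Filters are ordered with the finer one below, so the usual maximality is minimality and
  Zorn's lemma is used upside down. The infimum of a nonempty chain stays proper because whatever
  holds eventually for it does so for some member.\<close>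

lemma ex_ultrafilter_le:
  assumes "F \<noteq> bot"
  shows "\<exists>U\<le>F. ultrafilter U"
proof -
  define A where "A = {G. G \<le> F \<and> G \<noteq> bot}"
  have "\<exists>m\<in>A. \<forall>a\<in>A. a \<le> m \<longrightarrow> a = m"
  proof (rule predicate_Zorn)
    show "partial_order_on A (relation_of (\<lambda>x y. y \<le> x) A)"
      by (rule partial_order_on_relation_ofI) auto
  next
    fix \<C> assume "\<C> \<in> Chains (relation_of (\<lambda>x y. y \<le> x) A)"
    then have sub: "\<C> \<subseteq> A" and chain: "\<And>G H. G \<in> \<C> \<Longrightarrow> H \<in> \<C> \<Longrightarrow> G \<le> H \<or> H \<le> G"
      by (auto simp: Chains_def relation_of_def)
    show "\<exists>u\<in>A. \<forall>a\<in>\<C>. u \<le> a"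
    proof (cases "\<C> = {}")
      case True
      then show ?thesis using assms by (auto simp: A_def)
    next
      case False
      have "eventually P (Inf \<C>) \<longleftrightarrow> (\<exists>G\<in>\<C>. eventually P G)" for P
        by (rule eventually_Inf_base[OF False]) (metis chain inf.absorb1 inf.absorb2 order_refl)
      then have "Inf \<C> \<noteq> bot"
        using sub by (auto simp: A_def trivial_limit_def)
      moreover have "Inf \<C> \<le> F"
        using False sub by (auto simp: A_def intro: Inf_lower2)
      ultimately show ?thesis by (auto simp: A_def intro: Inf_lower)
    qed
  qed
  then show ?thesis by (fastforce simp: A_def ultrafilter_def)
qed

text \<open>Plays the role of weak-star compactness: values in a closed disc have a cluster point,
  and an ultrafilter converges to its cluster points.\<close>

lemma ultrafilter_convergent:
  fixes f :: "'a \<Rightarrow> complex"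
  assumes U: "ultrafilter U" and f: "\<forall>\<^sub>F x in U. norm (f x) \<le> K"
  shows "\<exists>l. (f \<longlongrightarrow> l) U"
proof -
  have "compact (cball (0::complex) K)" by simp
  moreover have "filtermap f U \<noteq> bot" using U by (simp add: ultrafilter_def filtermap_bot_iff)
  moreover have "eventually (\<lambda>z. z \<in> cball 0 K) (filtermap f U)"
    using f by (simp add: eventually_filtermap)
  ultimately obtain l where l: "inf (nhds l) (filtermap f U) \<noteq> bot"
    by (auto simp: compact_filter)
  have "inf U (filtercomap f (nhds l)) \<noteq> bot"
  proof
    assume "inf U (filtercomap f (nhds l)) = bot"
    then have "eventually (\<lambda>_. False) (inf U (filtercomap f (nhds l)))" by simp
    then obtain P Q where P: "eventually P U" and Q: "eventually Q (filtercomap f (nhds l))"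
      and PQ: "\<And>x. P x \<Longrightarrow> Q x \<Longrightarrow> False"
      by (auto simp: eventually_inf)
    from Q obtain R where R: "eventually R (nhds l)" "\<And>x. R (f x) \<Longrightarrow> Q x"
      by (auto simp: eventually_filtercomap)
    have "eventually (\<lambda>z. \<not> R z) (filtermap f U)"
      unfolding eventually_filtermap using P by eventually_elim (use R(2) PQ in blast)
    with R(1) have "eventually (\<lambda>_. False) (inf (nhds l) (filtermap f U))"
      unfolding eventually_inf by blast
    then show False using l by (simp add: trivial_limit_def)
  qed
  then have "inf U (filtercomap f (nhds l)) = U"
    using U by (simp add: ultrafilter_def)
  then have "U \<le> filtercomap f (nhds l)" by (metis inf.cobounded2)
  then show ?thesis
    by (auto simp: filterlim_def filtermap_le_iff_le_filtercomap)
qed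

text \<open>A filter on the algebra itself serves as the net, with the elements as their own
  indices. The bound 8 is that of \<open>ex_two_sided_unit_finite\<close>.\<close>

locale approximate_identity =
  fixes U :: "'a::cstar_algebra filter"
  assumes ultra: "ultrafilter U"
    and norm_unit: "\<forall>\<^sub>F e in U. norm e \<le> 8"
    and left_unit: "((\<lambda>e. e * a) \<longlongrightarrow> a) U"
    and right_unit: "((\<lambda>e. a * e) \<longlongrightarrow> a) U"

text \<open>The sets of units for a finite set and a tolerance form a filter base, directed by
  unions and minima. An ultrafilter below it has the required limits because each singleton occurs
  as a finite set.\<close>

lemma ex_approximate_identity: "\<exists>U :: 'a::cstar_algebra filter. approximate_identity U"
proof -
  define F where "F = (\<lambda>(S, \<epsilon>). principal {e :: 'a. norm e \<le> 8 \<and> (\<forall>a\<in>S. norm (a - e * a) < \<epsilon> \<and> norm (a - a * e) < \<epsilon>)})"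
  define B where "B = {(S :: 'a set, \<epsilon> :: real). finite S \<and> 0 < \<epsilon>}"
  have "({}, 1) \<in> B" by (simp add: B_def)
  then have "B \<noteq> {}" by blast
  have base: "eventually P (INF p\<in>B. F p) \<longleftrightarrow> (\<exists>p\<in>B. eventually P (F p))" for P
  proof (rule eventually_INF_base[OF \<open>B \<noteq> {}\<close>])
    fix p q assume "p \<in> B" "q \<in> B"
    moreover obtain S \<epsilon> T \<delta> where "p = (S, \<epsilon>)" "q = (T, \<delta>)" by fastforce
    ultimately show "\<exists>x\<in>B. F x \<le> inf (F p) (F q)"
      by (intro bexI[of _ "(S \<union> T, min \<epsilon> \<delta>)"]) (auto simp: B_def F_def)
  qed
  have "(INF p\<in>B. F p) \<noteq> bot"
    unfolding trivial_limit_def base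
    using ex_two_sided_unit_finite by (force simp: B_def F_def eventually_principal)
  then obtain U where U: "U \<le> (INF p\<in>B. F p)" "ultrafilter U"
    using ex_ultrafilter_le by blast
  have ev: "eventually P U" if "p \<in> B" "eventually P (F p)" for p P
    using that base U(1) by (meson filter_leD)
  have "approximate_identity U"
  proof
    show "\<forall>\<^sub>F e in U. norm e \<le> 8"
      by (rule ev[of "({}, 1)"]) (auto simp: B_def F_def eventually_principal)
    show "((\<lambda>e. e * a) \<longlongrightarrow> a) U" for a
    proof (rule tendstoI)
      fix \<epsilon> :: real assume "0 < \<epsilon>"
      then show "\<forall>\<^sub>F e in U. dist (e * a) a < \<epsilon>"
        by (intro ev[of "({a}, \<epsilon>)"]) (auto simp: B_def F_def eventually_principal dist_norm norm_minus_commute)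
    qed
    show "((\<lambda>e. a * e) \<longlongrightarrow> a) U" for a
    proof (rule tendstoI)
      fix \<epsilon> :: real assume "0 < \<epsilon>"
      then show "\<forall>\<^sub>F e in U. dist (a * e) a < \<epsilon>"
        by (intro ev[of "({a}, \<epsilon>)"]) (auto simp: B_def F_def eventually_principal dist_norm norm_minus_commute)
    qed
  qed fact
  then show ?thesis ..
qed

subsection \<open>Banach bimodules and their duals\<close>

context complex_banach_space
begin

lemma diff_closed: "x \<in> carrier X \<Longrightarrow> y \<in> carrier X \<Longrightarrow> x \<ominus> y \<in> carrier X"
  by (simp add: vdiff_def add_closed smult_closed)

lemma smult_zero_left: "x \<in> carrier X \<Longrightarrow> 0 \<odot> x = \<zero>"
  using smult_add_left[of x 1 "- 1"] minus_self[of x] by (simp add: vdiff_def smult_one)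

lemma smult_zero_right: "z \<odot> \<zero> = \<zero>"
  using smult_smult[OF zero_closed, of z 0] by (simp add: smult_zero_left zero_closed)

lemma nrm_zero: "nrm X \<zero> = 0"
  by (simp add: nrm_eq_zero zero_closed)

lemma nrm_nonneg: "x \<in> carrier X \<Longrightarrow> 0 \<le> nrm X x"
  using nrm_triangle[of x "(- 1) \<odot> x"] minus_self[of x]
  by (simp add: vdiff_def smult_closed nrm_smult nrm_zero)

lemma add_left_commute:
  "x \<in> carrier X \<Longrightarrow> y \<in> carrier X \<Longrightarrow> w \<in> carrier X \<Longrightarrow> x \<oplus> (y \<oplus> w) = y \<oplus> (x \<oplus> w)"
  by (metis add_assoc add_commute)

lemma smult_diff:
  "x \<in> carrier X \<Longrightarrow> y \<in> carrier X \<Longrightarrow> z \<odot> (x \<ominus> y) = z \<odot> x \<ominus> z \<odot> y"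
  by (simp add: vdiff_def smult_add_right smult_closed smult_smult mult.commute)

lemma zero_add: "x \<in> carrier X \<Longrightarrow> \<zero> \<oplus> x = x"
  by (simp add: add_commute[of "\<zero>"] zero_closed add_zero)

lemma add_minus_cancel:
  assumes "y \<in> carrier X" "w \<in> carrier X"
  shows "y \<oplus> ((- 1) \<odot> y \<oplus> w) = w"
proof -
  have "y \<oplus> ((- 1) \<odot> y \<oplus> w) = (y \<oplus> (- 1) \<odot> y) \<oplus> w"
    using assms by (simp add: add_assoc smult_closed)
  also have "\<dots> = w"
    using assms minus_self[of y] by (simp add: vdiff_def zero_add)
  finally show ?thesis .
qed

lemma diff_add_diff:
  assumes "x \<in> carrier X" "y \<in> carrier X" "w \<in> carrier X"
  shows "(x \<ominus> y) \<oplus> (y \<ominus> w) = x \<ominus> w"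
proof -
  have "(x \<ominus> y) \<oplus> (y \<ominus> w) = x \<oplus> ((- 1) \<odot> y \<oplus> (y \<oplus> (- 1) \<odot> w))"
    using assms unfolding vdiff_def by (simp add: add_assoc add_closed smult_closed)
  also have "\<dots> = x \<oplus> (y \<oplus> ((- 1) \<odot> y \<oplus> (- 1) \<odot> w))"
    using assms add_left_commute[of "(- 1) \<odot> y" y "(- 1) \<odot> w"] by (simp add: smult_closed)
  also have "\<dots> = x \<ominus> w"
    using assms by (simp add: add_minus_cancel smult_closed vdiff_def)
  finally show ?thesis .
qed

lemma diff_zero: "x \<in> carrier X \<Longrightarrow> x \<ominus> \<zero> = x"
  by (simp add: vdiff_def smult_zero_right add_zero)

lemma add_diff_add:
  "p \<in> carrier X \<Longrightarrow> q \<in> carrier X \<Longrightarrow> x \<in> carrier X \<Longrightarrow> y \<in> carrier X \<Longrightarrow>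
    (p \<oplus> q) \<ominus> (x \<oplus> y) = (p \<ominus> x) \<oplus> (q \<ominus> y)"
  by (simp add: vdiff_def smult_add_right smult_closed add_assoc add_left_commute add_closed)

lemma diff_eq_zero:
  assumes "x \<in> carrier X" "y \<in> carrier X" "x \<ominus> y = \<zero>"
  shows "x = y"
proof -
  have "x = (x \<ominus> y) \<oplus> (y \<ominus> \<zero>)"
    using diff_add_diff[OF assms(1,2) zero_closed] assms(1) by (simp add: diff_zero)
  also have "\<dots> = y"
    using assms(2,3) by (simp add: diff_zero zero_add)
  finally show ?thesis .
qed

lemma diff_swap: "x \<in> carrier X \<Longrightarrow> y \<in> carrier X \<Longrightarrow> (- 1) \<odot> (x \<ominus> y) = y \<ominus> x"
  by (simp add: vdiff_def smult_add_right smult_closed smult_smult smult_one add_commute)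

lemma nrm_diff_commute: "x \<in> carrier X \<Longrightarrow> y \<in> carrier X \<Longrightarrow> nrm X (x \<ominus> y) = nrm X (y \<ominus> x)"
  using nrm_smult[OF diff_closed, of x y "- 1"] by (simp add: diff_swap)

lemma nrm_diff_triangle:
  "x \<in> carrier X \<Longrightarrow> y \<in> carrier X \<Longrightarrow> w \<in> carrier X \<Longrightarrow>
    nrm X (x \<ominus> w) \<le> nrm X (x \<ominus> y) + nrm X (y \<ominus> w)"
  using nrm_triangle[OF diff_closed diff_closed, of x y y w] by (simp add: diff_add_diff)

text \<open>Carrying a subset \<open>V\<close> along lets the same facts serve a bimodule and its
  essential part, which differs from it only in the carrier.\<close>

lemma Metric_space_subset:
  assumes V: "V \<subseteq> carrier X"
  shows "Metric_space V (vdist (X\<lparr>carrier := V\<rparr>))"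
proof
  fix x y w
  show "0 \<le> vdist (X\<lparr>carrier := V\<rparr>) x y"
    using V by (auto simp: vdist_def vdiff_def intro!: nrm_nonneg add_closed smult_closed)
  show "vdist (X\<lparr>carrier := V\<rparr>) x y = vdist (X\<lparr>carrier := V\<rparr>) y x"
    using V nrm_diff_commute[of x y] by (auto simp: vdist_def vdiff_def)
  show "vdist (X\<lparr>carrier := V\<rparr>) x y = 0 \<longleftrightarrow> x = y" if "x \<in> V" "y \<in> V"
    using that V nrm_eq_zero[OF diff_closed, of x y] diff_eq_zero[of x y] minus_self[of x]
    by (auto simp: vdist_def vdiff_def)
  show "vdist (X\<lparr>carrier := V\<rparr>) x w \<le> vdist (X\<lparr>carrier := V\<rparr>) x y + vdist (X\<lparr>carrier := V\<rparr>) y w"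
    if "x \<in> V" "y \<in> V" "w \<in> V"
    using that V nrm_diff_triangle[of x y w] by (auto simp: vdist_def vdiff_def)
qed

lemma mcomplete_subset_iff:
  assumes V: "V \<subseteq> carrier X"
  shows "Metric_space.mcomplete V (vdist (X\<lparr>carrier := V\<rparr>)) \<longleftrightarrow>
    (\<forall>\<sigma>. range \<sigma> \<subseteq> V \<longrightarrow> (\<forall>\<epsilon>>0. \<exists>N. \<forall>m\<ge>N. \<forall>n\<ge>N. nrm X (\<sigma> m \<ominus> \<sigma> n) < \<epsilon>) \<longrightarrow>
      (\<exists>x\<in>V. (\<lambda>n. nrm X (\<sigma> n \<ominus> x)) \<longlonglongrightarrow> 0))"
  (is "_ \<longleftrightarrow> (\<forall>\<sigma>. _ \<longrightarrow> ?C \<sigma> \<longrightarrow> _)")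
proof -
  interpret V: Metric_space V "vdist (X\<lparr>carrier := V\<rparr>)"
    by (rule Metric_space_subset[OF V])
  have d: "vdist (X\<lparr>carrier := V\<rparr>) x y = nrm X (x \<ominus> y)" if "x \<in> V" "y \<in> V" for x y
    using that by (simp add: vdist_def vdiff_def)
  have cauchy: "V.MCauchy \<sigma> \<longleftrightarrow> range \<sigma> \<subseteq> V \<and> (\<forall>\<epsilon>>0. \<exists>N. \<forall>m\<ge>N. \<forall>n\<ge>N. nrm X (\<sigma> m \<ominus> \<sigma> n) < \<epsilon>)" for \<sigma>
    by (cases "range \<sigma> \<subseteq> V") (simp_all add: V.MCauchy_def d range_subsetD)
  have lim: "limitin V.mtopology \<sigma> x sequentially \<longleftrightarrow> x \<in> V \<and> (\<lambda>n. nrm X (\<sigma> n \<ominus> x)) \<longlonglongrightarrow> 0"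
    if \<sigma>: "range \<sigma> \<subseteq> V" for \<sigma> x
  proof -
    have "((\<lambda>n. nrm X (\<sigma> n \<ominus> x)) \<longlonglongrightarrow> 0) \<longleftrightarrow> (\<forall>\<epsilon>>0. \<forall>\<^sub>F n in sequentially. vdist (X\<lparr>carrier := V\<rparr>) (\<sigma> n) x < \<epsilon>)"
      if x: "x \<in> V"
    proof -
      have "0 \<le> nrm X (\<sigma> n \<ominus> x)" for n
        using \<sigma> x V by (intro nrm_nonneg diff_closed) auto
      then show ?thesis
        unfolding tendsto_iff dist_real_def using \<sigma> x by (simp add: d range_subsetD)
    qed
    then show ?thesis
      using \<sigma> by (auto simp: V.limitin_metric range_subsetD)
  qed
  show ?thesis
    unfolding V.mcomplete_def cauchy
  proof (intro iff_allI)
    fix \<sigma>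
    show "(range \<sigma> \<subseteq> V \<and> ?C \<sigma> \<longrightarrow> (\<exists>x. limitin V.mtopology \<sigma> x sequentially)) \<longleftrightarrow>
        (range \<sigma> \<subseteq> V \<longrightarrow> ?C \<sigma> \<longrightarrow> (\<exists>x\<in>V. (\<lambda>n. nrm X (\<sigma> n \<ominus> x)) \<longlonglongrightarrow> 0))"
      by (cases "range \<sigma> \<subseteq> V") (simp_all add: lim Bex_def)
  qed
qed

text \<open>The intersection with the carrier matters when \<open>S\<close> leaves the carrier: then
  no subspace contains \<open>S\<close>, and \<open>linear_span X S\<close> is the whole
  type.\<close>

lemma closed_linear_span_eq_carrier_iff:
  "closed_linear_span X S = carrier X \<longleftrightarrow>
    (\<forall>x\<in>carrier X. \<forall>\<epsilon>>0. \<exists>y\<in>linear_span X S \<inter> carrier X. nrm X (x \<ominus> y) < \<epsilon>)"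
proof -
  interpret M: Metric_space "carrier X" "vdist X"
    using Metric_space_subset[of "carrier X"] by simp
  have "closed_linear_span X S = carrier X \<longleftrightarrow>
      (\<forall>x\<in>carrier X. \<forall>\<epsilon>>0. \<exists>y\<in>linear_span X S. y \<in> M.mball x \<epsilon>)"
    unfolding closed_linear_span_def M.metric_closure_of by blast
  also have "\<dots> \<longleftrightarrow> (\<forall>x\<in>carrier X. \<forall>\<epsilon>>0. \<exists>y\<in>linear_span X S \<inter> carrier X. nrm X (x \<ominus> y) < \<epsilon>)"
    by (intro ball_cong refl) (auto simp: M.in_mball vdist_def)
  finally show ?thesis .
qed

lemma linear_span_superset: "S \<subseteq> linear_span X S"
  by (auto simp: linear_span_def)

lemma linear_span_least: "linear_subspace X V \<Longrightarrow> S \<subseteq> V \<Longrightarrow> linear_span X S \<subseteq> V"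
  by (auto simp: linear_span_def)

lemma dual_carrierD:
  assumes "f \<in> dual_carrier X"
  shows "x \<in> carrier X \<Longrightarrow> y \<in> carrier X \<Longrightarrow> f (x \<oplus> y) = f x + f y"
    and "x \<in> carrier X \<Longrightarrow> f (z \<odot> x) = z * f x"
    and "f \<in> extensional (carrier X)"
  using assms by (auto simp: dual_carrier_def)

lemma dual_carrier_bound:
  assumes "f \<in> dual_carrier X"
  shows "\<exists>K\<ge>0. \<forall>x\<in>carrier X. cmod (f x) \<le> K * nrm X x"
proof -
  obtain K where K: "\<And>x. x \<in> carrier X \<Longrightarrow> cmod (f x) \<le> K * nrm X x"
    using assms unfolding dual_carrier_def by blast
  have "cmod (f x) \<le> \<bar>K\<bar> * nrm X x" if "x \<in> carrier X" for x
    using K[OF that] mult_right_mono[OF abs_ge_self nrm_nonneg[OF that], of K] by linarith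
  then show ?thesis by (intro exI[of _ "\<bar>K\<bar>"]) auto
qed

lemma dual_carrierI:
  assumes "\<And>x y. x \<in> carrier X \<Longrightarrow> y \<in> carrier X \<Longrightarrow> f (x \<oplus> y) = f x + f y"
    and "\<And>z x. x \<in> carrier X \<Longrightarrow> f (z \<odot> x) = z * f x"
    and "\<And>x. x \<in> carrier X \<Longrightarrow> cmod (f x) \<le> K * nrm X x"
  shows "restrict f (carrier X) \<in> dual_carrier X"
  unfolding dual_carrier_def using assms by (auto simp: add_closed smult_closed intro!: exI[of _ K])

lemma dual_carrier_diff: "f \<in> dual_carrier X \<Longrightarrow> x \<in> carrier X \<Longrightarrow> y \<in> carrier X \<Longrightarrow> f (x \<ominus> y) = f x - f y"
  by (simp add: vdiff_def dual_carrierD smult_closed)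

lemma dual_carrier_zero: "f \<in> dual_carrier X \<Longrightarrow> f \<zero> = 0"
  using dual_carrierD(2)[of f "\<zero>" 0] by (simp add: smult_zero_left zero_closed)

text \<open>One closure rule for sums and differences, with z = 1 and z = -1; hence the explicit
  factors 1 and -1 in the functionals built later.\<close>

lemma dual_carrier_lincomb:
  assumes f: "f \<in> dual_carrier X" and g: "g \<in> dual_carrier X"
  shows "(\<lambda>x\<in>carrier X. f x + z * g x) \<in> dual_carrier X"
proof -
  obtain K where K: "\<And>x. x \<in> carrier X \<Longrightarrow> cmod (f x) \<le> K * nrm X x"
    using dual_carrier_bound[OF f] by blast
  obtain L where L: "\<And>x. x \<in> carrier X \<Longrightarrow> cmod (g x) \<le> L * nrm X x"
    using dual_carrier_bound[OF g] by blast
  show ?thesis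
  proof (rule dual_carrierI)
    fix x assume x: "x \<in> carrier X"
    have "cmod (f x + z * g x) \<le> cmod (f x) + cmod z * cmod (g x)"
      by (metis norm_triangle_ineq norm_mult)
    also have "\<dots> \<le> K * nrm X x + cmod z * (L * nrm X x)"
      by (intro add_mono mult_left_mono K L x) simp
    finally show "cmod (f x + z * g x) \<le> (K + cmod z * L) * nrm X x"
      by (simp add: algebra_simps)
  qed (simp_all add: dual_carrierD[OF f] dual_carrierD[OF g] algebra_simps)
qed

lemma tendsto_functional:
  assumes f: "f \<in> dual_carrier X" and g: "\<And>i. g i \<in> carrier X" and x: "x \<in> carrier X"
    and lim: "((\<lambda>i. nrm X (g i \<ominus> x)) \<longlongrightarrow> 0) F"
  shows "((\<lambda>i. f (g i)) \<longlongrightarrow> f x) F"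
proof -
  obtain K where K: "\<And>x. x \<in> carrier X \<Longrightarrow> cmod (f x) \<le> K * nrm X x"
    using dual_carrier_bound[OF f] by blast
  have "((\<lambda>i. f (g i) - f x) \<longlongrightarrow> 0) F"
  proof (rule Lim_null_comparison)
    show "\<forall>\<^sub>F i in F. norm (f (g i) - f x) \<le> K * nrm X (g i \<ominus> x)"
      by (intro always_eventually allI) (metis K dual_carrier_diff diff_closed f g x)
    show "((\<lambda>i. K * nrm X (g i \<ominus> x)) \<longlongrightarrow> 0) F"
      using tendsto_mult_right_zero[OF lim] .
  qed
  then show ?thesis by (simp add: Lim_null[symmetric])
qed

lemma functional_eq_zero:
  assumes f: "f \<in> dual_carrier X" and S: "\<And>x. x \<in> S \<Longrightarrow> f x = 0" "S \<subseteq> carrier X"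
    and dense: "closed_linear_span X S = carrier X" and x: "x \<in> carrier X"
  shows "f x = 0"
proof (rule ccontr)
  assume "f x \<noteq> 0"
  obtain K where K: "0 \<le> K" "\<And>x. x \<in> carrier X \<Longrightarrow> cmod (f x) \<le> K * nrm X x"
    using dual_carrier_bound[OF f] by blast
  have "linear_subspace X {x \<in> carrier X. f x = 0}"
    by (auto simp: linear_subspace_def zero_closed add_closed smult_closed dual_carrierD[OF f]
        dual_carrier_zero[OF f])
  then have span: "linear_span X S \<subseteq> {x \<in> carrier X. f x = 0}"
    by (rule linear_span_least) (use S in auto)
  \<comment> \<open>K + 1 instead of K, as K may be 0.\<close>
  have "0 < cmod (f x) / (K + 1)" using \<open>f x \<noteq> 0\<close> K(1) by simp
  then obtain y where y: "y \<in> linear_span X S" "nrm X (x \<ominus> y) < cmod (f x) / (K + 1)"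
    using dense x unfolding closed_linear_span_eq_carrier_iff by blast
  have yc: "y \<in> carrier X" "f y = 0" using span y(1) by auto
  have "cmod (f x) \<le> K * nrm X (x \<ominus> y)"
    using K(2)[OF diff_closed[OF x yc(1)]] by (simp add: dual_carrier_diff f x yc)
  also have "\<dots> \<le> (K + 1) * nrm X (x \<ominus> y)"
    using nrm_nonneg[OF diff_closed[OF x yc(1)]] by (simp add: distrib_right)
  also have "\<dots> < cmod (f x)"
    using y(2) K(1) by (simp add: field_simps)
  finally show False by simp
qed

end

lemma dual_simps [simp]:
  "carrier (dual X) = dual_carrier X"
  "zero (dual X) = (\<lambda>x\<in>carrier X. 0)"
  "f \<oplus>\<^bsub>dual X\<^esub> g = (\<lambda>x\<in>carrier X. f x + g x)"
  "z \<odot>\<^bsub>dual X\<^esub> f = (\<lambda>x\<in>carrier X. z * f x)"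
  "a \<rhd>\<^bsub>dual X\<^esub> f = (\<lambda>x\<in>carrier X. f (x \<lhd>\<^bsub>X\<^esub> a))"
  "f \<lhd>\<^bsub>dual X\<^esub> a = (\<lambda>x\<in>carrier X. f (a \<rhd>\<^bsub>X\<^esub> x))"
  "f \<ominus>\<^bsub>dual X\<^esub> g = (\<lambda>x\<in>carrier X. f x - g x)"
  by (auto simp: dual_def vdiff_def)

lemma nrm_dual: "nrm (dual X) f = (SUP x\<in>{x \<in> carrier X. nrm X x \<le> 1}. cmod (f x))"
  by (simp add: dual_def)

context banach_bimodule
begin

lemma lact_bound: "\<exists>K\<ge>0. \<forall>a. \<forall>x\<in>carrier X. nrm X (a \<rhd> x) \<le> K * norm a * nrm X x"
proof -
  obtain K where K: "\<And>a x. x \<in> carrier X \<Longrightarrow> nrm X (a \<rhd> x) \<le> K * norm a * nrm X x"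
    using lact_bounded by blast
  have "nrm X (a \<rhd> x) \<le> \<bar>K\<bar> * norm a * nrm X x" if "x \<in> carrier X" for a x
    using K[OF that, of a] nrm_nonneg[OF that]
    by (meson abs_ge_self mult_right_mono norm_ge_zero order.trans)
  then show ?thesis by (intro exI[of _ "\<bar>K\<bar>"]) auto
qed

lemma ract_bound: "\<exists>K\<ge>0. \<forall>a. \<forall>x\<in>carrier X. nrm X (x \<lhd> a) \<le> K * norm a * nrm X x"
proof -
  obtain K where K: "\<And>a x. x \<in> carrier X \<Longrightarrow> nrm X (x \<lhd> a) \<le> K * norm a * nrm X x"
    using ract_bounded by blast
  have "nrm X (x \<lhd> a) \<le> \<bar>K\<bar> * norm a * nrm X x" if "x \<in> carrier X" for a x
    using K[OF that, of a] nrm_nonneg[OF that]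
    by (meson abs_ge_self mult_right_mono norm_ge_zero order.trans)
  then show ?thesis by (intro exI[of _ "\<bar>K\<bar>"]) auto
qed

lemma lact_diff_left: "x \<in> carrier X \<Longrightarrow> (a - b) \<rhd> x = (a \<rhd> x) \<ominus> (b \<rhd> x)"
  using lact_add_left[of x a "- b"] lact_scaleC[of x "- 1" b] by (simp add: vdiff_def scaleC_minus_left)

lemma ract_diff_right: "x \<in> carrier X \<Longrightarrow> x \<lhd> (a - b) = (x \<lhd> a) \<ominus> (x \<lhd> b)"
  using ract_add_right[of x a "- b"] ract_scaleC[of x "- 1" b] by (simp add: vdiff_def scaleC_minus_left)

lemma lact_diff_right:
  "x \<in> carrier X \<Longrightarrow> y \<in> carrier X \<Longrightarrow> a \<rhd> (x \<ominus> y) = (a \<rhd> x) \<ominus> (a \<rhd> y)"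
  by (simp add: vdiff_def lact_add_right lact_smult smult_closed)

lemma ract_diff_left:
  "x \<in> carrier X \<Longrightarrow> y \<in> carrier X \<Longrightarrow> (x \<ominus> y) \<lhd> a = (x \<lhd> a) \<ominus> (y \<lhd> a)"
  by (simp add: vdiff_def ract_add_left ract_smult smult_closed)

lemma lact_zero: "x \<in> carrier X \<Longrightarrow> 0 \<rhd> x = \<zero>"
  using lact_scaleC[of x 0 0] by (simp add: smult_zero_left lact_closed)

lemma dual_lact_closed:
  assumes f: "f \<in> dual_carrier X"
  shows "(\<lambda>x\<in>carrier X. f (x \<lhd> a)) \<in> dual_carrier X"
proof -
  obtain K where K: "0 \<le> K" "\<And>x. x \<in> carrier X \<Longrightarrow> cmod (f x) \<le> K * nrm X x"
    using dual_carrier_bound[OF f] by blast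
  obtain L where L: "0 \<le> L" "\<And>a x. x \<in> carrier X \<Longrightarrow> nrm X (x \<lhd> a) \<le> L * norm a * nrm X x"
    using ract_bound by blast
  show ?thesis
  proof (rule dual_carrierI)
    fix x assume x: "x \<in> carrier X"
    show "cmod (f (x \<lhd> a)) \<le> (K * (L * norm a)) * nrm X x"
      using order.trans[OF K(2)[OF ract_closed[OF x], of a] mult_left_mono[OF L(2)[OF x, of a] K(1)]]
      by (simp add: mult.assoc)
  qed (simp_all add: ract_closed ract_add_left ract_smult dual_carrierD[OF f])
qed

lemma dual_ract_closed:
  assumes f: "f \<in> dual_carrier X"
  shows "(\<lambda>x\<in>carrier X. f (a \<rhd> x)) \<in> dual_carrier X"
proof -
  obtain K where K: "0 \<le> K" "\<And>x. x \<in> carrier X \<Longrightarrow> cmod (f x) \<le> K * nrm X x"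
    using dual_carrier_bound[OF f] by blast
  obtain L where L: "0 \<le> L" "\<And>a x. x \<in> carrier X \<Longrightarrow> nrm X (a \<rhd> x) \<le> L * norm a * nrm X x"
    using lact_bound by blast
  show ?thesis
  proof (rule dual_carrierI)
    fix x assume x: "x \<in> carrier X"
    show "cmod (f (a \<rhd> x)) \<le> (K * (L * norm a)) * nrm X x"
      using order.trans[OF K(2)[OF lact_closed[OF x], of a] mult_left_mono[OF L(2)[OF x, of a] K(1)]]
      by (simp add: mult.assoc)
  qed (simp_all add: lact_closed lact_add_right lact_smult dual_carrierD[OF f])
qed

lemma nrm_dual_bound:
  assumes f: "f \<in> dual_carrier X" and x: "x \<in> carrier X"
  shows "cmod (f x) \<le> nrm (dual X) f * nrm X x"
proof (cases "x = \<zero>")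
  case True
  then show ?thesis by (simp add: dual_carrier_zero[OF f] nrm_zero)
next
  case False
  then have pos: "0 < nrm X x" using nrm_eq_zero[OF x] nrm_nonneg[OF x] by simp
  obtain K where K: "0 \<le> K" "\<And>x. x \<in> carrier X \<Longrightarrow> cmod (f x) \<le> K * nrm X x"
    using dual_carrier_bound[OF f] by blast
  let ?y = "complex_of_real (1 / nrm X x) \<odot> x"
  have y: "?y \<in> carrier X" "nrm X ?y \<le> 1"
    using pos by (simp_all add: x smult_closed nrm_smult norm_divide)
  have "bdd_above ((\<lambda>x. cmod (f x)) ` {x \<in> carrier X. nrm X x \<le> 1})"
  proof (rule bdd_aboveI2)
    fix w assume "w \<in> {x \<in> carrier X. nrm X x \<le> 1}"
    then show "cmod (f w) \<le> K"
      using K(2)[of w] mult_left_mono[of "nrm X w" 1 K] K(1) by simp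
  qed
  then have "cmod (f ?y) \<le> nrm (dual X) f"
    unfolding nrm_dual by (intro cSUP_upper) (use y in auto)
  then show ?thesis
    using pos by (simp add: dual_carrierD(2)[OF f x] norm_mult norm_divide divide_le_eq)
qed

lemma nrm_dual_le:
  assumes "\<And>x. x \<in> carrier X \<Longrightarrow> cmod (f x) \<le> c * nrm X x" "0 \<le> c"
  shows "nrm (dual X) f \<le> c"
  unfolding nrm_dual
proof (rule cSUP_least)
  show "{x \<in> carrier X. nrm X x \<le> 1} \<noteq> {}"
    using zero_closed nrm_zero by force
  fix x assume "x \<in> {x \<in> carrier X. nrm X x \<le> 1}"
  then show "cmod (f x) \<le> c"
    using assms(1)[of x] mult_left_mono[of "nrm X x" 1 c] assms(2) by simp
qed

lemma dual_eq_iff: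
  assumes "f \<in> dual_carrier X"
  shows "f = restrict g (carrier X) \<longleftrightarrow> (\<forall>x\<in>carrier X. f x = g x)"
proof
  assume "\<forall>x\<in>carrier X. f x = g x"
  then show "f = restrict g (carrier X)"
    by (intro extensionalityI[OF dual_carrierD(3)[OF assms]]) auto
qed simp

lemma bounded_operator_dual_iff:
  "bounded_operator (dual X) D \<longleftrightarrow>
    (\<forall>a. D a \<in> dual_carrier X) \<and>
    (\<forall>a b. \<forall>x\<in>carrier X. D (a + b) x = D a x + D b x) \<and>
    (\<forall>z a. \<forall>x\<in>carrier X. D (z *\<^sub>C a) x = z * D a x) \<and>
    (\<exists>K\<ge>0. \<forall>a. \<forall>x\<in>carrier X. cmod (D a x) \<le> K * norm a * nrm X x)"
  (is "_ \<longleftrightarrow> ?dual \<and> ?add \<and> ?scale \<and> ?bound")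
proof -
  have bound: "(\<exists>K. \<forall>a. nrm (dual X) (D a) \<le> K * norm a) \<longleftrightarrow> ?bound" if D: ?dual
  proof
    assume "\<exists>K. \<forall>a. nrm (dual X) (D a) \<le> K * norm a"
    then obtain K where K: "\<And>a. nrm (dual X) (D a) \<le> K * norm a" by blast
    have "cmod (D a x) \<le> \<bar>K\<bar> * norm a * nrm X x" if x: "x \<in> carrier X" for a x
    proof -
      have "cmod (D a x) \<le> nrm (dual X) (D a) * nrm X x"
        using D x by (intro nrm_dual_bound) auto
      also have "nrm (dual X) (D a) \<le> \<bar>K\<bar> * norm a"
        using K[of a] mult_right_mono[OF abs_ge_self norm_ge_zero, of K a] by linarith
      finally show ?thesis using nrm_nonneg[OF x] by (simp add: mult_right_mono)
    qed
    then show ?bound by (intro exI[of _ "\<bar>K\<bar>"]) auto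
  next
    assume ?bound
    then show "\<exists>K. \<forall>a. nrm (dual X) (D a) \<le> K * norm a"
      by (meson nrm_dual_le mult_nonneg_nonneg norm_ge_zero)
  qed
  have add: "(\<forall>a b. D (a + b) = D a \<oplus>\<^bsub>dual X\<^esub> D b) \<longleftrightarrow> ?add" if ?dual
    using that by (simp add: dual_eq_iff)
  have scale: "(\<forall>z a. D (z *\<^sub>C a) = z \<odot>\<^bsub>dual X\<^esub> D a) \<longleftrightarrow> ?scale" if ?dual
    using that by (simp add: dual_eq_iff)
  show ?thesis
    unfolding bounded_operator_def dual_simps(1) using bound add scale by (meson conj_cong)
qed

lemma bounded_derivation_dual_iff:
  "bounded_derivation (dual X) D \<longleftrightarrow> bounded_operator (dual X) D \<and>
    (\<forall>a b. \<forall>x\<in>carrier X. D (a * b) x = D b (x \<lhd> a) + D a (b \<rhd> x))"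
proof -
  have "(D (a * b) = (a \<rhd>\<^bsub>dual X\<^esub> D b) \<oplus>\<^bsub>dual X\<^esub> (D a \<lhd>\<^bsub>dual X\<^esub> b)) \<longleftrightarrow>
      (\<forall>x\<in>carrier X. D (a * b) x = D b (x \<lhd> a) + D a (b \<rhd> x))"
    if "bounded_operator (dual X) D" for a b
    using that unfolding bounded_operator_dual_iff by (simp add: dual_eq_iff)
  then show ?thesis unfolding bounded_derivation_def by auto
qed

lemma dual_bimodule_difference_iff:
  assumes "\<forall>a. D a \<in> dual_carrier X"
  shows "(\<forall>a. D a = (a \<rhd>\<^bsub>dual X\<^esub> f) \<ominus>\<^bsub>dual X\<^esub> (g \<lhd>\<^bsub>dual X\<^esub> a)) \<longleftrightarrow>
    (\<forall>a. \<forall>x\<in>carrier X. D a x = f (x \<lhd> a) - g (a \<rhd> x))"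
  using assms by (simp add: dual_eq_iff)

lemma bounded_bilinear_functional:
  fixes \<phi> :: "'a \<Rightarrow> 'a \<Rightarrow> complex"
  assumes "\<And>a b c. \<phi> (a + b) c = \<phi> a c + \<phi> b c" "\<And>a b c. \<phi> a (b + c) = \<phi> a b + \<phi> a c"
    and "\<And>z a b. \<phi> (z *\<^sub>C a) b = z * \<phi> a b" "\<And>z a b. \<phi> a (z *\<^sub>C b) = z * \<phi> a b"
    and "\<And>a b. cmod (\<phi> a b) \<le> K * norm a * norm b"
  shows "bounded_bilinear \<phi>"
proof
  show "\<exists>K. \<forall>a b. norm (\<phi> a b) \<le> norm a * norm b * K"
    using assms(5) by (intro exI[of _ K]) (simp add: mult_ac)
qed (simp_all add: assms scaleR_scaleC scaleR_conv_of_real)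

end

subsection \<open>Hyperlocal operators\<close>

lemma bounded_bilinear_diff:
  assumes "bounded_bilinear f" "bounded_bilinear g"
  shows "bounded_bilinear (\<lambda>x y. f x y - g x y)"
proof -
  interpret f: bounded_bilinear f by fact
  interpret g: bounded_bilinear g by fact
  obtain K L where K: "\<And>x y. norm (f x y) \<le> norm x * norm y * K" and L: "\<And>x y. norm (g x y) \<le> norm x * norm y * L"
    using f.bounded g.bounded by blast
  show ?thesis
  proof
    have "norm (f x y - g x y) \<le> norm x * norm y * (K + L)" for x y
      using norm_triangle_ineq4[of "f x y" "g x y"] K[of x y] L[of x y]
      by (simp add: distrib_left)
    then show "\<exists>K. \<forall>x y. norm (f x y - g x y) \<le> norm x * norm y * K" by blast
  qed (simp_all add: f.add_left f.add_right g.add_left g.add_right f.scaleR_left f.scaleR_right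
      g.scaleR_left g.scaleR_right scaleR_diff_right)
qed

context banach_bimodule
begin

text \<open>Each half of essentiality is used once. For fixed a the functional sending v to f (v a)
  vanishes on all b x, hence everywhere; then f vanishes on all v a, hence everywhere.\<close>

lemma essential_separates:
  assumes "essential X" and f: "f \<in> dual_carrier X"
    and zero: "\<And>a b x. x \<in> carrier X \<Longrightarrow> f (b \<rhd> (x \<lhd> a)) = 0" and x: "x \<in> carrier X"
  shows "f x = 0"
proof (rule functional_eq_zero[OF f])
  show "closed_linear_span X {x \<lhd> a | a x. x \<in> carrier X} = carrier X"
    using assms(1) by (simp add: essential_def)
  show "{x \<lhd> a | a x. x \<in> carrier X} \<subseteq> carrier X"
    by (auto simp: ract_closed)
  fix w assume "w \<in> {x \<lhd> a | a x. x \<in> carrier X}"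
  then obtain a v where w: "w = v \<lhd> a" and v: "v \<in> carrier X" by blast
  have "(\<lambda>v\<in>carrier X. f (v \<lhd> a)) v = 0"
  proof (rule functional_eq_zero[OF dual_lact_closed[OF f]])
    show "closed_linear_span X {b \<rhd> x | b x. x \<in> carrier X} = carrier X"
      using assms(1) by (simp add: essential_def)
  qed (auto simp: lact_closed lact_ract zero v)
  then show "f w = 0" using v by (simp add: w)
qed fact

end

locale dual_operator = banach_bimodule X
  for X :: "('a::cstar_algebra, 'x) bimodule" (structure) and D :: "'a \<Rightarrow> 'x \<Rightarrow> complex" +
  assumes operator: "bounded_operator (dual X) D"
begin

lemma dual_closed: "D a \<in> dual_carrier X"
  and add: "x \<in> carrier X \<Longrightarrow> D (a + b) x = D a x + D b x"
  and scale: "x \<in> carrier X \<Longrightarrow> D (z *\<^sub>C a) x = z * D a x"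
  and bound: "\<exists>K\<ge>0. \<forall>a. \<forall>x\<in>carrier X. cmod (D a x) \<le> K * norm a * nrm X x"
  using operator by (auto simp: bounded_operator_dual_iff)

lemma linear_arg:
  assumes x: "x \<in> carrier X"
  shows "bounded_linear (\<lambda>a. D a x)"
proof -
  obtain K where "\<And>a. cmod (D a x) \<le> K * norm a * nrm X x" using bound x by blast
  then show ?thesis
    by (intro bounded_linear_intro[of _ "K * nrm X x"])
       (simp_all add: add scale x scaleR_scaleC scaleR_conv_of_real mult_ac)
qed

lemma zero: "x \<in> carrier X \<Longrightarrow> D 0 x = 0"
  using scale[of x 0 0] by simp

lemma bilinear_lact:
  assumes w: "w \<in> carrier X"
  shows "bounded_bilinear (\<lambda>c b. D c (b \<rhd> w))"
proof -
  obtain K where K: "0 \<le> K" "\<And>a x. x \<in> carrier X \<Longrightarrow> cmod (D a x) \<le> K * norm a * nrm X x"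
    using bound by blast
  obtain L where L: "0 \<le> L" "\<And>a x. x \<in> carrier X \<Longrightarrow> nrm X (a \<rhd> x) \<le> L * norm a * nrm X x"
    using lact_bound by blast
  show ?thesis
  proof (rule bounded_bilinear_functional)
    fix a b
    have "cmod (D a (b \<rhd> w)) \<le> K * norm a * nrm X (b \<rhd> w)"
      by (rule K(2)[OF lact_closed[OF w]])
    also have "\<dots> \<le> K * norm a * (L * norm b * nrm X w)"
      using K(1) L w by (intro mult_mono L(2)) (auto intro: nrm_nonneg lact_closed)
    finally show "cmod (D a (b \<rhd> w)) \<le> (K * L * nrm X w) * norm a * norm b"
      by (simp add: mult_ac)
  qed (simp_all add: w add scale lact_closed lact_add_left lact_scaleC
      dual_carrierD[OF dual_closed])
qed

lemma bilinear_ract: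
  assumes w: "w \<in> carrier X"
  shows "bounded_bilinear (\<lambda>a g. D (g * c) (b \<rhd> (w \<lhd> a)))"
proof -
  obtain K where K: "0 \<le> K" "\<And>a x. x \<in> carrier X \<Longrightarrow> cmod (D a x) \<le> K * norm a * nrm X x"
    using bound by blast
  obtain L where L: "0 \<le> L" "\<And>a x. x \<in> carrier X \<Longrightarrow> nrm X (a \<rhd> x) \<le> L * norm a * nrm X x"
    using lact_bound by blast
  obtain R where R: "0 \<le> R" "\<And>a x. x \<in> carrier X \<Longrightarrow> nrm X (x \<lhd> a) \<le> R * norm a * nrm X x"
    using ract_bound by blast
  show ?thesis
  proof (rule bounded_bilinear_functional)
    fix a g
    have "cmod (D (g * c) (b \<rhd> (w \<lhd> a))) \<le> K * norm (g * c) * nrm X (b \<rhd> (w \<lhd> a))"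
      by (intro K(2) lact_closed ract_closed w)
    also have "\<dots> \<le> K * (norm g * norm c) * (L * norm b * (R * norm a * nrm X w))"
    proof (intro mult_mono norm_mult_ineq)
      have "nrm X (b \<rhd> (w \<lhd> a)) \<le> L * norm b * nrm X (w \<lhd> a)"
        by (intro L(2) ract_closed w)
      also have "\<dots> \<le> L * norm b * (R * norm a * nrm X w)"
        using L(1) by (intro mult_left_mono R(2) w) auto
      finally show "nrm X (b \<rhd> (w \<lhd> a)) \<le> L * norm b * (R * norm a * nrm X w)" .
    qed (use K(1) w in \<open>auto intro: nrm_nonneg lact_closed ract_closed\<close>)
    finally show "cmod (D (g * c) (b \<rhd> (w \<lhd> a))) \<le> (K * norm c * L * norm b * R * nrm X w) * norm a * norm g"
      by (simp add: mult_ac)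
  qed (simp_all add: w distrib_right mult_scaleC_left add scale lact_closed ract_closed lact_add_right
      lact_smult ract_add_right ract_scaleC dual_carrierD[OF dual_closed])
qed

lemma tendsto_arg:
  assumes "x \<in> carrier X" "(g \<longlongrightarrow> l) F"
  shows "((\<lambda>i. D (g i) x) \<longlongrightarrow> D l x) F"
  using bounded_linear.tendsto[OF linear_arg[OF assms(1)] assms(2)] .

end

locale essential_hyperlocal = dual_operator X D
  for X :: "('a::cstar_algebra, 'x) bimodule" (structure) and D :: "'a \<Rightarrow> 'x \<Rightarrow> complex" +
  assumes essential: "essential X" and hyperlocal: "hyperlocal (dual X) D"
begin

text \<open>The pairing exchanges the sides: a D(c) b evaluated at x is D(c) evaluated at b x
  a.\<close>

lemma hyperlocal_pointwise:
  assumes "a * c = 0" "c * b = 0" and x: "x \<in> carrier X"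
  shows "D c (b \<rhd> (x \<lhd> a)) = 0"
proof -
  have "((a \<rhd>\<^bsub>dual X\<^esub> D c) \<lhd>\<^bsub>dual X\<^esub> b) x = \<zero>\<^bsub>dual X\<^esub> x"
    using hyperlocal assms(1,2) unfolding hyperlocal_def by metis
  then show ?thesis using x by (simp add: lact_closed lact_ract)
qed

lemma imag_balanced:
  "x \<in> carrier X \<Longrightarrow> D ((\<i> *\<^sub>C g) * c) (b \<rhd> (x \<lhd> a)) = D (g * c) (b \<rhd> (x \<lhd> (\<i> *\<^sub>C a)))"
  by (simp add: mult_scaleC_left scale lact_closed ract_closed lact_smult ract_scaleC
      dual_carrierD[OF dual_closed])

text \<open>Replacing c by g c preserves c b = 0, so the map sending u, g to D(g c) at b x u
  vanishes whenever u g = 0 and is therefore balanced. Letting g run through an approximate identity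
  removes it again.\<close>

lemma left_balanced:
  assumes cb: "c * b = 0" and x: "x \<in> carrier X"
  shows "D c (b \<rhd> (x \<lhd> (a * m))) = D (m * c) (b \<rhd> (x \<lhd> a))"
proof -
  obtain U :: "'a filter" where "approximate_identity U" using ex_approximate_identity by blast
  then interpret approximate_identity U .
  have *: "D (g * c) (b \<rhd> (x \<lhd> (a * m))) = D ((m * g) * c) (b \<rhd> (x \<lhd> a))" for g
  proof (rule zero_product_preserving_imp_balanced[OF bilinear_ract[OF x]])
    fix u v :: 'a assume "u * v = 0"
    then show "D (v * c) (b \<rhd> (x \<lhd> u)) = 0"
      using cb by (intro hyperlocal_pointwise x) (simp_all add: mult.assoc, simp flip: mult.assoc)
  qed (rule imag_balanced[OF x, symmetric])
  have "((\<lambda>e. D (e * c) (b \<rhd> (x \<lhd> (a * m)))) \<longlongrightarrow> D c (b \<rhd> (x \<lhd> (a * m)))) U"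
    by (intro tendsto_arg lact_closed ract_closed x left_unit)
  moreover have "((\<lambda>e. D ((m * e) * c) (b \<rhd> (x \<lhd> a))) \<longlongrightarrow> D (m * c) (b \<rhd> (x \<lhd> a))) U"
    by (intro tendsto_arg lact_closed ract_closed x tendsto_mult right_unit tendsto_const)
  ultimately show ?thesis
    unfolding * using ultra tendsto_unique by (auto simp: ultrafilter_def)
qed

text \<open>By \<open>left_balanced\<close> the difference of its two sides, as a bilinear map of c
  and b, vanishes whenever c b = 0, so n can be moved across. This is the identity at the points b w
  a, and these determine a functional on an essential bimodule.\<close>

lemma hyperlocal_identity:
  assumes x: "x \<in> carrier X"
  shows "D (m * c * n) x = D (c * n) (x \<lhd> m) + D (m * c) (n \<rhd> x) - D c (n \<rhd> (x \<lhd> m))"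
proof -
  \<comment> \<open>The defect of the identity as a functional; the nested restrictions have the
    shape to which \<open>dual_carrier_lincomb\<close>, \<open>dual_lact_closed\<close> and
    \<open>dual_ract_closed\<close> apply.\<close>
  define G where "G = (\<lambda>x\<in>carrier X. (\<lambda>x\<in>carrier X. D (m * c * n) x + (- 1) * (\<lambda>x\<in>carrier X. D (c * n) (x \<lhd> m)) x) x
    + (- 1) * (\<lambda>x\<in>carrier X. (\<lambda>x\<in>carrier X. D (m * c) (n \<rhd> x)) x + (- 1) * (\<lambda>x\<in>carrier X. (\<lambda>x\<in>carrier X. D c (n \<rhd> x)) (x \<lhd> m)) x) x)"
  have G: "G x = D (m * c * n) x - D (c * n) (x \<lhd> m) - (D (m * c) (n \<rhd> x) - D c (n \<rhd> (x \<lhd> m)))"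
    if "x \<in> carrier X" for x
    using that by (simp add: G_def ract_closed)
  have "G x = 0"
  proof (rule essential_separates[OF essential _ _ x])
    show "G \<in> dual_carrier X"
      unfolding G_def by (intro dual_carrier_lincomb dual_lact_closed dual_ract_closed dual_closed)
    fix a b w assume w: "w \<in> carrier X"
    have "D (c * n) (b \<rhd> (w \<lhd> (a * m))) - D (m * (c * n)) (b \<rhd> (w \<lhd> a))
        = D c ((n * b) \<rhd> (w \<lhd> (a * m))) - D (m * c) ((n * b) \<rhd> (w \<lhd> a))"
    proof (rule zero_product_preserving_imp_balanced)
      show "bounded_bilinear (\<lambda>c b. D c (b \<rhd> (w \<lhd> (a * m))) - D (m * c) (b \<rhd> (w \<lhd> a)))"
        by (intro bounded_bilinear_diff bilinear_lact ract_closed w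
            bounded_bilinear.comp1[OF bilinear_lact bounded_linear_mult_right])
      show "D c (b \<rhd> (w \<lhd> (a * m))) - D (m * c) (b \<rhd> (w \<lhd> a)) = 0" if "c * b = 0" for c b
        using left_balanced[OF that w] by simp
      show "D (\<i> *\<^sub>C c) (b \<rhd> (w \<lhd> (a * m))) - D (m * (\<i> *\<^sub>C c)) (b \<rhd> (w \<lhd> a))
          = D c ((\<i> *\<^sub>C b) \<rhd> (w \<lhd> (a * m))) - D (m * c) ((\<i> *\<^sub>C b) \<rhd> (w \<lhd> a))" for c b
        by (simp add: w mult_scaleC_right scale lact_closed ract_closed lact_scaleC dual_carrierD[OF dual_closed])
    qed
    then show "G (b \<rhd> (w \<lhd> a)) = 0"
      by (simp add: G w lact_closed ract_closed lact_ract ract_mult lact_mult mult.assoc)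
        (metis minus_diff_eq)
  qed
  then show ?thesis using G[OF x] by (simp add: algebra_simps)
qed

end

section \<open>Weak-star limits along the approximate identity\<close>

locale unital_bimodule = banach_bimodule X + approximate_identity U
  for X :: "('a::cstar_algebra, 'x) bimodule" (structure) and U :: "'a filter"
begin

lemma U_nontrivial: "U \<noteq> bot"
  using ultra by (simp add: ultrafilter_def)

text \<open>The weak-star limit along the ultrafilter, meaningful for families bounded near
  \<open>U\<close>; the restriction keeps the normalization of the dual.\<close>

definition limit_functional :: "('a \<Rightarrow> 'x \<Rightarrow> complex) \<Rightarrow> 'x \<Rightarrow> complex"
  where "limit_functional F = (\<lambda>x\<in>carrier X. Lim U (\<lambda>e. F e x))"

lemma limit_functional:
  assumes F: "\<And>e. F e \<in> dual_carrier X"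
    and bound: "\<And>e x. norm e \<le> 8 \<Longrightarrow> x \<in> carrier X \<Longrightarrow> cmod (F e x) \<le> K * nrm X x"
  shows tendsto_limit_functional: "x \<in> carrier X \<Longrightarrow> ((\<lambda>e. F e x) \<longlongrightarrow> limit_functional F x) U"
    and limit_functional_bound: "x \<in> carrier X \<Longrightarrow> cmod (limit_functional F x) \<le> K * nrm X x"
    and limit_functional_closed: "limit_functional F \<in> dual_carrier X"
proof -
  have ev: "\<forall>\<^sub>F e in U. cmod (F e x) \<le> K * nrm X x" if "x \<in> carrier X" for x
    using norm_unit by eventually_elim (rule bound[OF _ that])
  show lim: "((\<lambda>e. F e x) \<longlongrightarrow> limit_functional F x) U" if x: "x \<in> carrier X" for x
  proof -
    obtain l where "((\<lambda>e. F e x) \<longlongrightarrow> l) U"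
      using ultrafilter_convergent[OF ultra ev[OF x]] by blast
    moreover from this have "Lim U (\<lambda>e. F e x) = l"
      by (rule tendsto_Lim[OF U_nontrivial])
    ultimately show ?thesis
      using x by (simp add: limit_functional_def)
  qed
  show le: "cmod (limit_functional F x) \<le> K * nrm X x" if x: "x \<in> carrier X" for x
    by (rule tendsto_upperbound[OF tendsto_norm[OF lim[OF x]] ev[OF x] U_nontrivial])
  have "restrict (limit_functional F) (carrier X) \<in> dual_carrier X"
  proof (rule dual_carrierI[OF _ _ le])
    fix x y assume xy: "x \<in> carrier X" "y \<in> carrier X"
    have "((\<lambda>e. F e x + F e y) \<longlongrightarrow> limit_functional F x + limit_functional F y) U"
      by (intro tendsto_add lim xy)
    moreover have "((\<lambda>e. F e x + F e y) \<longlongrightarrow> limit_functional F (x \<oplus> y)) U"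
      using lim[OF add_closed[OF xy]] by (simp add: dual_carrierD(1)[OF F] xy)
    ultimately show "limit_functional F (x \<oplus> y) = limit_functional F x + limit_functional F y"
      using tendsto_unique[OF U_nontrivial] by blast
  next
    fix z x assume x: "x \<in> carrier X"
    have "((\<lambda>e. z * F e x) \<longlongrightarrow> z * limit_functional F x) U"
      by (intro tendsto_mult tendsto_const lim x)
    moreover have "((\<lambda>e. z * F e x) \<longlongrightarrow> limit_functional F (z \<odot> x)) U"
      using lim[OF smult_closed[OF x]] by (simp add: dual_carrierD(2)[OF F] x)
    ultimately show "limit_functional F (z \<odot> x) = z * limit_functional F x"
      using tendsto_unique[OF U_nontrivial] by blast
  qed
  then show "limit_functional F \<in> dual_carrier X"
    by (simp add: limit_functional_def cong: restrict_cong)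
qed

end

context essential_hyperlocal
begin

text \<open>With c along the approximate identity, \<open>hyperlocal_identity\<close> becomes D(a b)
  = a D(b) + D(a) b - a \<xi> b. For d(a) = D(a) - a \<xi>, the terms - a b \<xi> and - a \<xi> b
  are those contained in a d(b) and d(a) b.\<close>

lemma ex_derivation:
  "\<exists>\<xi>\<in>dual_carrier X. bounded_derivation (dual X) (\<lambda>a. \<lambda>x\<in>carrier X. D a x - \<xi> (x \<lhd> a))"
proof -
  obtain U :: "'a filter" where "approximate_identity U" using ex_approximate_identity by blast
  then interpret unital_bimodule X U by (intro unital_bimodule.intro banach_bimodule_axioms)
  obtain K where K: "0 \<le> K" "\<And>a x. x \<in> carrier X \<Longrightarrow> cmod (D a x) \<le> K * norm a * nrm X x"
    using bound by blast
  have K8: "cmod (D e x) \<le> K * 8 * nrm X x" if "norm e \<le> 8" "x \<in> carrier X" for e x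
    using K(2)[OF that(2), of e] mult_right_mono[OF mult_left_mono[OF that(1) K(1)] nrm_nonneg[OF that(2)]]
    by linarith
  define \<xi> where "\<xi> = limit_functional D"
  have \<xi>: "\<xi> \<in> dual_carrier X"
    unfolding \<xi>_def by (rule limit_functional_closed[OF dual_closed K8])
  have lim: "((\<lambda>e. D e x) \<longlongrightarrow> \<xi> x) U" if "x \<in> carrier X" for x
    unfolding \<xi>_def by (rule tendsto_limit_functional[OF dual_closed K8 that])
  have D_mult: "D (a * b) x = D b (x \<lhd> a) + D a (b \<rhd> x) - \<xi> (b \<rhd> (x \<lhd> a))" if x: "x \<in> carrier X" for a b x
  proof (rule tendsto_unique[OF U_nontrivial])
    have xs: "x \<lhd> a \<in> carrier X" "b \<rhd> x \<in> carrier X" "b \<rhd> (x \<lhd> a) \<in> carrier X"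
      using x by (simp_all add: lact_closed ract_closed)
    show "((\<lambda>e. D (a * e * b) x) \<longlongrightarrow> D (a * b) x) U"
      by (intro tendsto_arg x tendsto_mult right_unit tendsto_const)
    show "((\<lambda>e. D (a * e * b) x) \<longlongrightarrow> D b (x \<lhd> a) + D a (b \<rhd> x) - \<xi> (b \<rhd> (x \<lhd> a))) U"
      unfolding hyperlocal_identity[OF x]
      by (intro tendsto_diff tendsto_add tendsto_arg lim xs left_unit right_unit)
  qed
  obtain L where L: "0 \<le> L" "\<And>x. x \<in> carrier X \<Longrightarrow> cmod (\<xi> x) \<le> L * nrm X x"
    using dual_carrier_bound[OF \<xi>] by blast
  obtain R where R: "0 \<le> R" "\<And>a x. x \<in> carrier X \<Longrightarrow> nrm X (x \<lhd> a) \<le> R * norm a * nrm X x"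
    using ract_bound by blast
  let ?d = "\<lambda>a. \<lambda>x\<in>carrier X. D a x - \<xi> (x \<lhd> a)"
  have "bounded_operator (dual X) ?d"
    unfolding bounded_operator_dual_iff
  proof (intro conjI allI ballI exI[of _ "K + L * R"])
    fix a
    show "?d a \<in> dual_carrier X"
      using dual_carrier_lincomb[OF dual_closed dual_lact_closed[OF \<xi>], of a "- 1" a]
      by (simp cong: restrict_cong)
    fix x assume x: "x \<in> carrier X"
    have "cmod (\<xi> (x \<lhd> a)) \<le> L * (R * norm a * nrm X x)"
      using L(2)[OF ract_closed[OF x], of a] mult_left_mono[OF R(2)[OF x, of a] L(1)] by linarith
    then show "cmod (?d a x) \<le> (K + L * R) * norm a * nrm X x"
      using K(2)[OF x, of a] norm_triangle_ineq4[of "D a x" "\<xi> (x \<lhd> a)"] x by (simp add: algebra_simps)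
  qed (use K(1) L(1) R(1) in \<open>simp_all add: add scale ract_add_right ract_scaleC ract_closed
      dual_carrierD[OF \<xi>] algebra_simps\<close>)
  moreover have "?d (a * b) x = ?d b (x \<lhd> a) + ?d a (b \<rhd> x)" if "x \<in> carrier X" for a b x
    using that by (simp add: D_mult ract_closed lact_closed ract_mult lact_ract)
  ultimately show ?thesis
    using \<xi> unfolding bounded_derivation_dual_iff by blast
qed

end

text \<open>If D(a) - a \<xi> = a y - y a, then D(a) = a (\<xi> + y) - y a; the two functionals
  differ by \<xi>.\<close>

lemma amenable_imp_hyperlocal_form:
  fixes X :: "('a::cstar_algebra, 'x) bimodule"
  assumes "amenable TYPE('a) TYPE('x)" "banach_bimodule X" "essential X"
    "bounded_operator (dual X) D" "hyperlocal (dual X) D"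
  shows "\<exists>x'\<in>carrier (dual X). \<exists>y'\<in>carrier (dual X).
    \<forall>a. D a = (a \<rhd>\<^bsub>dual X\<^esub> x') \<ominus>\<^bsub>dual X\<^esub> (y' \<lhd>\<^bsub>dual X\<^esub> a)"
proof -
  interpret essential_hyperlocal X D
    using assms by (simp add: essential_hyperlocal_def essential_hyperlocal_axioms_def dual_operator_def
        dual_operator_axioms_def)
  obtain \<xi> where \<xi>: "\<xi> \<in> dual_carrier X"
    and der: "bounded_derivation (dual X) (\<lambda>a. \<lambda>x\<in>carrier X. D a x - \<xi> (x \<lhd>\<^bsub>X\<^esub> a))"
    using ex_derivation by blast
  have "inner_derivation (dual X) (\<lambda>a. \<lambda>x\<in>carrier X. D a x - \<xi> (x \<lhd>\<^bsub>X\<^esub> a))"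
    using assms(1,2) der unfolding amenable_def by blast
  then obtain y where y: "y \<in> dual_carrier X"
    and eq: "\<forall>a. (\<lambda>x\<in>carrier X. D a x - \<xi> (x \<lhd>\<^bsub>X\<^esub> a)) = (a \<rhd>\<^bsub>dual X\<^esub> y) \<ominus>\<^bsub>dual X\<^esub> (y \<lhd>\<^bsub>dual X\<^esub> a)"
    unfolding inner_derivation_def dual_simps(1) by blast
  have point: "D a x = (\<xi> (x \<lhd>\<^bsub>X\<^esub> a) + 1 * y (x \<lhd>\<^bsub>X\<^esub> a)) - y (a \<rhd>\<^bsub>X\<^esub> x)" if "x \<in> carrier X" for a x
    using fun_cong[OF eq[rule_format, of a], of x] that by (simp add: algebra_simps)
  have "\<forall>a. D a = (a \<rhd>\<^bsub>dual X\<^esub> (\<lambda>x\<in>carrier X. \<xi> x + 1 * y x)) \<ominus>\<^bsub>dual X\<^esub> (y \<lhd>\<^bsub>dual X\<^esub> a)"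
    unfolding dual_bimodule_difference_iff[OF allI[OF dual_closed]]
    by (simp add: point ract_closed)
  then show ?thesis
    unfolding dual_simps(1) using dual_carrier_lincomb[OF \<xi> y, of 1] y by blast
qed

section \<open>The essential part of a bimodule\<close>

context unital_bimodule
begin

lemma nrm_tendsto_0_comparison:
  assumes "\<And>e. w e \<in> carrier X" "\<And>e. nrm X (w e) \<le> K * f e" "(f \<longlongrightarrow> 0) F"
  shows "((\<lambda>e. nrm X (w e)) \<longlongrightarrow> 0) F"
  by (rule Lim_null_comparison[OF _ tendsto_mult_right_zero[OF assms(3)]])
     (use assms(1,2) in \<open>auto simp: nrm_nonneg intro!: always_eventually\<close>)

text \<open>This is the closed linear span of the products a x, in a form from which invariance
  under both actions is read off directly.\<close>

definition left_part :: "'x set"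
  where "left_part = {x \<in> carrier X. ((\<lambda>e. nrm X ((e \<rhd> x) \<ominus> x)) \<longlongrightarrow> 0) U}"

definition right_part :: "'x set"
  where "right_part = {x \<in> carrier X. ((\<lambda>e. nrm X ((x \<lhd> e) \<ominus> x)) \<longlongrightarrow> 0) U}"

lemma tendsto_lact_arg:
  assumes x: "x \<in> carrier X" and g: "(g \<longlongrightarrow> l) F"
  shows "((\<lambda>i. nrm X ((g i \<rhd> x) \<ominus> (l \<rhd> x))) \<longlongrightarrow> 0) F"
proof -
  obtain L where L: "0 \<le> L" "\<And>a x. x \<in> carrier X \<Longrightarrow> nrm X (a \<rhd> x) \<le> L * norm a * nrm X x"
    using lact_bound by blast
  have lim: "((\<lambda>i. norm (g i - l)) \<longlongrightarrow> 0) F"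
    using g by (simp add: Lim_null[of g] tendsto_norm_zero_iff)
  show ?thesis
    unfolding lact_diff_left[OF x, symmetric]
  proof (rule nrm_tendsto_0_comparison[OF _ _ lim])
    show "nrm X ((g i - l) \<rhd> x) \<le> (L * nrm X x) * norm (g i - l)" for i
      using L(2)[OF x, of "g i - l"] by (simp add: mult_ac)
  qed (simp add: lact_closed x)
qed

lemma tendsto_ract_arg:
  assumes x: "x \<in> carrier X" and g: "(g \<longlongrightarrow> l) F"
  shows "((\<lambda>i. nrm X ((x \<lhd> g i) \<ominus> (x \<lhd> l))) \<longlongrightarrow> 0) F"
proof -
  obtain L where L: "0 \<le> L" "\<And>a x. x \<in> carrier X \<Longrightarrow> nrm X (x \<lhd> a) \<le> L * norm a * nrm X x"
    using ract_bound by blast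
  have lim: "((\<lambda>i. norm (g i - l)) \<longlongrightarrow> 0) F"
    using g by (simp add: Lim_null[of g] tendsto_norm_zero_iff)
  show ?thesis
    unfolding ract_diff_right[OF x, symmetric]
  proof (rule nrm_tendsto_0_comparison[OF _ _ lim])
    show "nrm X (x \<lhd> (g i - l)) \<le> (L * nrm X x) * norm (g i - l)" for i
      using L(2)[OF x, of "g i - l"] by (simp add: mult_ac)
  qed (simp add: ract_closed x)
qed

lemma tendsto_lact:
  assumes g: "\<And>i. g i \<in> carrier X" and x: "x \<in> carrier X"
    and lim: "((\<lambda>i. nrm X (g i \<ominus> x)) \<longlongrightarrow> 0) F"
  shows "((\<lambda>i. nrm X ((a \<rhd> g i) \<ominus> (a \<rhd> x))) \<longlongrightarrow> 0) F"
proof -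
  obtain L where L: "0 \<le> L" "\<And>a x. x \<in> carrier X \<Longrightarrow> nrm X (a \<rhd> x) \<le> L * norm a * nrm X x"
    using lact_bound by blast
  show ?thesis
    unfolding lact_diff_right[OF g x, symmetric]
    by (rule nrm_tendsto_0_comparison[OF _ _ lim, where K = "L * norm a"])
       (use L g x in \<open>auto simp: lact_closed diff_closed\<close>)
qed

lemma tendsto_ract:
  assumes g: "\<And>i. g i \<in> carrier X" and x: "x \<in> carrier X"
    and lim: "((\<lambda>i. nrm X (g i \<ominus> x)) \<longlongrightarrow> 0) F"
  shows "((\<lambda>i. nrm X ((g i \<lhd> a) \<ominus> (x \<lhd> a))) \<longlongrightarrow> 0) F"
proof -
  obtain L where L: "0 \<le> L" "\<And>a x. x \<in> carrier X \<Longrightarrow> nrm X (x \<lhd> a) \<le> L * norm a * nrm X x"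
    using ract_bound by blast
  show ?thesis
    unfolding ract_diff_left[OF g x, symmetric]
    by (rule nrm_tendsto_0_comparison[OF _ _ lim, where K = "L * norm a"])
       (use L g x in \<open>auto simp: ract_closed diff_closed\<close>)
qed

lemma lact_left_part: "x \<in> carrier X \<Longrightarrow> a \<rhd> x \<in> left_part"
  using tendsto_lact_arg[OF _ left_unit, of x a] by (simp add: left_part_def lact_closed lact_mult)

lemma ract_right_part: "x \<in> carrier X \<Longrightarrow> x \<lhd> a \<in> right_part"
  using tendsto_ract_arg[OF _ right_unit, of x a] by (simp add: right_part_def ract_closed ract_mult)

lemma ract_left_part: "x \<in> left_part \<Longrightarrow> x \<lhd> a \<in> left_part"
  using tendsto_ract[of "\<lambda>e. e \<rhd> x" x U a]
  by (auto simp: left_part_def lact_closed ract_closed lact_ract)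

lemma lact_right_part: "x \<in> right_part \<Longrightarrow> a \<rhd> x \<in> right_part"
  using tendsto_lact[of "\<lambda>e. x \<lhd> e" x U a]
  by (auto simp: right_part_def lact_closed ract_closed lact_ract)

text \<open>Closedness comes from the uniform bound on \<open>T e\<close> for norm e \<le> 8, which
  holds eventually along \<open>U\<close>. The abstract \<open>T\<close> covers the left and the
  right action alike.\<close>

lemma approximately_fixed_subspace:
  assumes T: "\<And>e x. x \<in> carrier X \<Longrightarrow> T e x \<in> carrier X"
    and T_add: "\<And>e x y. x \<in> carrier X \<Longrightarrow> y \<in> carrier X \<Longrightarrow> T e (x \<oplus> y) = T e x \<oplus> T e y"
    and T_smult: "\<And>e z x. x \<in> carrier X \<Longrightarrow> T e (z \<odot> x) = z \<odot> T e x"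
    and T_bound: "\<And>e x. x \<in> carrier X \<Longrightarrow> nrm X (T e x) \<le> L * norm e * nrm X x" "0 \<le> L"
  defines "P \<equiv> {x \<in> carrier X. ((\<lambda>e. nrm X (T e x \<ominus> x)) \<longlongrightarrow> 0) U}"
  shows "linear_subspace X P"
    and "\<lbrakk>range \<sigma> \<subseteq> P; x \<in> carrier X; (\<lambda>n. nrm X (\<sigma> n \<ominus> x)) \<longlonglongrightarrow> 0\<rbrakk> \<Longrightarrow> x \<in> P"
proof -
  have T0: "T e \<zero> = \<zero>" for e
    using T_smult[OF zero_closed, of e 0] by (simp add: smult_zero_left smult_zero_right T zero_closed)
  show "linear_subspace X P"
    unfolding linear_subspace_def
  proof (intro conjI ballI allI)
    show "\<zero> \<in> P" by (simp add: P_def T0 zero_closed minus_self nrm_zero)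
    fix x assume x: "x \<in> P"
    show "z \<odot> x \<in> P" for z
    proof -
      have "((\<lambda>e. nrm X (T e (z \<odot> x) \<ominus> (z \<odot> x))) \<longlongrightarrow> 0) U"
        using tendsto_mult_right_zero[of "\<lambda>e. nrm X (T e x \<ominus> x)" U "cmod z"] x
        by (simp add: P_def T_smult T diff_closed nrm_smult flip: smult_diff)
      then show ?thesis using x by (simp add: P_def smult_closed)
    qed
    fix y assume y: "y \<in> P"
    have "((\<lambda>e. nrm X (T e (x \<oplus> y) \<ominus> (x \<oplus> y))) \<longlongrightarrow> 0) U"
    proof (rule Lim_null_comparison)
      show "((\<lambda>e. nrm X (T e x \<ominus> x) + nrm X (T e y \<ominus> y)) \<longlongrightarrow> 0) U"
        using x y by (intro tendsto_add_zero) (auto simp: P_def)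
      show "\<forall>\<^sub>F e in U. norm (nrm X (T e (x \<oplus> y) \<ominus> (x \<oplus> y))) \<le> nrm X (T e x \<ominus> x) + nrm X (T e y \<ominus> y)"
        using x y by (auto simp: P_def T_add add_diff_add T nrm_nonneg nrm_triangle diff_closed add_closed
            intro!: always_eventually)
    qed
    then show "x \<oplus> y \<in> P" using x y by (simp add: P_def add_closed)
  qed (auto simp: P_def)
  assume \<sigma>: "range \<sigma> \<subseteq> P" and x: "x \<in> carrier X" and lim: "(\<lambda>n. nrm X (\<sigma> n \<ominus> x)) \<longlonglongrightarrow> 0"
  have \<sigma>c: "\<sigma> n \<in> carrier X" and \<sigma>P: "((\<lambda>e. nrm X (T e (\<sigma> n) \<ominus> \<sigma> n)) \<longlongrightarrow> 0) U" for n
    using \<sigma> by (auto simp: P_def)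
  have "((\<lambda>e. nrm X (T e x \<ominus> x)) \<longlongrightarrow> 0) U"
  proof (rule tendstoI)
    fix \<epsilon> :: real assume \<epsilon>: "0 < \<epsilon>"
    \<comment> \<open>The distance from \<sigma> n to x enters once directly and once through
      \<open>T e\<close>, amplified by at most 8 L; here (8 L + 1) \<delta> = \<epsilon> /
      2.\<close>
    define \<delta> where "\<delta> = \<epsilon> / (2 * (L * 8 + 1))"
    have \<delta>: "0 < \<delta>" using \<epsilon> T_bound(2) by (simp add: \<delta>_def add_nonneg_pos)
    obtain n where n: "nrm X (\<sigma> n \<ominus> x) < \<delta>"
      using order_tendstoD(2)[OF lim \<delta>] by (auto simp: eventually_sequentially)
    have "\<forall>\<^sub>F e in U. nrm X (T e (\<sigma> n) \<ominus> \<sigma> n) < \<epsilon> / 2"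
      by (rule order_tendstoD(2)[OF \<sigma>P]) (use \<epsilon> in simp)
    then show "\<forall>\<^sub>F e in U. dist (nrm X (T e x \<ominus> x)) 0 < \<epsilon>"
      using norm_unit
    proof eventually_elim
      case (elim e)
      have "T e x \<ominus> T e (\<sigma> n) = T e (x \<ominus> \<sigma> n)"
        by (simp add: vdiff_def T_add T_smult x \<sigma>c smult_closed)
      then have "nrm X (T e x \<ominus> T e (\<sigma> n)) \<le> L * norm e * nrm X (x \<ominus> \<sigma> n)"
        by (simp add: T_bound(1) x \<sigma>c diff_closed)
      also have "\<dots> \<le> L * 8 * nrm X (x \<ominus> \<sigma> n)"
        using elim(2) T_bound(2) by (intro mult_right_mono mult_left_mono) (auto simp: nrm_nonneg diff_closed x \<sigma>c)
      finally have "nrm X (T e x \<ominus> x) \<le> L * 8 * nrm X (\<sigma> n \<ominus> x) + (nrm X (T e (\<sigma> n) \<ominus> \<sigma> n) + nrm X (\<sigma> n \<ominus> x))"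
        using nrm_diff_triangle[of "T e x" "T e (\<sigma> n)" x] nrm_diff_triangle[of "T e (\<sigma> n)" "\<sigma> n" x]
        by (simp add: T x \<sigma>c nrm_diff_commute[of x "\<sigma> n"])
      also have "\<dots> = (L * 8 + 1) * nrm X (\<sigma> n \<ominus> x) + nrm X (T e (\<sigma> n) \<ominus> \<sigma> n)"
        by (simp add: algebra_simps)
      also have "\<dots> < (L * 8 + 1) * \<delta> + \<epsilon> / 2"
        using n elim(1) T_bound(2) by (intro add_strict_mono mult_strict_left_mono) auto
      also have "(L * 8 + 1) * \<delta> = \<epsilon> / 2"
        using T_bound(2) by (simp add: \<delta>_def field_simps add_nonneg_eq_0_iff)
      finally show ?case by (simp add: nrm_nonneg diff_closed T x)
    qed
  qed
  then show "x \<in> P" using x by (simp add: P_def)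
qed

lemma left_part_subspace: "linear_subspace X left_part"
  and left_part_closed:
    "\<lbrakk>range \<sigma> \<subseteq> left_part; x \<in> carrier X; (\<lambda>n. nrm X (\<sigma> n \<ominus> x)) \<longlonglongrightarrow> 0\<rbrakk> \<Longrightarrow> x \<in> left_part"
proof -
  obtain L where L: "0 \<le> L" "\<And>a x. x \<in> carrier X \<Longrightarrow> nrm X (a \<rhd> x) \<le> L * norm a * nrm X x"
    using lact_bound by blast
  note * = approximately_fixed_subspace[of "\<lambda>e x. e \<rhd> x", OF lact_closed lact_add_right lact_smult L(2,1),
      folded left_part_def]
  show "linear_subspace X left_part" by (rule *(1))
  show "\<lbrakk>range \<sigma> \<subseteq> left_part; x \<in> carrier X; (\<lambda>n. nrm X (\<sigma> n \<ominus> x)) \<longlonglongrightarrow> 0\<rbrakk> \<Longrightarrow> x \<in> left_part"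
    by (rule *(2))
qed

lemma right_part_subspace: "linear_subspace X right_part"
  and right_part_closed:
    "\<lbrakk>range \<sigma> \<subseteq> right_part; x \<in> carrier X; (\<lambda>n. nrm X (\<sigma> n \<ominus> x)) \<longlonglongrightarrow> 0\<rbrakk> \<Longrightarrow> x \<in> right_part"
proof -
  obtain L where L: "0 \<le> L" "\<And>a x. x \<in> carrier X \<Longrightarrow> nrm X (x \<lhd> a) \<le> L * norm a * nrm X x"
    using ract_bound by blast
  note * = approximately_fixed_subspace[of "\<lambda>e x. x \<lhd> e", OF ract_closed ract_add_left ract_smult L(2,1),
      folded right_part_def]
  show "linear_subspace X right_part" by (rule *(1))
  show "\<lbrakk>range \<sigma> \<subseteq> right_part; x \<in> carrier X; (\<lambda>n. nrm X (\<sigma> n \<ominus> x)) \<longlonglongrightarrow> 0\<rbrakk> \<Longrightarrow> x \<in> right_part"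
    by (rule *(2))
qed

text \<open>Equal to the closed linear span of the elements a x b.\<close>

definition essential_carrier :: "'x set"
  where "essential_carrier = left_part \<inter> right_part"

definition essential_part :: "('a, 'x) bimodule"
  where "essential_part = X\<lparr>carrier := essential_carrier\<rparr>"

lemma essential_part_simps [simp]:
  "carrier essential_part = essential_carrier"
  "\<zero>\<^bsub>essential_part\<^esub> = \<zero>"
  "x \<oplus>\<^bsub>essential_part\<^esub> y = x \<oplus> y"
  "z \<odot>\<^bsub>essential_part\<^esub> x = z \<odot> x"
  "x \<ominus>\<^bsub>essential_part\<^esub> y = x \<ominus> y"
  "nrm essential_part = nrm X"
  "a \<rhd>\<^bsub>essential_part\<^esub> x = a \<rhd> x"
  "x \<lhd>\<^bsub>essential_part\<^esub> a = x \<lhd> a"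
  by (simp_all add: essential_part_def vdiff_def)

lemma essential_carrierD:
  assumes "x \<in> essential_carrier"
  shows "x \<in> carrier X" "((\<lambda>e. nrm X ((e \<rhd> x) \<ominus> x)) \<longlongrightarrow> 0) U" "((\<lambda>e. nrm X ((x \<lhd> e) \<ominus> x)) \<longlongrightarrow> 0) U"
  using assms by (auto simp: essential_carrier_def left_part_def right_part_def)

lemma essential_carrier_lact: "x \<in> essential_carrier \<Longrightarrow> a \<rhd> x \<in> essential_carrier"
  using lact_left_part[OF essential_carrierD(1), of x a] lact_right_part[of x a]
  by (simp add: essential_carrier_def)

lemma essential_carrier_ract: "x \<in> essential_carrier \<Longrightarrow> x \<lhd> a \<in> essential_carrier"
  using ract_right_part[OF essential_carrierD(1), of x a] ract_left_part[of x a]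
  by (simp add: essential_carrier_def)

lemma sandwich_essential: "x \<in> carrier X \<Longrightarrow> a \<rhd> (x \<lhd> b) \<in> essential_carrier"
  by (simp add: essential_carrier_def lact_left_part lact_right_part ract_right_part ract_closed)

lemma essential_part_bimodule: "banach_bimodule essential_part"
proof -
  note subspaces = left_part_subspace right_part_subspace
  have sub: "essential_carrier \<subseteq> carrier X"
    by (auto simp: essential_carrier_def left_part_def)
  have complete_X: "\<exists>x\<in>carrier X. (\<lambda>n. nrm X (\<sigma> n \<ominus> x)) \<longlonglongrightarrow> 0"
    if "range \<sigma> \<subseteq> carrier X" "\<forall>\<epsilon>>0. \<exists>N. \<forall>m\<ge>N. \<forall>n\<ge>N. nrm X (\<sigma> m \<ominus> \<sigma> n) < \<epsilon>" for \<sigma> :: "nat \<Rightarrow> 'x"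
    using mcomplete_subset_iff[of "carrier X"] complete that by auto
  have mc: "Metric_space.mcomplete essential_carrier (vdist essential_part)"
    unfolding essential_part_def mcomplete_subset_iff[OF sub]
  proof (intro allI impI)
    fix \<sigma> :: "nat \<Rightarrow> 'x"
    assume \<sigma>: "range \<sigma> \<subseteq> essential_carrier" "\<forall>\<epsilon>>0. \<exists>N. \<forall>m\<ge>N. \<forall>n\<ge>N. nrm X (\<sigma> m \<ominus> \<sigma> n) < \<epsilon>"
    then obtain x where x: "x \<in> carrier X" "(\<lambda>n. nrm X (\<sigma> n \<ominus> x)) \<longlonglongrightarrow> 0"
      using complete_X sub by blast
    have "x \<in> essential_carrier"
      using \<sigma>(1) left_part_closed[OF _ x] right_part_closed[OF _ x] by (auto simp: essential_carrier_def)
    then show "\<exists>x\<in>essential_carrier. (\<lambda>n. nrm X (\<sigma> n \<ominus> x)) \<longlonglongrightarrow> 0"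
      using x(2) by blast
  qed
  have smult: "z \<odot> x \<in> essential_carrier" if "x \<in> essential_carrier" for z x
    using subspaces that by (auto simp: linear_subspace_def essential_carrier_def)
  have add: "x \<oplus> y \<in> essential_carrier" if "x \<in> essential_carrier" "y \<in> essential_carrier" for x y
    using subspaces that by (auto simp: linear_subspace_def essential_carrier_def)
  have zero: "\<zero> \<in> essential_carrier"
    using subspaces by (auto simp: linear_subspace_def essential_carrier_def)
  note in_X = essential_carrierD(1)
  show ?thesis
  proof (intro banach_bimodule.intro complex_banach_space.intro banach_bimodule_axioms.intro,
      unfold essential_part_simps)
    show "Metric_space.mcomplete essential_carrier (vdist essential_part)" by (rule mc)
    show "\<exists>K. \<forall>a. \<forall>x\<in>essential_carrier. nrm X (a \<rhd> x) \<le> K * norm a * nrm X x"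
      using lact_bounded in_X by blast
    show "\<exists>K. \<forall>a. \<forall>x\<in>essential_carrier. nrm X (x \<lhd> a) \<le> K * norm a * nrm X x"
      using ract_bounded in_X by blast
    show "x \<oplus> y = y \<oplus> x" if "x \<in> essential_carrier" "y \<in> essential_carrier" for x y
      using that by (intro add_commute in_X)
  qed (simp_all add: in_X zero add smult add_assoc add_zero minus_self smult_one smult_smult smult_add_left
      smult_add_right nrm_eq_zero nrm_triangle nrm_smult essential_carrier_lact lact_add_left
      lact_add_right lact_scaleC lact_smult lact_mult essential_carrier_ract ract_add_left ract_add_right
      ract_scaleC ract_smult ract_mult lact_ract)
qed

end

subsection \<open>Derivations vanishing on the essential part\<close>

context unital_bimodule
begin

text \<open>An element x of the essential part is the limit of e x and of x e, which are products
  with a factor from the essential part itself.\<close>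

lemma essential_part_essential: "essential essential_part"
proof -
  interpret E: banach_bimodule essential_part by (rule essential_part_bimodule)
  have "closed_linear_span essential_part S = carrier essential_part"
    if S: "S \<subseteq> essential_carrier" and g: "\<And>x e. x \<in> essential_carrier \<Longrightarrow> g e x \<in> S"
      and lim: "\<And>x. x \<in> essential_carrier \<Longrightarrow> ((\<lambda>e. nrm X (g e x \<ominus> x)) \<longlongrightarrow> 0) U" for S g
    unfolding E.closed_linear_span_eq_carrier_iff
  proof (intro ballI allI impI)
    fix x and \<epsilon> :: real assume x: "x \<in> carrier essential_part" and "0 < \<epsilon>"
    then have "\<forall>\<^sub>F e in U. nrm X (g e x \<ominus> x) < \<epsilon>"
      by (intro order_tendstoD(2)[OF lim]) simp_all
    then obtain e where e: "nrm X (g e x \<ominus> x) < \<epsilon>"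
      using eventually_happens U_nontrivial by blast
    have "g e x \<in> S" using g x by simp
    moreover have "nrm X (x \<ominus> g e x) < \<epsilon>"
      using e E.nrm_diff_commute[of x "g e x"] x \<open>g e x \<in> S\<close> S by auto
    ultimately show "\<exists>y\<in>linear_span essential_part S \<inter> carrier essential_part.
        nrm essential_part (x \<ominus>\<^bsub>essential_part\<^esub> y) < \<epsilon>"
      using E.linear_span_superset[of S] S by auto
  qed
  note span = this
  have "closed_linear_span essential_part {a \<rhd> x | a x. x \<in> essential_carrier} = carrier essential_part"
    by (rule span[where g = "\<lambda>e x. e \<rhd> x"]) (auto simp: essential_carrier_lact essential_carrierD)
  moreover have "closed_linear_span essential_part {x \<lhd> a | a x. x \<in> essential_carrier} = carrier essential_part"
    by (rule span[where g = "\<lambda>e x. x \<lhd> e"]) (auto simp: essential_carrier_ract essential_carrierD)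
  ultimately show ?thesis by (simp add: essential_def)
qed

definition double_limit :: "('a \<Rightarrow> 'a \<Rightarrow> 'x \<Rightarrow> complex) \<Rightarrow> 'x \<Rightarrow> complex"
  where "double_limit F = limit_functional (\<lambda>e. limit_functional (F e))"

text \<open>For fixed e the inner limit can work with a bound that depends on e; only the outer
  limit requires a uniform one, namely 64 C.\<close>

lemma double_limit:
  assumes F: "\<And>e e'. F e e' \<in> dual_carrier X" and C: "0 \<le> C"
    and bound: "\<And>e e' x. x \<in> carrier X \<Longrightarrow> cmod (F e e' x) \<le> C * norm e * norm e' * nrm X x"
  shows double_limit_closed: "double_limit F \<in> dual_carrier X"
    and double_limit_eqI: "\<lbrakk>x \<in> carrier X; \<And>e. ((\<lambda>e'. F e e' x) \<longlongrightarrow> g e) U; (g \<longlongrightarrow> l) U\<rbrakk>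
      \<Longrightarrow> double_limit F x = l"
proof -
  have inner: "cmod (F e e' x) \<le> (C * norm e * 8) * nrm X x" if "norm e' \<le> 8" "x \<in> carrier X" for e e' x
    using bound[OF that(2), of e e'] that C
    by (elim order.trans) (intro mult_right_mono mult_left_mono, auto simp: nrm_nonneg)
  have closed: "limit_functional (F e) \<in> dual_carrier X" for e
    by (rule limit_functional_closed[OF F inner])
  have outer: "cmod (limit_functional (F e) x) \<le> (C * 8 * 8) * nrm X x" if "norm e \<le> 8" "x \<in> carrier X" for e x
  proof -
    have "cmod (limit_functional (F e) x) \<le> (C * norm e * 8) * nrm X x"
      by (rule limit_functional_bound[OF F inner that(2)])
    then show ?thesis
      using that C by (elim order.trans) (intro mult_right_mono mult_left_mono, auto simp: nrm_nonneg)
  qed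
  show "double_limit F \<in> dual_carrier X"
    unfolding double_limit_def by (rule limit_functional_closed[OF closed outer])
  assume x: "x \<in> carrier X" and g: "\<And>e. ((\<lambda>e'. F e e' x) \<longlongrightarrow> g e) U" and l: "(g \<longlongrightarrow> l) U"
  have "limit_functional (F e) x = g e" for e
    by (rule tendsto_unique[OF U_nontrivial tendsto_limit_functional[OF F inner x] g])
  then have "((\<lambda>e. limit_functional (F e) x) \<longlongrightarrow> l) U" using l by simp
  moreover have "((\<lambda>e. limit_functional (F e) x) \<longlongrightarrow> limit_functional (\<lambda>e. limit_functional (F e)) x) U"
    by (rule tendsto_limit_functional[OF closed outer x])
  ultimately show "double_limit F x = l"
    unfolding double_limit_def using tendsto_unique[OF U_nontrivial] by blast
qed

text \<open>The element e x e' lies in the domain of f for every x of the bimodule. For x in the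
  essential part the inner limit of f (e x e') is f (e x) and the outer one is f x.\<close>

lemma ex_essential_extension:
  assumes f: "f \<in> dual_carrier essential_part"
  shows "\<exists>h\<in>dual_carrier X. \<forall>x\<in>essential_carrier. h x = f x"
proof -
  interpret E: banach_bimodule essential_part by (rule essential_part_bimodule)
  define F where "F e e' = (\<lambda>x\<in>carrier X. f (e \<rhd> (x \<lhd> e')))" for e e'
  obtain K where K: "0 \<le> K" "\<And>x. x \<in> essential_carrier \<Longrightarrow> cmod (f x) \<le> K * nrm X x"
    using E.dual_carrier_bound[OF f] by auto
  obtain L where L: "0 \<le> L" "\<And>a x. x \<in> carrier X \<Longrightarrow> nrm X (a \<rhd> x) \<le> L * norm a * nrm X x"
    using lact_bound by blast
  obtain R where R: "0 \<le> R" "\<And>a x. x \<in> carrier X \<Longrightarrow> nrm X (x \<lhd> a) \<le> R * norm a * nrm X x"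
    using ract_bound by blast
  have bound: "cmod (f (e \<rhd> (x \<lhd> e'))) \<le> K * L * R * norm e * norm e' * nrm X x"
    if x: "x \<in> carrier X" for e e' x
  proof -
    have "cmod (f (e \<rhd> (x \<lhd> e'))) \<le> K * nrm X (e \<rhd> (x \<lhd> e'))"
      by (intro K(2) sandwich_essential x)
    also have "\<dots> \<le> K * (L * norm e * nrm X (x \<lhd> e'))"
      by (intro mult_left_mono L(2) ract_closed x K(1))
    also have "\<dots> \<le> K * (L * norm e * (R * norm e' * nrm X x))"
      by (intro mult_left_mono R(2) x K(1)) (simp add: L(1))
    finally show ?thesis by (simp add: mult_ac)
  qed
  note f_lin = E.dual_carrierD(1,2)[OF f, simplified]
  have F: "F e e' \<in> dual_carrier X" for e e'
    unfolding F_def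
    by (rule dual_carrierI[where K = "K * L * R * norm e * norm e'"])
       (simp_all add: bound ract_add_left ract_smult lact_add_right lact_smult ract_closed sandwich_essential f_lin)
  have F_bound: "cmod (F e e' x) \<le> (K * L * R) * norm e * norm e' * nrm X x" if "x \<in> carrier X" for e e' x
    using bound[OF that] that by (simp add: F_def)
  have C: "0 \<le> K * L * R" using K(1) L(1) R(1) by simp
  have "double_limit F x = f x" if x: "x \<in> essential_carrier" for x
  proof (rule double_limit_eqI[OF F C F_bound essential_carrierD(1)[OF x]])
    note xc = essential_carrierD(1)[OF x]
    show "((\<lambda>e'. F e e' x) \<longlongrightarrow> f (e \<rhd> x)) U" for e
      using E.tendsto_functional[OF f, of "\<lambda>e'. e \<rhd> (x \<lhd> e')" "e \<rhd> x" U]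
        tendsto_lact[OF _ _ essential_carrierD(3)[OF x], of e]
      by (simp add: F_def xc ract_closed sandwich_essential essential_carrier_lact x)
    show "((\<lambda>e. f (e \<rhd> x)) \<longlongrightarrow> f x) U"
      using E.tendsto_functional[OF f, of "\<lambda>e. e \<rhd> x" x U] essential_carrierD(2)[OF x]
      by (simp add: essential_carrier_lact x)
  qed
  then show ?thesis using double_limit_closed[OF F C F_bound] by blast
qed

end

locale dual_derivation = unital_bimodule X U + dual_operator X D
  for X :: "('a::cstar_algebra, 'x) bimodule" (structure) and U :: "'a filter"
    and D :: "'a \<Rightarrow> 'x \<Rightarrow> complex" +
  assumes derivation: "x \<in> carrier X \<Longrightarrow> D (a * b) x = D b (x \<lhd> a) + D a (b \<rhd> x)"
begin

text \<open>The limit is wanted as a continuous function of a, because the approximate identity is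
  later inserted into its argument.\<close>

lemma ex_arg_limit:
  assumes w: "\<And>e. w e \<in> carrier X" and M: "0 \<le> M" "\<And>e. norm e \<le> 8 \<Longrightarrow> nrm X (w e) \<le> M"
  shows "\<exists>p. bounded_linear p \<and> (\<forall>a. ((\<lambda>e. D a (w e)) \<longlongrightarrow> p a) U)"
proof -
  obtain K where K: "0 \<le> K" "\<And>a x. x \<in> carrier X \<Longrightarrow> cmod (D a x) \<le> K * norm a * nrm X x"
    using bound by blast
  have ev: "\<forall>\<^sub>F e in U. cmod (D a (w e)) \<le> norm a * (K * M)" for a
    using norm_unit
  proof eventually_elim
    case (elim e)
    have "cmod (D a (w e)) \<le> K * norm a * nrm X (w e)" by (rule K(2)[OF w])
    also have "\<dots> \<le> K * norm a * M" using K(1) M(2)[OF elim] by (intro mult_left_mono) auto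
    finally show ?case by (simp add: mult_ac)
  qed
  have "\<forall>a. \<exists>l. ((\<lambda>e. D a (w e)) \<longlongrightarrow> l) U"
    using ultrafilter_convergent[OF ultra ev] by blast
  then obtain p where p: "\<And>a. ((\<lambda>e. D a (w e)) \<longlongrightarrow> p a) U" by metis
  have "bounded_linear p"
  proof (rule bounded_linear_intro)
    show "norm (p a) \<le> norm a * (K * M)" for a
      by (rule tendsto_upperbound[OF tendsto_norm[OF p] ev U_nontrivial])
    show "p (a + b) = p a + p b" for a b
      using tendsto_unique[OF U_nontrivial p[of "a + b"]] tendsto_add[OF p[of a] p[of b]]
      by (simp add: add w)
    show "p (r *\<^sub>R a) = r *\<^sub>R p a" for r a
      using tendsto_unique[OF U_nontrivial p[of "r *\<^sub>R a"]] tendsto_mult_left[OF p[of a], of "of_real r"]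
      by (simp add: scaleR_scaleC scale w scaleR_conv_of_real)
  qed
  then show ?thesis using p by blast
qed

(* With p and q the limits of D a (x e) and D a (e x), the functionals y2 and y3 satisfy
   y2 (x a) = D a x - q a, y3 (a x) = D a x - p a and y2 (a x) = y3 (x a) = 0, while p + q = D(-) x. *)
lemma vanishing_imp_inner:
  assumes vanish: "\<And>a x. x \<in> essential_carrier \<Longrightarrow> D a x = 0"
  shows "\<exists>y\<in>dual_carrier X. \<forall>a. \<forall>x\<in>carrier X. D a x = y (x \<lhd> a) - y (a \<rhd> x)"
proof -
  obtain K where K: "0 \<le> K" "\<And>a x. x \<in> carrier X \<Longrightarrow> cmod (D a x) \<le> K * norm a * nrm X x"
    using bound by blast
  obtain L where L: "0 \<le> L" "\<And>a x. x \<in> carrier X \<Longrightarrow> nrm X (a \<rhd> x) \<le> L * norm a * nrm X x"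
    using lact_bound by blast
  obtain R where R: "0 \<le> R" "\<And>a x. x \<in> carrier X \<Longrightarrow> nrm X (x \<lhd> a) \<le> R * norm a * nrm X x"
    using ract_bound by blast
  \<comment> \<open>In the dual these are e' D(e) and D(e) e'.\<close>
  define F2 F3 where "F2 e e' = (\<lambda>x\<in>carrier X. D e (x \<lhd> e'))" and "F3 e e' = (\<lambda>x\<in>carrier X. D e (e' \<rhd> x))" for e e'
  have F2: "F2 e e' \<in> dual_carrier X" and F3: "F3 e e' \<in> dual_carrier X" for e e'
    unfolding F2_def F3_def by (intro dual_lact_closed dual_ract_closed dual_closed)+
  have B2: "cmod (F2 e e' x) \<le> (K * R) * norm e * norm e' * nrm X x" if x: "x \<in> carrier X" for e e' x
    using order.trans[OF K(2)[OF ract_closed[OF x], of e e'] mult_left_mono[OF R(2)[OF x, of e'], of "K * norm e"]]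
      K(1) x by (simp add: F2_def mult_ac)
  have B3: "cmod (F3 e e' x) \<le> (K * L) * norm e * norm e' * nrm X x" if x: "x \<in> carrier X" for e e' x
    using order.trans[OF K(2)[OF lact_closed[OF x], of e e'] mult_left_mono[OF L(2)[OF x, of e'], of "K * norm e"]]
      K(1) x by (simp add: F3_def mult_ac)
  have C2: "0 \<le> K * R" and C3: "0 \<le> K * L" using K(1) L(1) R(1) by simp_all
  define y2 y3 where "y2 = double_limit F2" and "y3 = double_limit F3"
  have y: "y2 \<in> dual_carrier X" "y3 \<in> dual_carrier X"
    unfolding y2_def y3_def using double_limit_closed[OF F2 C2 B2] double_limit_closed[OF F3 C3 B3] by blast+
  have main: "D a x = (y2 (x \<lhd> a) - y3 (x \<lhd> a)) - (y2 (a \<rhd> x) - y3 (a \<rhd> x))" if x: "x \<in> carrier X" for a x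
  proof -
    have xs: "x \<lhd> b \<in> carrier X" "b \<rhd> x \<in> carrier X" for b
      using x by (simp_all add: lact_closed ract_closed)
    have "\<exists>p. bounded_linear p \<and> (\<forall>a. ((\<lambda>e. D a (x \<lhd> e)) \<longlongrightarrow> p a) U)"
    proof (rule ex_arg_limit[where M = "R * 8 * nrm X x"])
      show "nrm X (x \<lhd> e) \<le> R * 8 * nrm X x" if "norm e \<le> 8" for e
        using R(2)[OF x, of e] that R(1) x
        by (elim order.trans) (intro mult_right_mono mult_left_mono, auto simp: nrm_nonneg)
    qed (use R(1) x in \<open>simp_all add: nrm_nonneg ract_closed\<close>)
    then obtain p where p: "bounded_linear p" "\<And>a. ((\<lambda>e. D a (x \<lhd> e)) \<longlongrightarrow> p a) U" by blast
    have "\<exists>p. bounded_linear p \<and> (\<forall>a. ((\<lambda>e. D a (e \<rhd> x)) \<longlongrightarrow> p a) U)"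
    proof (rule ex_arg_limit[where M = "L * 8 * nrm X x"])
      show "nrm X (e \<rhd> x) \<le> L * 8 * nrm X x" if "norm e \<le> 8" for e
        using L(2)[OF x, of e] that L(1) x
        by (elim order.trans) (intro mult_right_mono mult_left_mono, auto simp: nrm_nonneg)
    qed (use L(1) x in \<open>simp_all add: nrm_nonneg lact_closed\<close>)
    then obtain q where q: "bounded_linear q" "\<And>a. ((\<lambda>e. D a (e \<rhd> x)) \<longlongrightarrow> q a) U" by blast
    have ract_lim: "((\<lambda>e. D a (x \<lhd> (b * e))) \<longlongrightarrow> D a (x \<lhd> b)) U"
      "((\<lambda>e. D a (x \<lhd> (e * b))) \<longlongrightarrow> D a (x \<lhd> b)) U" for a b
      by (intro tendsto_functional[OF dual_closed] xs tendsto_ract_arg x right_unit left_unit)+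
    have lact_lim: "((\<lambda>e. D a ((b * e) \<rhd> x)) \<longlongrightarrow> D a (b \<rhd> x)) U"
      "((\<lambda>e. D a ((e * b) \<rhd> x)) \<longlongrightarrow> D a (b \<rhd> x)) U" for a b
      by (intro tendsto_functional[OF dual_closed] xs tendsto_lact_arg x right_unit left_unit)+
    \<comment> \<open>In the Leibniz rule for D(b c) at x e, the term D b (c x e) vanishes because c
      x e lies in the essential part. The other term D c (x e b) tends to D c (x b).\<close>
    have p_prod: "p (b * c) = D c (x \<lhd> b)" for b c
    proof (rule tendsto_unique[OF U_nontrivial p(2)])
      have "D (b * c) (x \<lhd> e) = D c (x \<lhd> (e * b))" for e
        using derivation[OF xs(1), of b c e] vanish[OF sandwich_essential[OF x], of b c e]
        by (simp add: ract_mult x)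
      then show "((\<lambda>e. D (b * c) (x \<lhd> e)) \<longlongrightarrow> D c (x \<lhd> b)) U"
        using ract_lim(2) by simp
    qed
    have q_prod: "q (b * c) = D b (c \<rhd> x)" for b c
    proof (rule tendsto_unique[OF U_nontrivial q(2)])
      have "D (b * c) (e \<rhd> x) = D b ((c * e) \<rhd> x)" for e
        using derivation[OF xs(2), of b c e] vanish[OF sandwich_essential[OF x], of c e b]
        by (simp add: lact_mult lact_ract x)
      then show "((\<lambda>e. D (b * c) (e \<rhd> x)) \<longlongrightarrow> D b (c \<rhd> x)) U"
        using lact_lim(1) by simp
    qed
    \<comment> \<open>The Leibniz rule splits D(a e) at x into D e (x a) = p (a e) and D a (e x) = q
      (a e); continuity of p and q gives the limit.\<close>
    have pq: "D a x = p a + q a"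
    proof (rule tendsto_unique[OF U_nontrivial])
      show "((\<lambda>e. D (a * e) x) \<longlongrightarrow> D a x) U"
        by (intro tendsto_arg x right_unit)
      show "((\<lambda>e. D (a * e) x) \<longlongrightarrow> p a + q a) U"
        unfolding derivation[OF x] p_prod[symmetric] q_prod[symmetric]
        by (intro tendsto_add bounded_linear.tendsto[OF p(1)] bounded_linear.tendsto[OF q(1)] right_unit)
    qed
    have "y2 (x \<lhd> a) = D a x - q a"
      unfolding y2_def
    proof (rule double_limit_eqI[OF F2 C2 B2 xs(1)])
      show "((\<lambda>e'. F2 e e' (x \<lhd> a)) \<longlongrightarrow> D e (x \<lhd> a)) U" for e
        using ract_lim(1)[of e a] by (simp add: F2_def xs ract_mult x)
      have "D e (x \<lhd> a) = D (a * e) x - D a (e \<rhd> x)" for e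
        by (simp add: derivation x)
      then show "((\<lambda>e. D e (x \<lhd> a)) \<longlongrightarrow> D a x - q a) U"
        by (simp add: tendsto_diff tendsto_arg x right_unit q(2))
    qed
    moreover have "y3 (a \<rhd> x) = D a x - p a"
      unfolding y3_def
    proof (rule double_limit_eqI[OF F3 C3 B3 xs(2)])
      show "((\<lambda>e'. F3 e e' (a \<rhd> x)) \<longlongrightarrow> D e (a \<rhd> x)) U" for e
        using lact_lim(2)[of e a] by (simp add: F3_def xs lact_mult x)
      have "D e (a \<rhd> x) = D (e * a) x - D a (x \<lhd> e)" for e
        by (simp add: derivation x)
      then show "((\<lambda>e. D e (a \<rhd> x)) \<longlongrightarrow> D a x - p a) U"
        by (simp add: tendsto_diff tendsto_arg x left_unit p(2))
    qed
    moreover have "y2 (a \<rhd> x) = 0"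
      unfolding y2_def
      by (rule double_limit_eqI[OF F2 C2 B2 xs(2), where g = "\<lambda>_. 0"])
         (simp_all add: F2_def xs lact_ract x vanish sandwich_essential)
    moreover have "y3 (x \<lhd> a) = 0"
      unfolding y3_def
      by (rule double_limit_eqI[OF F3 C3 B3 xs(1), where g = "\<lambda>_. 0"])
         (simp_all add: F3_def xs x vanish sandwich_essential)
    \<comment> \<open>For y = y2 - y3 the difference y (x a) - y (a x) is (D a x - q a) + (D a x - p
      a), that is, 2 D a x - D a x.\<close>
    ultimately show ?thesis using pq by simp
  qed
  have "(\<lambda>x\<in>carrier X. y2 x + (- 1) * y3 x) \<in> dual_carrier X"
    by (rule dual_carrier_lincomb[OF y])
  then show ?thesis
    by (rule bexI[rotated]) (simp add: main lact_closed ract_closed)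
qed

end

section \<open>Reduction of a derivation to the essential part\<close>

context dual_derivation
begin

definition restricted :: "'a \<Rightarrow> 'x \<Rightarrow> complex"
  where "restricted a = restrict (D a) essential_carrier"

lemma restricted_operator: "bounded_operator (dual essential_part) restricted"
proof -
  interpret E: banach_bimodule essential_part by (rule essential_part_bimodule)
  obtain K where K: "0 \<le> K" "\<And>a x. x \<in> carrier X \<Longrightarrow> cmod (D a x) \<le> K * norm a * nrm X x"
    using bound by blast
  have "restrict (D a) (carrier essential_part) \<in> dual_carrier essential_part" for a
    by (rule E.dual_carrierI[where K = "K * norm a"])
       (use K(2) essential_carrierD(1) in \<open>auto simp: dual_carrierD[OF dual_closed]\<close>)
  moreover have "restricted a x = D a x" if "x \<in> essential_carrier" for a x
    using that by (simp add: restricted_def)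
  ultimately show ?thesis
    unfolding E.bounded_operator_dual_iff
    using K essential_carrierD(1) by (auto simp: add scale restricted_def intro!: exI[of _ K])
qed

text \<open>By the Leibniz rule a D(c) b = D(a c) b - D(a) (c b), and both terms vanish.\<close>

lemma restricted_hyperlocal: "hyperlocal (dual essential_part) restricted"
  unfolding hyperlocal_def
proof (intro allI impI)
  fix a b c :: 'a assume "a * c = 0 \<and> c * b = 0"
  then have ac: "a * c = 0" and cb: "c * b = 0" by auto
  have "D c ((b \<rhd> x) \<lhd> a) = 0" if x: "x \<in> essential_carrier" for x
  proof -
    have bx: "b \<rhd> x \<in> carrier X" using essential_carrierD(1)[OF x] by (simp add: lact_closed)
    have "c \<rhd> (b \<rhd> x) = \<zero>"
      using cb essential_carrierD(1)[OF x] lact_mult[of x c b] by (simp add: lact_zero)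
    then show ?thesis
      using derivation[OF bx, of a c] ac bx by (simp add: zero dual_carrier_zero[OF dual_closed])
  qed
  then show "(a \<rhd>\<^bsub>dual essential_part\<^esub> restricted c) \<lhd>\<^bsub>dual essential_part\<^esub> b = \<zero>\<^bsub>dual essential_part\<^esub>"
    by (auto simp: restricted_def essential_carrier_lact essential_carrier_ract intro!: restrict_ext)
qed

text \<open>Comparing the form a f - g a with the Leibniz rule leaves a (f - g) b = 0, so f - g
  vanishes at all points b x a and is zero by essentiality.\<close>

lemma ex_inner_on_essential:
  assumes "bounded_operator (dual essential_part) restricted \<Longrightarrow> hyperlocal (dual essential_part) restricted \<Longrightarrow>
    \<exists>f\<in>carrier (dual essential_part). \<exists>g\<in>carrier (dual essential_part).
      \<forall>a. restricted a = (a \<rhd>\<^bsub>dual essential_part\<^esub> f) \<ominus>\<^bsub>dual essential_part\<^esub> (g \<lhd>\<^bsub>dual essential_part\<^esub> a)"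
  shows "\<exists>g\<in>dual_carrier essential_part. \<forall>a. \<forall>x\<in>essential_carrier. D a x = g (x \<lhd> a) - g (a \<rhd> x)"
proof -
  interpret E: banach_bimodule essential_part by (rule essential_part_bimodule)
  obtain f g where f: "f \<in> dual_carrier essential_part" and g: "g \<in> dual_carrier essential_part"
    and "\<forall>a. restricted a = (a \<rhd>\<^bsub>dual essential_part\<^esub> f) \<ominus>\<^bsub>dual essential_part\<^esub> (g \<lhd>\<^bsub>dual essential_part\<^esub> a)"
    using assms[OF restricted_operator restricted_hyperlocal] unfolding dual_simps(1) by blast
  then have "\<forall>a. \<forall>x\<in>essential_carrier. restricted a x = f (x \<lhd> a) - g (a \<rhd> x)"
    using restricted_operator E.dual_bimodule_difference_iff[of restricted f g]
    by (simp add: E.bounded_operator_dual_iff)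
  then have fg: "D a x = f (x \<lhd> a) - g (a \<rhd> x)" if "x \<in> essential_carrier" for a x
    using that by (simp add: restricted_def)
  have "(\<lambda>x\<in>carrier essential_part. f x + (- 1) * g x) x = 0" if "x \<in> essential_carrier" for x
  proof (rule E.essential_separates[OF essential_part_essential E.dual_carrier_lincomb[OF f g]])
    fix a b x assume "x \<in> carrier essential_part"
    then have x: "x \<in> essential_carrier" by simp
    note xs = essential_carrierD(1)[OF x] essential_carrier_lact[OF x] essential_carrier_ract[OF x]
    have "f (b \<rhd> (x \<lhd> a)) = g (b \<rhd> (x \<lhd> a))"
      using derivation[OF xs(1), of a b] by (simp add: fg xs x lact_ract lact_mult ract_mult)
    then show "(\<lambda>x\<in>carrier essential_part. f x + (- 1) * g x) (b \<rhd>\<^bsub>essential_part\<^esub> (x \<lhd>\<^bsub>essential_part\<^esub> a)) = 0"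
      by (simp add: xs essential_carrier_lact)
  qed (simp add: that)
  then have "f x = g x" if "x \<in> essential_carrier" for x
    using that by fastforce
  then show ?thesis using g fg essential_carrier_ract by auto
qed

text \<open>Subtracting the inner derivation given by an extension h of g leaves a derivation that
  vanishes on the essential part and hence is implemented by some y; then h + y implements
  D.\<close>

lemma inner_if_inner_on_essential:
  assumes g: "g \<in> dual_carrier essential_part"
    and eq: "\<And>a x. x \<in> essential_carrier \<Longrightarrow> D a x = g (x \<lhd> a) - g (a \<rhd> x)"
  shows "inner_derivation (dual X) D"
proof -
  obtain h where h: "h \<in> dual_carrier X" and hg: "\<And>x. x \<in> essential_carrier \<Longrightarrow> h x = g x"
    using ex_essential_extension[OF g] by blast
  define D' where "D' a = (\<lambda>x\<in>carrier X. D a x + (- 1) * (\<lambda>x\<in>carrier X.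
    (\<lambda>x\<in>carrier X. h (x \<lhd> a)) x + (- 1) * (\<lambda>x\<in>carrier X. h (a \<rhd> x)) x) x)" for a
  have D': "D' a x = D a x - (h (x \<lhd> a) - h (a \<rhd> x))" if "x \<in> carrier X" for a x
    using that by (simp add: D'_def)
  obtain K where K: "0 \<le> K" "\<And>a x. x \<in> carrier X \<Longrightarrow> cmod (D a x) \<le> K * norm a * nrm X x"
    using bound by blast
  obtain H where H: "0 \<le> H" "\<And>x. x \<in> carrier X \<Longrightarrow> cmod (h x) \<le> H * nrm X x"
    using dual_carrier_bound[OF h] by blast
  obtain L where L: "0 \<le> L" "\<And>a x. x \<in> carrier X \<Longrightarrow> nrm X (a \<rhd> x) \<le> L * norm a * nrm X x"
    using lact_bound by blast
  obtain R where R: "0 \<le> R" "\<And>a x. x \<in> carrier X \<Longrightarrow> nrm X (x \<lhd> a) \<le> R * norm a * nrm X x"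
    using ract_bound by blast
  have "bounded_operator (dual X) D'"
    unfolding bounded_operator_dual_iff
  proof (intro conjI allI ballI exI[of _ "K + H * R + H * L"])
    fix a
    show "D' a \<in> dual_carrier X"
      unfolding D'_def by (intro dual_carrier_lincomb dual_lact_closed dual_ract_closed dual_closed h)
    fix x assume x: "x \<in> carrier X"
    have "cmod (h (x \<lhd> a)) \<le> H * (R * norm a * nrm X x)"
      using order.trans[OF H(2)[OF ract_closed[OF x]] mult_left_mono[OF R(2)[OF x] H(1)]] .
    moreover have "cmod (h (a \<rhd> x)) \<le> H * (L * norm a * nrm X x)"
      using order.trans[OF H(2)[OF lact_closed[OF x]] mult_left_mono[OF L(2)[OF x] H(1)]] .
    ultimately show "cmod (D' a x) \<le> (K + H * R + H * L) * norm a * nrm X x"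
      using K(2)[OF x, of a] norm_triangle_ineq4[of "D a x" "h (x \<lhd> a) - h (a \<rhd> x)"]
        norm_triangle_ineq4[of "h (x \<lhd> a)" "h (a \<rhd> x)"]
      by (simp add: D'[OF x] algebra_simps)
  qed (use K(1) H(1) L(1) R(1) in \<open>simp_all add: D' add scale ract_add_right ract_scaleC ract_closed
      lact_add_left lact_scaleC lact_closed dual_carrierD[OF h] algebra_simps\<close>)
  moreover have "D' (a * b) x = D' b (x \<lhd> a) + D' a (b \<rhd> x)" if x: "x \<in> carrier X" for a b x
    using x by (simp add: D' derivation ract_closed lact_closed ract_mult lact_mult lact_ract)
  ultimately interpret D': dual_derivation X U D'
    by unfold_locales
  obtain y where y: "y \<in> dual_carrier X"
    and yD: "\<And>a x. x \<in> carrier X \<Longrightarrow> D' a x = y (x \<lhd> a) - y (a \<rhd> x)"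
    using D'.vanishing_imp_inner
    by (metis (no_types, lifting) D' diff_self eq hg essential_carrierD(1) essential_carrier_lact essential_carrier_ract)
  have "D a x = (\<lambda>x\<in>carrier X. h x + 1 * y x) (x \<lhd> a) - (\<lambda>x\<in>carrier X. h x + 1 * y x) (a \<rhd> x)"
    if x: "x \<in> carrier X" for a x
    using D'[OF x, of a] yD[OF x, of a] x by (simp add: lact_closed ract_closed algebra_simps)
  then have "\<forall>a. D a = (a \<rhd>\<^bsub>dual X\<^esub> (\<lambda>x\<in>carrier X. h x + 1 * y x))
      \<ominus>\<^bsub>dual X\<^esub> ((\<lambda>x\<in>carrier X. h x + 1 * y x) \<lhd>\<^bsub>dual X\<^esub> a)"
    using dual_bimodule_difference_iff[of D] dual_closed by blast
  then show ?thesis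
    unfolding inner_derivation_def dual_simps(1) using dual_carrier_lincomb[OF h y, of 1] by blast
qed

end

theorem corollary5p2:
  shows "amenable TYPE('a::cstar_algebra) TYPE('x) \<longleftrightarrow>
    (\<forall>(X :: ('a, 'x) bimodule) D.
      banach_bimodule X \<longrightarrow> essential X \<longrightarrow> bounded_operator (dual X) D \<longrightarrow> hyperlocal (dual X) D \<longrightarrow>
      (\<exists>x'\<in>carrier (dual X). \<exists>y'\<in>carrier (dual X).
        \<forall>a. D a = (a \<rhd>\<^bsub>dual X\<^esub> x') \<ominus>\<^bsub>dual X\<^esub> (y' \<lhd>\<^bsub>dual X\<^esub> a)))"
  (is "_ \<longleftrightarrow> ?form")
proof
  assume "amenable TYPE('a) TYPE('x)"
  then show ?form
    by (intro allI impI) (rule amenable_imp_hyperlocal_form)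
next
  assume form: ?form
  show "amenable TYPE('a) TYPE('x)"
    unfolding amenable_def
  proof (intro allI impI)
    fix X :: "('a, 'x) bimodule" and D
    assume X: "banach_bimodule X" and D: "bounded_derivation (dual X) D"
    obtain U :: "'a filter" where U: "approximate_identity U" using ex_approximate_identity by blast
    interpret dual_derivation X U D
      using X D U by (simp add: dual_derivation_def dual_derivation_axioms_def unital_bimodule_def
          dual_operator_def dual_operator_axioms_def banach_bimodule.bounded_derivation_dual_iff)
    \<comment> \<open>The essential part has the same underlying type as X, so the hypothesis for
      the universe \<open>'x\<close> applies to it.\<close>
    obtain g where "g \<in> dual_carrier essential_part"
      and "\<forall>a. \<forall>x\<in>essential_carrier. D a x = g (x \<lhd>\<^bsub>X\<^esub> a) - g (a \<rhd>\<^bsub>X\<^esub> x)"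
      using ex_inner_on_essential form[rule_format, OF essential_part_bimodule essential_part_essential] by blast
    then show "inner_derivation (dual X) D"
      by (intro inner_if_inner_on_essential) auto
  qed
qed

end
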